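(* Let $E(k,\ell)$ denote the elliptic curve $$y^2=4x^3-27(k^4-16k^2+16)\ell^2x+27\left(k^6-24k^4+120k^2+64\right)\ell^3 .$$ (1) The identity $11\,m(1)=m(16)$ is equivalent to $$11\,D^{E_1}(P_1)=6\,D^{E_2}(P_2),$$ where $E_1=E(5,2)$, $E_2=E(16,1/2)$, $P_1=(87,1080)\in E_1$ and $P_2=(195,432)\in E_2$. (2) The identity $4\,m(2)=m(8)$ is equivalent to $$5\,D^{E_3}(P_3)=8\,D^{E_4}(P_4),$$ where $E_3=E(8,1/2)$, $E_4=E(3\sqrt2,1)$, $P_3=(51,216)\in E_3$ and $P_4=(33,324)\in E_4$.
   Context: For real $\alpha$, $m(\alpha):=\int_0^1\int_0^1\log\left|\alpha+x+x^{-1}+y+y^{-1}\right|\,d\theta_1d\theta_2$ with $x=e^{2\pi i\theta_1}$, $y=e^{2\pi i\theta_2}$ (the logarithmic Mahler measure of $\alpha+x+x^{-1}+y+y^{-1}$). $D$ is the Bloch-Wigner dilogarithm $D(z)=\operatorname{Im}\left(\operatorname{Li}_2(z)+\log|z|\log(1-z)\right)$ (principal branches on $\mathbb{C}\setminus[1,\infty)$), extended continuously to $\mathbb{C}\cup\{\infty\}$ (so $D(0)=D(1)=D(\infty)=0$). Elliptic dilogarithm: let $E:y^2=4x^3-g_2x-g_3$ be an elliptic curve parameterized by $(x,y)=(\wp(u),\wp'(u))$, where $\wp$ is the Weierstrass function with period lattice generated by $\omega,\omega'$, and $\tau=\omega'/\omega$ has $\operatorname{Im}\tau>0$; put $q=e^{2\pi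 i\tau}$. For $P=(\wp(u),\wp'(u))$ on $E$, define $D^E(P):=\sum_{n\in\mathbb{Z}}D\left(e^{2\pi iu/\omega}q^n\right)$ (this does not depend on the choice of $u$ modulo the lattice). For the curves considered here, $g_2,g_3$ are real and $g_2^3-27g_3^2>0$, and the periods are chosen with $\omega$ the real period and $\omega'$ purely imaginary. *)

theory Defs
  imports "HOL-Complex_Analysis.Complex_Analysis"
begin

section \<open>Mahler measure\<close>

text \<open>
  The integrand is \<^term>\<open>ln (0::real)\<close> \<open>= 0\<close> on the zero set of the polynomial. This set
  has measure zero, so the convention does not affect the integral.
\<close>

definition mahler :: "real \<Rightarrow> real" where
  "mahler \<alpha> =
     (LBINT s:{0..1}. LBINT t:{0..1}.
        (let x = exp (2 * of_real pi * \<i> * of_real s);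
             y = exp (2 * of_real pi * \<i> * of_real t)
         in ln (cmod (of_real \<alpha> + x + inverse x + y + inverse y))))"


section \<open>The Bloch--Wigner dilogarithm\<close>

definition branch_cut :: "complex set" where
  "branch_cut = complex_of_real ` {1..}"

text \<open>
  Principal branch of the dilogarithm on the complement of the cut. The integrand has a removable
  singularity at the origin.
\<close>

definition Li2 :: "complex \<Rightarrow> complex" where
  "Li2 z = - contour_integral (linepath 0 z) (\<lambda>w. Ln (1 - w) / w)"

text \<open>
  The continuous extension to the cut is a limit from outside the cut. At \<open>z = 0\<close> the formula
  already yields the continuous value \<open>0\<close>, since \<open>ln 0 = 0\<close> and \<open>Ln 1 = 0\<close>. The value at infinity
  is never needed, because \<open>D\<close> is only evaluated at finite nonzero arguments.
\<close>

definition bloch_wigner :: "complex \<Rightarrow> real" where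
  "bloch_wigner z =
     (let f = (\<lambda>w. Im (Li2 w + of_real (ln (cmod w)) * Ln (1 - w)))
      in if z \<in> branch_cut then Lim (at z within - branch_cut) f else f z)"


section \<open>Weierstrass curves and the elliptic dilogarithm\<close>

definition period_lattice :: "complex \<Rightarrow> complex \<Rightarrow> complex set" where
  "period_lattice \<omega> \<omega>' = {of_int m * \<omega> + of_int n * \<omega>' | m n. True}"

definition weierstrass_p :: "complex \<Rightarrow> complex \<Rightarrow> complex \<Rightarrow> complex" where
  "weierstrass_p \<omega> \<omega>' u =
     1 / u ^ 2 + (\<Sum>\<^sub>\<infinity>v\<in>period_lattice \<omega> \<omega>' - {0}. 1 / (u - v) ^ 2 - 1 / v ^ 2)"

datatype weierstrass_curve = Weierstrass (g2: real) (g3: real)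

text \<open>The affine points; the point at infinity corresponds to the lattice points.\<close>

definition affine_points :: "weierstrass_curve \<Rightarrow> (complex \<times> complex) set" where
  "affine_points E =
     {(x, y). y ^ 2 = 4 * x ^ 3 - of_real (g2 E) * x - of_real (g3 E)}"

text \<open>
  \<open>\<omega>\<close> is the positive real period and \<open>\<omega>'\<close> is purely imaginary in the upper half plane. The sign
  of \<open>\<omega>\<close> has to be fixed: replacing \<open>(\<omega>, \<omega>')\<close> by \<open>(-\<omega>, -\<omega>')\<close> preserves \<open>\<tau>\<close> but turns the
  elliptic dilogarithm into its negative.
\<close>

definition rectangular_periods :: "weierstrass_curve \<Rightarrow> complex \<Rightarrow> complex \<Rightarrow> bool" where
  "rectangular_periods E \<omega> \<omega>' \<longleftrightarrow>
     Im \<omega> = 0 \<and> Re \<omega> > 0 \<and> Re \<omega>' = 0 \<and> Im (\<omega>' / \<omega>) > 0 \<and>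
     (\<lambda>u. (weierstrass_p \<omega> \<omega>' u, deriv (weierstrass_p \<omega> \<omega>') u)) ` (- period_lattice \<omega> \<omega>')
       = affine_points E"

text \<open>
  Such periods exist when \<open>g2 ^ 3 - 27 * g3 ^ 2 > 0\<close>. They are then unique, and the sum does not
  depend on the choice of \<open>u\<close> modulo the lattice.
\<close>

definition elliptic_dilog :: "weierstrass_curve \<Rightarrow> complex \<times> complex \<Rightarrow> real" where
  "elliptic_dilog E P =
     (let (\<omega>, \<omega>', u) =
            (SOME (\<omega>, \<omega>', u). rectangular_periods E \<omega> \<omega>' \<and> u \<notin> period_lattice \<omega> \<omega>' \<and>
               (weierstrass_p \<omega> \<omega>' u, deriv (weierstrass_p \<omega> \<omega>') u) = P);
          \<tau> = \<omega>' / \<omega>;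
          q = exp (2 * of_real pi * \<i> * \<tau>)
      in \<Sum>\<^sub>\<infinity>n::int. bloch_wigner (exp (2 * of_real pi * \<i> * u / \<omega>) * q powi n))"

definition curve :: "real \<Rightarrow> real \<Rightarrow> weierstrass_curve" where
  "curve k l = Weierstrass
     (27 * (k ^ 4 - 16 * k ^ 2 + 16) * l ^ 2)
     (- 27 * (k ^ 6 - 24 * k ^ 4 + 120 * k ^ 2 + 64) * l ^ 3)"

lemma curve_points:
  "(87, 1080) \<in> affine_points (curve 5 2)"
  "(195, 432) \<in> affine_points (curve 16 (1/2))"
  "(51, 216) \<in> affine_points (curve 8 (1/2))"
  "(33, 324) \<in> affine_points (curve (3 * sqrt 2) 1)"
proof -
  have s: "sqrt 2 ^ 4 = 4" "sqrt 2 ^ 6 = 8"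
    by (simp_all add: power_mult [of "sqrt 2" 2 2, simplified] power_mult [of "sqrt 2" 2 3, simplified])
  show "(87, 1080) \<in> affine_points (curve 5 2)"
    "(195, 432) \<in> affine_points (curve 16 (1/2))"
    "(51, 216) \<in> affine_points (curve 8 (1/2))"
    "(33, 324) \<in> affine_points (curve (3 * sqrt 2) 1)"
    by (simp_all add: affine_points_def curve_def power_mult_distrib s power_divide)
qed

lemma curve_discriminants:
  "E \<in> {curve 5 2, curve 16 (1/2), curve 8 (1/2), curve (3 * sqrt 2) 1} \<Longrightarrow>
     g2 E ^ 3 - 27 * g3 E ^ 2 > 0"
proof -
  have s: "sqrt 2 ^ 4 = 4" "sqrt 2 ^ 6 = 8"
    by (simp_all add: power_mult [of "sqrt 2" 2 2, simplified] power_mult [of "sqrt 2" 2 3, simplified])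
  show "E \<in> {curve 5 2, curve 16 (1/2), curve 8 (1/2), curve (3 * sqrt 2) 1} \<Longrightarrow>
     g2 E ^ 3 - 27 * g3 E ^ 2 > 0"
    by (auto simp: curve_def power_mult_distrib s power_divide)
qed

end

theory Submission
  imports Defs "HOL-Real_Asymp.Real_Asymp"
begin

text \<open>
  For \<open>x > 0\<close> let \<open>E(x)\<close> and \<open>O(x)\<close> be the sums of \<open>sech (n x)\<close> over the even and the odd
  integers \<open>n\<close>. These theta-function squares obey Landen's transformation
  \<open>E(x) = E(2x) + O(2x)\<close>, \<open>O(x)\<^sup>2 = 4 E(2x) O(2x)\<close> and a modular inversion formula, which comes from
  comparing the half-period values of \<open>\<wp>\<close> for two homothetic rectangular lattices.

  By Jensen's formula \<open>m'(k)\<close> is a complete elliptic integral. At \<open>k = 4 E(x)/O(x)\<close> and at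
  \<open>k = 4 O(x)/E(x)\<close> it equals \<open>O(x)/4\<close> and \<open>E(x)/4\<close>, so \<open>m(4 E/O)\<close> and \<open>m(4 O/E)\<close> have
  derivatives \<open>E (E\<^sup>2 - O\<^sup>2)\<close> and \<open>- O (E\<^sup>2 - O\<^sup>2)\<close>. Up to a factor and after modular
  inversion, the first is also the derivative of \<open>\<Sum>\<^sub>n D(-i q\<^sup>n)\<close> with \<open>q = exp (-\<pi>\<^sup>2/(2x))\<close>. With
  the constant fixed at \<open>m(4)\<close> this gives \<open>m(4 E(x)/O(x)) = A(x)\<close>, where \<open>A(x)\<close> is
  \<open>-4/\<pi>\<close> times the series, and Landen's transformation gives \<open>m(4 O(x)/E(x)) = 2 A(x/2) - A(x)\<close>.

  The curve with parameters \<open>k = 4 E(x)/O(x)\<close> and \<open>l\<close> has period ratio \<open>\<tau> = i \<pi>/(4x)\<close>, hence the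
  same \<open>q\<close>, and its point with abscissa \<open>3 l (k\<^sup>2 + 4)/2\<close> and positive ordinate is \<open>u = -\<omega>/4\<close>; so the
  elliptic dilogarithm is the series above. If \<open>E(x)/O(x)\<close> is 4 or 2, then \<open>4 E(x/2)/O(x/2)\<close> is 5 or
  \<open>3 \<surd>2\<close>, and both sides of each equivalence are the same linear relation between \<open>A(x)\<close> and
  \<open>A(x/2)\<close>.
\<close>

section \<open>Series indexed by the integers\<close>

text \<open>Everything about E and O is derived from their hyperbolic series: telescoping sums of
  tanh evaluate the convolutions of \<open>sech\<close> and \<open>csch\<close>, and the resulting
  product formulas are the differential system of the Jacobi functions dn, cn and sn. Inversion is
  forced because m' is computed at x, whereas termwise differentiation of the dilogarithm series
  produces a second moment of \<open>sech\<close> at its own parameter y, namely E O (E + O), which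
  matches E (E^2 - O^2) only after y = pi^2/(2x). Since E > O, the two parametrizations reach k > 4
  and 0 < k < 4, and both tend to k = 4 as x tends to 0. There m' is infinite, so increments of m
  are computed as integrals of nonnegative functions; the constants come from continuity of m at 4
  and m(4) = 4 G/pi with Catalan's constant G. \<open>elliptic_dilog\<close> selects its periods and
  its u by Hilbert choice. Exhibiting suitable ones is not enough: all admissible choices must be
  determined, which takes surjectivity and injectivity of the Weierstrass parametrization and the
  fact that the curve determines k and l.\<close>

lemma infsum_has_field_derivative:
  fixes F :: "'i \<Rightarrow> 'a::{real_normed_field,banach} \<Rightarrow> 'a"
  assumes A: "countable A" "infinite A"
    and S: "open S" "convex S" "x \<in> S"
    and F': "\<And>n y. n \<in> A \<Longrightarrow> y \<in> S \<Longrightarrow> (F n has_field_derivative F' n y) (at y)"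
    and M: "\<And>n y. n \<in> A \<Longrightarrow> y \<in> S \<Longrightarrow> norm (F' n y) \<le> M n" "M summable_on A"
    and F: "\<And>y. y \<in> S \<Longrightarrow> (\<lambda>n. F n y) summable_on A"
  shows "((\<lambda>y. \<Sum>\<^sub>\<infinity>n\<in>A. F n y) has_field_derivative (\<Sum>\<^sub>\<infinity>n\<in>A. F' n x)) (at x)"
proof -
  \<comment> \<open>\<open>summable_on\<close> is unconditional, so an enumeration of
    \<open>A\<close> reduces the claim to series, where the majorant \<open>M\<close> gives uniform
    convergence of the derivatives.\<close>
  define e where "e = from_nat_into A"
  have e: "bij_betw e UNIV A"
    unfolding e_def using A by (rule bij_betw_from_nat_into)
  have eA: "e k \<in> A" for k using e by (auto simp: bij_betw_def)
  have Me: "(\<lambda>k. M (e k)) summable_on UNIV"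
    using summable_on_reindex_bij_betw[OF e, of M] M(2) by simp
  hence Ms: "summable (\<lambda>k. M (e k))" by (rule summable_on_imp_summable)
  have uc: "uniformly_convergent_on S (\<lambda>n x. \<Sum>i<n. F' (e i) x)"
    by (rule Weierstrass_m_test'[OF _ Ms]) (use M(1) eA in auto)
  have Fsum: "infsum (\<lambda>n. F n y) A = (\<Sum>k. F (e k) y)" if "y \<in> S" for y
  proof -
    have "(\<lambda>k. F (e k) y) summable_on UNIV"
      using summable_on_reindex_bij_betw[OF e, of "\<lambda>n. F n y"] F[OF that] by simp
    hence "(\<lambda>k. F (e k) y) sums (\<Sum>\<^sub>\<infinity>k. F (e k) y)"
      by (intro has_sum_imp_sums has_sum_infsum)
    thus ?thesis using infsum_reindex_bij_betw[OF e, of "\<lambda>n. F n y"] by (simp add: sums_iff)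
  qed
  have F'sum: "infsum (\<lambda>n. F' n x) A = (\<Sum>k. F' (e k) x)"
  proof -
    have "(\<lambda>k. norm (F' (e k) x)) summable_on UNIV"
      by (rule summable_on_comparison_test[OF Me]) (use M(1) eA S in auto)
    hence "(\<lambda>k. F' (e k) x) summable_on UNIV" by (rule abs_summable_summable)
    hence "(\<lambda>k. F' (e k) x) sums (\<Sum>\<^sub>\<infinity>k. F' (e k) x)"
      by (intro has_sum_imp_sums has_sum_infsum)
    thus ?thesis using infsum_reindex_bij_betw[OF e, of "\<lambda>n. F' n x"] by (simp add: sums_iff)
  qed
  have sm: "summable (\<lambda>k. F (e k) x)"
    using F[OF S(3)] summable_on_reindex_bij_betw[OF e, of "\<lambda>n. F n x"]
    by (intro summable_on_imp_summable) simp
  have "((\<lambda>y. \<Sum>k. F (e k) y) has_field_derivative (\<Sum>k. F' (e k) x)) (at x)"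
    by (rule has_field_derivative_series'(2)[where f = "\<lambda>k. F (e k)" and f' = "\<lambda>k. F' (e k)", OF S(2) _ uc S(3) sm])
       (use F' eA S in \<open>auto intro: has_field_derivative_at_within simp: interior_open\<close>)
  also have "?this \<longleftrightarrow> ?thesis"
    unfolding F'sum
    by (rule DERIV_cong_ev) (use S Fsum in \<open>auto simp: eventually_nhds\<close>)
  finally show ?thesis .
qed

lemma summable_on_int_abs:
  fixes M :: "nat \<Rightarrow> real"
  assumes "summable M" "\<And>n. M n \<ge> 0"
  shows "(\<lambda>n::int. M (nat \<bar>n\<bar>)) summable_on UNIV"
proof -
  have M: "M summable_on UNIV"
    using assms by (simp add: summable_on_UNIV_nonneg_real_iff)
  have 1: "(\<lambda>n::int. M (nat \<bar>n\<bar>)) summable_on range int"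
    using M by (subst summable_on_reindex) (auto simp: o_def)
  have 2: "(\<lambda>n::int. M (nat \<bar>n\<bar>)) summable_on range (\<lambda>k. - int k)"
    using M by (subst summable_on_reindex) (auto simp: o_def inj_on_def)
  have "(\<lambda>n::int. M (nat \<bar>n\<bar>)) summable_on (range int \<union> range (\<lambda>k. - int k))"
    by (rule summable_on_union[OF 1 2])
  moreover have "range int \<union> range (\<lambda>k. - int k) = UNIV"
  proof (intro equalityI subsetI)
    fix n :: int
    show "n \<in> range int \<union> range (\<lambda>k. - int k)"
      by (cases n rule: int_cases2) auto
  qed auto
  ultimately show ?thesis by simp
qed

lemma summable_on_int_exp:
  fixes c :: real
  assumes "c > 0"
  shows "(\<lambda>n::int. (1 + (real_of_int n)\<^sup>2) * exp (- (c * \<bar>real_of_int n\<bar>))) summable_on UNIV"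
proof -
  define M where "M = (\<lambda>n::nat. (1 + (real n)\<^sup>2) * exp (- (c * real n)))"
  have "summable M"
  proof (rule summable_comparison_test_bigo)
    have "summable (\<lambda>n. (exp (-(c/2))) ^ n :: real)"
      using assms by (intro summable_geometric) auto
    thus "summable (\<lambda>n. norm (exp (-(c/2) * real n)))"
      by (simp add: exp_of_nat_mult[symmetric] mult.commute)
    show "M \<in> O(\<lambda>n. exp (-(c/2) * real n))"
      unfolding M_def using assms by real_asymp
  qed
  from summable_on_int_abs[OF this] show ?thesis by (simp add: M_def)
qed

text \<open>Cut at 0, the sum telescopes on each side, to \<open>p - h 0\<close> and
  \<open>h 0 - q\<close>. Summability is assumed because the two limits alone give only convergence
  of ordered partial sums.\<close>

lemma has_sum_telescope_int:
  fixes h :: "int \<Rightarrow> real"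
  assumes s: "(\<lambda>n. h (n + 1) - h n) summable_on UNIV"
    and p: "(\<lambda>n. h (int n)) \<longlonglongrightarrow> p" and q: "(\<lambda>n. h (- int n)) \<longlonglongrightarrow> q"
  shows "((\<lambda>n. h (n + 1) - h n) has_sum (p - q)) UNIV"
proof -
  let ?d = "\<lambda>n. h (n + 1) - h n"
  have S: "?d summable_on B" for B using s by (rule summable_on_subset) auto
  have 1: "infsum ?d (range int) = p - h 0"
  proof -
    have "(\<lambda>n. ?d (int n)) sums (p - h 0)"
      using telescope_sums[OF p] by (simp add: add.commute)
    moreover have "(\<lambda>n. ?d (int n)) sums infsum (\<lambda>n. ?d (int n)) UNIV"
      using S[of "range int"] by (intro has_sum_imp_sums has_sum_infsum)
        (subst (asm) summable_on_reindex, auto simp: o_def)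
    ultimately have "infsum (\<lambda>n. ?d (int n)) UNIV = p - h 0" by (rule sums_unique2[symmetric])
    thus ?thesis by (subst infsum_reindex) (auto simp: o_def)
  qed
  have 2: "infsum ?d (range (\<lambda>k. - int k - 1)) = h 0 - q"
  proof -
    have inj: "inj (\<lambda>k. - int k - 1)" by (auto simp: inj_on_def)
    have "(\<lambda>n. h (- int n) - h (- int (Suc n))) sums (h 0 - q)"
      using telescope_sums'[OF q] by simp
    moreover have "(\<lambda>n. ?d (- int n - 1)) = (\<lambda>n. h (- int n) - h (- int (Suc n)))"
      by (intro ext arg_cong2[where f = "(-)"] arg_cong[where f = h]) auto
    ultimately have "(\<lambda>n. ?d (- int n - 1)) sums (h 0 - q)" by metis
    moreover have "(\<lambda>n. ?d (- int n - 1)) sums infsum (\<lambda>n. ?d (- int n - 1)) UNIV"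
      using S[of "range (\<lambda>k. - int k - 1)"] inj by (intro has_sum_imp_sums has_sum_infsum)
        (subst (asm) summable_on_reindex, auto simp: o_def)
    ultimately have "infsum (\<lambda>n. ?d (- int n - 1)) UNIV = h 0 - q" by (rule sums_unique2[symmetric])
    thus ?thesis using inj by (subst infsum_reindex) (auto simp: o_def)
  qed
  have U: "range int \<union> range (\<lambda>k. - int k - 1) = UNIV"
  proof (intro equalityI subsetI)
    fix n :: int
    show "n \<in> range int \<union> range (\<lambda>k. - int k - 1)"
    proof (cases "n \<ge> 0")
      case True thus ?thesis using zero_le_imp_eq_int by blast
    next
      case False
      hence "n = - int (nat (-n-1)) - 1" by auto
      thus ?thesis by blast
    qed
  qed auto
  have "infsum ?d (range int \<union> range (\<lambda>k. - int k - 1)) = (p - h 0) + (h 0 - q)"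
    unfolding 1[symmetric] 2[symmetric] by (rule infsum_Un_disjoint[OF S S]) auto
  hence "infsum ?d UNIV = p - q" unfolding U by simp
  thus ?thesis using s by (metis has_sum_infsum)
qed

section \<open>Parity classes of the integers and products of trigonometric series over them\<close>

definition parity_class :: "int \<Rightarrow> int set" where
  "parity_class c = {n. even (n - c)}"

lemma bij_betw_parity_class: "bij_betw (\<lambda>j. c + 2 * j) UNIV (parity_class c)"
  by (rule bij_betwI[of _ _ _ "\<lambda>n. (n - c) div 2"]) (auto simp: parity_class_def)

lemma bij_betw_parity_class_uminus: "bij_betw uminus (parity_class c) (parity_class c)"
  by (rule bij_betwI[of _ _ _ uminus]) (auto simp: parity_class_def)

lemma bij_betw_parity_class_diff:
  "bij_betw (\<lambda>n. m - n) (parity_class c) (parity_class (m - c))"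
  by (rule bij_betwI[of _ _ _ "\<lambda>n. m - n"]) (auto simp: parity_class_def)

lemma infinite_parity_class: "infinite (parity_class c)"
  using bij_betw_finite[OF bij_betw_parity_class[of c]] infinite_UNIV_int by blast

lemma infsum_int_parity:
  fixes f :: "int \<Rightarrow> 'a::banach"
  assumes "f summable_on UNIV"
  shows "infsum f UNIV = infsum f (parity_class 0) + infsum f (parity_class 1)"
proof -
  have U: "(UNIV :: int set) = parity_class 0 \<union> parity_class 1" by (auto simp: parity_class_def)
  have "infsum f (parity_class 0 \<union> parity_class 1) = infsum f (parity_class 0) + infsum f (parity_class 1)"
    by (intro infsum_Un_disjoint) (auto intro: summable_on_subset_banach[OF assms] simp: parity_class_def)
  thus ?thesis using U by simp
qed

text \<open>The sum n + l becomes the outer variable. Classes are labelled by integers and not by a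
  truth value so that the class of n + l is simply that of c + d.\<close>

lemma bij_betw_convolution:
  "bij_betw (\<lambda>(n, l). (n + l, n)) (parity_class c \<times> parity_class d) (parity_class (c + d) \<times> parity_class c)"
proof (rule bij_betwI[of _ _ _ "\<lambda>(m, n). (n, m - n)"])
  show "(\<lambda>(n, l). (n + l, n)) \<in> parity_class c \<times> parity_class d \<rightarrow> parity_class (c + d) \<times> parity_class c"
    by (auto simp: parity_class_def)
  show "(\<lambda>(m, n). (n, m - n)) \<in> parity_class (c + d) \<times> parity_class c \<rightarrow> parity_class c \<times> parity_class d"
    by (auto simp: parity_class_def)
qed auto

text \<open>The Cauchy product over the integers. The factor \<open>p\<close> stands for a
  trigonometric function of the total frequency; its bound by 1 preserves absolute
  summability.\<close>

lemma infsum_mult_convolution: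
  fixes a b :: "int \<Rightarrow> real"
  assumes a: "(\<lambda>n. norm (a n)) summable_on parity_class c" and b: "(\<lambda>n. norm (b n)) summable_on parity_class d"
    and p: "\<And>n. \<bar>p n\<bar> \<le> 1"
  shows "(\<Sum>\<^sub>\<infinity>(n, l)\<in>parity_class c \<times> parity_class d. a n * b l * p (n + l)) =
         (\<Sum>\<^sub>\<infinity>m\<in>parity_class (c + d). (\<Sum>\<^sub>\<infinity>n\<in>parity_class c. a n * b (m - n)) * p m)"
    and "(\<lambda>(n, l). a n * b l * p (n + l)) summable_on parity_class c \<times> parity_class d"
proof -
  let ?C = "parity_class c" and ?D = "parity_class d"
  have ab: "(\<lambda>x. norm (case x of (n, l) \<Rightarrow> a n * b l)) summable_on ?C \<times> ?D"
    using Infinite_Sum.abs_summable_on_Sigma_iff[of "\<lambda>(n, l). a n * b l" ?C "\<lambda>_. ?D"] a b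
    by (auto simp: abs_mult infsum_cmult_right' intro!: summable_on_cmult_right summable_on_cmult_left)
  have abp: "(\<lambda>x. norm (case x of (n, l) \<Rightarrow> a n * b l * p (n + l))) summable_on ?C \<times> ?D"
    by (rule Infinite_Sum.abs_summable_on_comparison_test[OF ab])
       (use p in \<open>auto simp: abs_mult intro!: mult_right_le_one_le\<close>)
  thus s: "(\<lambda>(n, l). a n * b l * p (n + l)) summable_on ?C \<times> ?D"
    by (rule abs_summable_summable)
  let ?f = "\<lambda>(m, n). a n * b (m - n) * p m"
  have eq: "(\<lambda>x. ?f ((\<lambda>(n, l). (n + l, n)) x)) = (\<lambda>(n, l). a n * b l * p (n + l))" by auto
  have s': "?f summable_on parity_class (c + d) \<times> ?C"
    using summable_on_reindex_bij_betw[OF bij_betw_convolution[of c d], of ?f] s unfolding eq by blast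
  have "(\<Sum>\<^sub>\<infinity>(n, l)\<in>?C \<times> ?D. a n * b l * p (n + l)) = infsum ?f (parity_class (c + d) \<times> ?C)"
    using infsum_reindex_bij_betw[OF bij_betw_convolution[of c d], of ?f] unfolding eq by blast
  also have "\<dots> = (\<Sum>\<^sub>\<infinity>m\<in>parity_class (c + d). \<Sum>\<^sub>\<infinity>n\<in>?C. a n * b (m - n) * p m)"
    using infsum_Sigma'_banach[of "\<lambda>m n. a n * b (m - n) * p m" "parity_class (c+d)" "\<lambda>_. ?C"] s'
    by simp
  also have "\<dots> = (\<Sum>\<^sub>\<infinity>m\<in>parity_class (c + d). (\<Sum>\<^sub>\<infinity>n\<in>?C. a n * b (m - n)) * p m)"
    by (simp add: infsum_cmult_left')
  finally show "(\<Sum>\<^sub>\<infinity>(n, l)\<in>?C \<times> ?D. a n * b l * p (n + l)) = \<dots>" .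
qed

lemma infsum_mult_infsum:
  fixes f g :: "int \<Rightarrow> real"
  assumes "(\<lambda>n. norm (f n)) summable_on A" "(\<lambda>n. norm (g n)) summable_on B"
  shows "infsum f A * infsum g B = (\<Sum>\<^sub>\<infinity>(n, l)\<in>A \<times> B. f n * g l)"
    and "(\<lambda>(n, l). f n * g l) summable_on A \<times> B"
proof -
  have ab: "(\<lambda>x. norm (case x of (n, l) \<Rightarrow> f n * g l)) summable_on A \<times> B"
    using Infinite_Sum.abs_summable_on_Sigma_iff[of "\<lambda>(n, l). f n * g l" A "\<lambda>_. B"] assms
    by (auto simp: abs_mult infsum_cmult_right' intro!: summable_on_cmult_right summable_on_cmult_left)
  thus s: "(\<lambda>(n, l). f n * g l) summable_on A \<times> B"
    by (rule abs_summable_summable)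
  show "infsum f A * infsum g B = (\<Sum>\<^sub>\<infinity>(n, l)\<in>A \<times> B. f n * g l)"
    using infsum_Sigma'_banach[of "\<lambda>n l. f n * g l" A "\<lambda>_. B"] s
    by (simp add: infsum_cmult_right' infsum_cmult_left')
qed

lemma infsum_odd_zero:
  fixes f :: "int \<Rightarrow> real"
  assumes "\<And>n. f (- n) = - f n"
  shows "infsum f (parity_class c) = 0"
proof -
  have "infsum f (parity_class c) = infsum (\<lambda>n. f (- n)) (parity_class c)"
    using infsum_reindex_bij_betw[OF bij_betw_parity_class_uminus, of f c] by simp
  also have "\<dots> = - infsum f (parity_class c)" by (simp add: assms infsum_uminus)
  finally show ?thesis by simp
qed

lemma abs_summable_on_mult_bounded:
  fixes a p :: "int \<Rightarrow> real"
  assumes "(\<lambda>n. norm (a n)) summable_on A" "\<And>n. \<bar>p n\<bar> \<le> 1"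
  shows "(\<lambda>n. norm (a n * p n)) summable_on A"
  by (rule Infinite_Sum.abs_summable_on_comparison_test[OF assms(1)])
     (use assms(2) in \<open>auto simp: abs_mult intro: mult_left_le\<close>)

text \<open>With even coefficients \<open>a\<close> the companion sine series vanishes, so the
  product of the two sine series can be subtracted for free. Then cos cos - sin sin is the cosine of
  the sum and leaves one convolution in place of the two from the product-to-sum formula.\<close>

lemma cos_series_mult_cos_series:
  fixes a b :: "int \<Rightarrow> real"
  assumes a: "(\<lambda>n. norm (a n)) summable_on parity_class c" "\<And>n. a (- n) = a n"
    and b: "(\<lambda>n. norm (b n)) summable_on parity_class d" "\<And>n. b (- n) = b n"
  shows "(\<Sum>\<^sub>\<infinity>n\<in>parity_class c. a n * cos (of_int n * u)) * (\<Sum>\<^sub>\<infinity>n\<in>parity_class d. b n * cos (of_int n * u)) =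
    (\<Sum>\<^sub>\<infinity>m\<in>parity_class (c + d). (\<Sum>\<^sub>\<infinity>n\<in>parity_class c. a n * b (m - n)) * cos (of_int m * u))"
proof -
  let ?C = "parity_class c" and ?D = "parity_class d"
  note cc = infsum_mult_infsum[OF abs_summable_on_mult_bounded[OF a(1)] abs_summable_on_mult_bounded[OF b(1)]]
  have 1: "(\<Sum>\<^sub>\<infinity>n\<in>?C. a n * cos (of_int n * u)) * (\<Sum>\<^sub>\<infinity>n\<in>?D. b n * cos (of_int n * u))
     = (\<Sum>\<^sub>\<infinity>(n, l)\<in>?C \<times> ?D. a n * cos (of_int n * u) * (b l * cos (of_int l * u)))"
    by (rule cc(1)) auto
  have 2: "(\<Sum>\<^sub>\<infinity>n\<in>?C. a n * sin (of_int n * u)) * (\<Sum>\<^sub>\<infinity>n\<in>?D. b n * sin (of_int n * u))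
     = (\<Sum>\<^sub>\<infinity>(n, l)\<in>?C \<times> ?D. a n * sin (of_int n * u) * (b l * sin (of_int l * u)))"
    by (rule cc(1)) auto
  have 3: "(\<Sum>\<^sub>\<infinity>n\<in>?C. a n * sin (of_int n * u)) = 0"
    by (rule infsum_odd_zero) (simp add: a(2))
  have "(\<Sum>\<^sub>\<infinity>n\<in>?C. a n * cos (of_int n * u)) * (\<Sum>\<^sub>\<infinity>n\<in>?D. b n * cos (of_int n * u)) =
     (\<Sum>\<^sub>\<infinity>(n, l)\<in>?C \<times> ?D. a n * cos (of_int n * u) * (b l * cos (of_int l * u)))
     - (\<Sum>\<^sub>\<infinity>(n, l)\<in>?C \<times> ?D. a n * sin (of_int n * u) * (b l * sin (of_int l * u)))"
    using 1 2 3 by simp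
  also have "\<dots> = (\<Sum>\<^sub>\<infinity>x\<in>?C \<times> ?D. (case x of (n, l) \<Rightarrow> a n * cos (of_int n * u) * (b l * cos (of_int l * u)))
       + - (case x of (n, l) \<Rightarrow> a n * sin (of_int n * u) * (b l * sin (of_int l * u))))"
    by (subst infsum_add)
       (simp_all only: infsum_uminus diff_conv_add_uminus summable_on_uminus cc(2) abs_cos_le_one abs_sin_le_one)
  also have "\<dots> = (\<Sum>\<^sub>\<infinity>(n, l)\<in>?C \<times> ?D. a n * b l * cos (of_int (n + l) * u))"
    by (intro infsum_cong) (auto simp: cos_add algebra_simps)
  also have "\<dots> = (\<Sum>\<^sub>\<infinity>m\<in>parity_class (c + d). (\<Sum>\<^sub>\<infinity>n\<in>?C. a n * b (m - n)) * cos (of_int m * u))"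
    by (rule infsum_mult_convolution(1)[OF a(1) b(1)]) auto
  finally show ?thesis .
qed

text \<open>The term added here is the sine series of \<open>a\<close> times the cosine series of
  \<open>b\<close>, zero again because \<open>a\<close> is even.\<close>

lemma cos_series_mult_sin_series:
  fixes a b :: "int \<Rightarrow> real"
  assumes a: "(\<lambda>n. norm (a n)) summable_on parity_class c" "\<And>n. a (- n) = a n"
    and b: "(\<lambda>n. norm (b n)) summable_on parity_class d" "\<And>n. b (- n) = - b n"
  shows "(\<Sum>\<^sub>\<infinity>n\<in>parity_class c. a n * cos (of_int n * u)) * (\<Sum>\<^sub>\<infinity>n\<in>parity_class d. b n * sin (of_int n * u)) =
    (\<Sum>\<^sub>\<infinity>m\<in>parity_class (c + d). (\<Sum>\<^sub>\<infinity>n\<in>parity_class c. a n * b (m - n)) * sin (of_int m * u))"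
proof -
  let ?C = "parity_class c" and ?D = "parity_class d"
  note cc = infsum_mult_infsum[OF abs_summable_on_mult_bounded[OF a(1)] abs_summable_on_mult_bounded[OF b(1)]]
  have 1: "(\<Sum>\<^sub>\<infinity>n\<in>?C. a n * cos (of_int n * u)) * (\<Sum>\<^sub>\<infinity>n\<in>?D. b n * sin (of_int n * u))
     = (\<Sum>\<^sub>\<infinity>(n, l)\<in>?C \<times> ?D. a n * cos (of_int n * u) * (b l * sin (of_int l * u)))"
    by (rule cc(1)) auto
  have 2: "(\<Sum>\<^sub>\<infinity>n\<in>?C. a n * sin (of_int n * u)) * (\<Sum>\<^sub>\<infinity>n\<in>?D. b n * cos (of_int n * u))
     = (\<Sum>\<^sub>\<infinity>(n, l)\<in>?C \<times> ?D. a n * sin (of_int n * u) * (b l * cos (of_int l * u)))"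
    by (rule cc(1)) auto
  have 3: "(\<Sum>\<^sub>\<infinity>n\<in>?C. a n * sin (of_int n * u)) = 0"
    by (rule infsum_odd_zero) (simp add: a(2))
  have "(\<Sum>\<^sub>\<infinity>n\<in>?C. a n * cos (of_int n * u)) * (\<Sum>\<^sub>\<infinity>n\<in>?D. b n * sin (of_int n * u)) =
     (\<Sum>\<^sub>\<infinity>(n, l)\<in>?C \<times> ?D. a n * cos (of_int n * u) * (b l * sin (of_int l * u)))
     + (\<Sum>\<^sub>\<infinity>(n, l)\<in>?C \<times> ?D. a n * sin (of_int n * u) * (b l * cos (of_int l * u)))"
    using 1 2 3 by simp
  also have "\<dots> = (\<Sum>\<^sub>\<infinity>x\<in>?C \<times> ?D. (case x of (n, l) \<Rightarrow> a n * cos (of_int n * u) * (b l * sin (of_int l * u)))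
       + (case x of (n, l) \<Rightarrow> a n * sin (of_int n * u) * (b l * cos (of_int l * u))))"
    by (subst infsum_add) (auto intro!: cc(2))
  also have "\<dots> = (\<Sum>\<^sub>\<infinity>(n, l)\<in>?C \<times> ?D. a n * b l * sin (of_int (n + l) * u))"
    by (intro infsum_cong) (auto simp: sin_add algebra_simps)
  also have "\<dots> = (\<Sum>\<^sub>\<infinity>m\<in>parity_class (c + d). (\<Sum>\<^sub>\<infinity>n\<in>?C. a n * b (m - n)) * sin (of_int m * u))"
    by (rule infsum_mult_convolution(1)[OF a(1) b(1)]) auto
  finally show ?thesis .
qed

section \<open>Series of hyperbolic secants and cosecants\<close>

definition sech :: "real \<Rightarrow> real" where "sech y = 1 / cosh y"

text \<open>The value \<open>csch 0 = 0\<close> allows sums over classes of integers that contain \<open>0\<close>.\<close>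

definition csch :: "real \<Rightarrow> real" where "csch y = 1 / sinh y"

lemma sech_minus [simp]: "sech (- y) = sech y"
  and csch_minus [simp]: "csch (- y) = - csch y"
  and sech_0 [simp]: "sech 0 = 1"
  and csch_0 [simp]: "csch 0 = 0"
  by (simp_all add: sech_def csch_def)

lemma sech_pos [simp]: "sech y > 0"
  by (simp add: sech_def cosh_real_pos)

lemma abs_sech [simp]: "\<bar>sech y\<bar> = sech y"
  by (simp add: less_imp_le)

lemma csch_pos: "y > 0 \<Longrightarrow> csch y > 0"
  by (simp add: csch_def)

lemma csch_abs: "csch \<bar>y\<bar> = \<bar>csch y\<bar>"
  by (cases "y \<ge> 0") (auto simp: csch_def)

lemma sech_le: "sech y \<le> 2 * exp (- \<bar>y\<bar>)"
proof -
  have "exp \<bar>y\<bar> / 2 \<le> cosh y" by (auto simp: cosh_def abs_if field_simps)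
  hence "1 / cosh y \<le> 1 / (exp \<bar>y\<bar> / 2)" by (intro divide_left_mono) (auto simp: cosh_real_pos)
  thus ?thesis by (simp add: sech_def exp_minus field_simps)
qed

text \<open>Near 0 the cosecant is unbounded, so the constant depends on the distance \<delta> kept
  from the pole.\<close>

lemma csch_le:
  assumes "\<bar>y\<bar> \<ge> \<delta>" "\<delta> > 0"
  shows "\<bar>csch y\<bar> \<le> 2 / (1 - exp (- 2 * \<delta>)) * exp (- \<bar>y\<bar>)"
proof -
  have "exp (- 2 * \<delta>) < 1" using assms by simp
  have "exp \<bar>y\<bar> * (1 - exp (- 2 * \<delta>)) / 2 \<le> exp \<bar>y\<bar> * (1 - exp (- 2 * \<bar>y\<bar>)) / 2"
    using assms by (intro divide_right_mono mult_left_mono) auto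
  also have "\<dots> = sinh \<bar>y\<bar>"
    by (simp add: sinh_def right_diff_distrib flip: exp_add)
  finally have "1 / sinh \<bar>y\<bar> \<le> 1 / (exp \<bar>y\<bar> * (1 - exp (- 2 * \<delta>)) / 2)"
    using \<open>exp (- 2 * \<delta>) < 1\<close> assms by (intro divide_left_mono) auto
  thus ?thesis unfolding csch_abs[symmetric] by (simp add: csch_def exp_minus field_simps)
qed

lemma summable_on_int_rapid:
  fixes f :: "int \<Rightarrow> real"
  assumes "c > 0" "\<And>n. n \<in> A \<Longrightarrow> \<bar>f n\<bar> \<le> C * (1 + (real_of_int n)\<^sup>2) * exp (- (c * \<bar>real_of_int n\<bar>))"
  shows "(\<lambda>n. norm (f n)) summable_on A" "f summable_on A"
proof -
  have "(\<lambda>n. C * ((1 + (real_of_int n)\<^sup>2) * exp (- (c * \<bar>real_of_int n\<bar>)))) summable_on A"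
    by (intro summable_on_cmult_right summable_on_subset[OF summable_on_int_exp]) (use assms in auto)
  thus *: "(\<lambda>n. norm (f n)) summable_on A"
    by (rule summable_on_comparison_test) (use assms(2) in \<open>auto simp: mult.assoc\<close>)
  thus "f summable_on A" by (rule abs_summable_summable)
qed

lemma sech_int_le:
  assumes "x > 0"
  shows "sech (of_int n * x) \<le> 2 * exp (- (x * \<bar>real_of_int n\<bar>))"
  using sech_le[of "of_int n * x"] assms by (simp add: abs_mult mult.commute)

lemma csch_int_le:
  assumes "x > 0"
  shows "\<bar>csch (of_int n * x)\<bar> \<le> 2 / (1 - exp (- 2 * x)) * exp (- (x * \<bar>real_of_int n\<bar>))"
proof (cases "n = 0")
  case True
  thus ?thesis using assms by simp
next
  case False
  hence "1 \<le> \<bar>real_of_int n\<bar>" by linarith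
  hence "x \<le> \<bar>of_int n * x\<bar>" using assms by (simp add: abs_mult)
  from csch_le[OF this assms] show ?thesis using assms by (simp add: abs_mult mult.commute)
qed

lemma summable_on_sech:
  assumes x: "x > 0" and p: "\<And>n. \<bar>p n\<bar> \<le> 1 + (real_of_int n)\<^sup>2"
  shows "(\<lambda>n. norm (p n * sech (of_int n * x))) summable_on A"
    "(\<lambda>n. p n * sech (of_int n * x)) summable_on A"
proof -
  have "\<bar>p n * sech (of_int n * x)\<bar> \<le> 2 * (1 + (real_of_int n)\<^sup>2) * exp (- (x * \<bar>real_of_int n\<bar>))" for n
  proof -
    have "\<bar>p n * sech (of_int n * x)\<bar> = \<bar>p n\<bar> * sech (of_int n * x)" by (simp add: abs_mult)
    also have "\<dots> \<le> (1 + (real_of_int n)\<^sup>2) * (2 * exp (- (x * \<bar>real_of_int n\<bar>)))"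
      by (rule mult_mono[OF p sech_int_le[OF x]]) (auto intro: less_imp_le)
    also have "\<dots> = 2 * (1 + (real_of_int n)\<^sup>2) * exp (- (x * \<bar>real_of_int n\<bar>))"
      by (simp only: mult_ac)
    finally show ?thesis .
  qed
  from summable_on_int_rapid[OF x this]
  show "(\<lambda>n. norm (p n * sech (of_int n * x))) summable_on A"
    "(\<lambda>n. p n * sech (of_int n * x)) summable_on A" .
qed

lemma summable_on_csch:
  assumes x: "x > 0" and p: "\<And>n. \<bar>p n\<bar> \<le> 1 + (real_of_int n)\<^sup>2"
  shows "(\<lambda>n. norm (p n * csch (of_int n * x))) summable_on A"
    "(\<lambda>n. p n * csch (of_int n * x)) summable_on A"
proof -
  have "\<bar>p n * csch (of_int n * x)\<bar> \<le> (2 / (1 - exp (- 2 * x))) * (1 + (real_of_int n)\<^sup>2) * exp (- (x * \<bar>real_of_int n\<bar>))" for n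
  proof -
    have "\<bar>p n * csch (of_int n * x)\<bar> = \<bar>p n\<bar> * \<bar>csch (of_int n * x)\<bar>" by (simp add: abs_mult)
    also have "\<dots> \<le> (1 + (real_of_int n)\<^sup>2) * (2 / (1 - exp (- 2 * x)) * exp (- (x * \<bar>real_of_int n\<bar>)))"
      by (rule mult_mono[OF p csch_int_le[OF x]]) (auto intro: less_imp_le)
    also have "\<dots> = (2 / (1 - exp (- 2 * x))) * (1 + (real_of_int n)\<^sup>2) * exp (- (x * \<bar>real_of_int n\<bar>))"
      by (simp only: mult_ac)
    finally show ?thesis .
  qed
  from summable_on_int_rapid[OF x this]
  show "(\<lambda>n. norm (p n * csch (of_int n * x))) summable_on A"
    "(\<lambda>n. p n * csch (of_int n * x)) summable_on A" .
qed

lemma abs_int_le_1_plus_square: "\<bar>real_of_int n\<bar> \<le> 1 + (real_of_int n)\<^sup>2"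
proof -
  have "0 \<le> (\<bar>real_of_int n\<bar> - 1)\<^sup>2" by simp
  hence "2 * \<bar>real_of_int n\<bar> \<le> 1 + (real_of_int n)\<^sup>2" by (simp add: power2_diff)
  thus ?thesis by linarith
qed

lemma summable_on_sech_0:
  assumes "x > 0"
  shows "(\<lambda>n. norm (sech (of_int n * x))) summable_on A" "(\<lambda>n. sech (of_int n * x)) summable_on A"
  using summable_on_sech[OF assms, of "\<lambda>_. 1"] by auto

lemma summable_on_csch_0:
  assumes "x > 0"
  shows "(\<lambda>n. norm (csch (of_int n * x))) summable_on A" "(\<lambda>n. csch (of_int n * x)) summable_on A"
  using summable_on_csch[OF assms, of "\<lambda>_. 1"] by auto

text \<open>By Jacobi's two-square formulas this is theta_3^2, and \<open>sech_odd x\<close> is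
  theta_2^2, at the nome exp (-2 x); \<open>ratio x\<close> below is then the reciprocal of the
  elliptic modulus.\<close>

definition sech_even :: "real \<Rightarrow> real" where
  "sech_even x = (\<Sum>\<^sub>\<infinity>n\<in>parity_class 0. sech (of_int n * x))"

definition sech_odd :: "real \<Rightarrow> real" where
  "sech_odd x = (\<Sum>\<^sub>\<infinity>n\<in>parity_class 1. sech (of_int n * x))"

lemma sech_even_ge_1: assumes "x > 0" shows "sech_even x \<ge> 1"
proof -
  have "infsum (\<lambda>n. sech (of_int n * x)) {0} \<le> sech_even x" unfolding sech_even_def
    by (intro infsum_mono2 summable_on_sech_0 assms) (auto simp: parity_class_def intro: less_imp_le)
  thus ?thesis by simp
qed

lemma sech_odd_pos: assumes "x > 0" shows "sech_odd x > 0"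
proof -
  have "infsum (\<lambda>n. sech (of_int n * x)) {1} \<le> sech_odd x" unfolding sech_odd_def
    by (intro infsum_mono2 summable_on_sech_0 assms) (auto simp: parity_class_def intro: less_imp_le)
  thus ?thesis using sech_pos[of x] by (simp del: sech_pos)
qed

section \<open>Convolutions of hyperbolic secants and cosecants\<close>

lemma parity_class_cong: "even (c - d) \<Longrightarrow> parity_class c = parity_class d"
  by (auto simp: parity_class_def)

text \<open>As a function of m the sum is odd, and raising m by 2 adds a sum of tanh increments that
  telescopes to 1 - (-1) = 2. Since J 1 = J (-1) + 2 = 2 - J 1, this forces the value m. The odd
  term \<rho> makes the series converge and cancels in differences.\<close>

lemma tanh_series_telescope:
  assumes x: "(x::real) > 0"
    and \<rho>: "\<And>n. \<rho> (- n) = - \<rho> n"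
    and s: "\<And>m. (\<lambda>n. \<rho> n + tanh (of_int (m - n) * x)) summable_on parity_class c"
  shows "(\<Sum>\<^sub>\<infinity>n\<in>parity_class c. \<rho> n + tanh (of_int (m - n) * x)) = of_int m"
proof -
  define J where "J m = (\<Sum>\<^sub>\<infinity>n\<in>parity_class c. \<rho> n + tanh (of_int (m - n) * x))" for m
  have odd: "J (- m) = - J m" for m
  proof -
    have "J (- m) = (\<Sum>\<^sub>\<infinity>n\<in>parity_class c. \<rho> (- n) + tanh (of_int (- m - (- n)) * x))"
      unfolding J_def
      using infsum_reindex_bij_betw[OF bij_betw_parity_class_uminus,
        of "\<lambda>n. \<rho> n + tanh (of_int (- m - n) * x)" c] by simp
    also have "\<dots> = (\<Sum>\<^sub>\<infinity>n\<in>parity_class c. - (\<rho> n + tanh (of_int (m - n) * x)))"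
    proof (intro infsum_cong)
      fix n
      have "tanh (of_int (- m - (- n)) * x) = - tanh (of_int (m - n) * x)"
        by (simp flip: tanh_minus add: algebra_simps)
      thus "\<rho> (- n) + tanh (of_int (- m - (- n)) * x) = - (\<rho> n + tanh (of_int (m - n) * x))"
        by (simp only: \<rho>)
    qed
    also have "\<dots> = - J m" unfolding J_def by (rule infsum_uminus)
    finally show ?thesis .
  qed
  have step: "J (m + 2) = J m + 2" for m
  proof -
    let ?t = "\<lambda>k. tanh (of_int (k + 2) * x) - tanh (of_int k * x)"
    let ?h = "\<lambda>j. tanh (of_int (m - c + 2 * j) * x)"
    have s': "(\<lambda>n. (\<rho> n + tanh (of_int (m + 2 - n) * x)) + - (\<rho> n + tanh (of_int (m - n) * x))) summable_on parity_class c"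
      by (intro summable_on_add summable_on_uminus[THEN iffD2] s)
    have e: "(\<lambda>n. (\<rho> n + tanh (of_int (m + 2 - n) * x)) + - (\<rho> n + tanh (of_int (m - n) * x))) = (\<lambda>n. ?t (m - n))"
      by (auto simp: algebra_simps)
    have "J (m + 2) - J m = (\<Sum>\<^sub>\<infinity>n\<in>parity_class c. (\<rho> n + tanh (of_int (m + 2 - n) * x)) + - (\<rho> n + tanh (of_int (m - n) * x)))"
      unfolding J_def
      by (subst infsum_add[OF s summable_on_uminus[THEN iffD2, OF s]]) (simp only: infsum_uminus diff_conv_add_uminus)
    also have "\<dots> = infsum ?t (parity_class (m - c))"
      unfolding e by (rule infsum_reindex_bij_betw[OF bij_betw_parity_class_diff])
    also have "\<dots> = (\<Sum>\<^sub>\<infinity>j. ?t (m - c + 2 * j))"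
      by (rule infsum_reindex_bij_betw[OF bij_betw_parity_class, symmetric])
    also have "\<dots> = 1 - (-1)"
    proof -
      have "?t summable_on parity_class (m - c)"
        using s' unfolding e using summable_on_reindex_bij_betw[OF bij_betw_parity_class_diff[of m c], of ?t] by simp
      hence sj: "(\<lambda>j. ?t (m - c + 2 * j)) summable_on UNIV"
        using summable_on_reindex_bij_betw[OF bij_betw_parity_class[of "m - c"], of ?t] by simp
      have ee: "?t (m - c + 2 * j) = ?h (j + 1) - ?h j" for j
        by (simp add: algebra_simps)
      have l1: "(\<lambda>n. ?h (int n)) \<longlonglongrightarrow> 1"
        using x by real_asymp
      have l2: "(\<lambda>n. ?h (- int n)) \<longlonglongrightarrow> -1"
        using x by real_asymp
      have "((\<lambda>j. ?h (j + 1) - ?h j) has_sum (1 - (-1))) UNIV"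
        by (rule has_sum_telescope_int[OF _ l1 l2]) (use sj in \<open>simp only: ee\<close>)
      thus ?thesis unfolding ee by (rule infsumI)
    qed
    finally show ?thesis by simp
  qed
  have 0: "J 0 = 0" using odd[of 0] by simp
  have 1: "J 1 = 1" using step[of "-1"] odd[of 1] by simp
  have nat: "J (int n) = of_int (int n)" for n
  proof (induction n rule: less_induct)
    case (less n)
    show ?case
    proof (cases "n < 2")
      case True
      hence "n = 0 \<or> n = 1" by auto
      thus ?thesis using 0 1 by auto
    next
      case False
      then obtain k where k: "n = k + 2" using le_Suc_ex[of 2 n] by (auto simp: add.commute)
      have "J (int n) = J (int k + 2)" using k by (simp add: add.commute)
      also have "\<dots> = of_int (int k) + 2" using step[of "int k"] less[of k] k by simp
      finally show ?thesis using k by simp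
    qed
  qed
  have "J m = of_int m"
    using nat[of "nat m"] nat[of "nat (- m)"] odd[of m] by (cases "m \<ge> 0") auto
  thus ?thesis by (simp add: J_def)
qed

lemma tanh_plus_tanh: "tanh a + tanh b = sinh (a + b) * (sech a * sech b)" for a b :: real
  using cosh_real_pos[of a] cosh_real_pos[of b]
  by (simp add: tanh_def sech_def sinh_add field_simps)

lemma coth_plus_tanh:
  fixes a b :: real
  assumes "a \<noteq> 0"
  shows "cosh a * csch a + tanh b = cosh (a + b) * (csch a * sech b)"
  using cosh_real_pos[of b] assms by (simp add: tanh_def sech_def csch_def cosh_add field_simps)

lemma sech_le_1: "sech y \<le> 1"
  using cosh_real_ge_1[of y] by (simp add: sech_def field_simps)

lemma summable_on_mult_sech:
  fixes a :: "int \<Rightarrow> real"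
  assumes "(\<lambda>n. norm (a n)) summable_on A"
  shows "(\<lambda>n. a n * sech (h n)) summable_on A"
proof -
  have "\<bar>sech (h n)\<bar> \<le> 1" for n using sech_le_1[of "h n"] by (simp add: less_imp_le)
  from abs_summable_on_mult_bounded[OF assms, of "\<lambda>n. sech (h n)", OF this]
  show ?thesis by (rule abs_summable_summable)
qed

text \<open>In \<open>tanh_plus_tanh\<close> with arguments n x and (m - n) x the factor sinh (m x)
  does not depend on n, so the convolution is a tanh series divided by it.\<close>

lemma sech_convolution:
  assumes "x > 0" "m \<noteq> 0"
  shows "(\<Sum>\<^sub>\<infinity>n\<in>parity_class c. sech (of_int n * x) * sech (of_int (m - n) * x)) = of_int m * csch (of_int m * x)"
proof -
  have sm: "sinh (of_int m * x) \<noteq> 0" using assms by simp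
  have eq: "tanh (of_int n * x) + tanh (of_int (k - n) * x) =
      sinh (of_int k * x) * (sech (of_int n * x) * sech (of_int (k - n) * x))" for n k
    by (subst tanh_plus_tanh) (simp add: algebra_simps)
  have "(\<Sum>\<^sub>\<infinity>n\<in>parity_class c. tanh (of_int n * x) + tanh (of_int (m - n) * x)) = of_int m"
  proof (rule tanh_series_telescope[OF assms(1)])
    show "(\<lambda>n. tanh (of_int n * x) + tanh (of_int (k - n) * x)) summable_on parity_class c" for k
      unfolding eq by (intro summable_on_cmult_right summable_on_mult_sech summable_on_sech_0 assms)
  qed auto
  hence "sinh (of_int m * x) * (\<Sum>\<^sub>\<infinity>n\<in>parity_class c. sech (of_int n * x) * sech (of_int (m - n) * x)) = of_int m"
    unfolding eq infsum_cmult_right' .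
  thus ?thesis using sm by (simp add: csch_def nonzero_eq_divide_eq mult.commute)
qed

text \<open>Only odd m - n count, and the class of n contains such n exactly when m - c is odd.
  Reflecting n to m - n then puts the cosecant on the odd integers, away from its pole, where coth
  plays the role of the odd term \<rho>.\<close>

lemma csch_sech_convolution:
  assumes "x > 0"
  shows "(\<Sum>\<^sub>\<infinity>n\<in>parity_class c. sech (of_int n * x) * (if odd (m - n) then csch (of_int (m - n) * x) else 0))
    = (if even (m - c) then 0 else of_int m * sech (of_int m * x))"
proof (cases "even (m - c)")
  case True
  have "(\<Sum>\<^sub>\<infinity>n\<in>parity_class c. sech (of_int n * x) * (if odd (m - n) then csch (of_int (m - n) * x) else 0)) =
     (\<Sum>\<^sub>\<infinity>n\<in>parity_class c. 0)"
    by (intro infsum_cong) (use True in \<open>auto simp: parity_class_def\<close>)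
  thus ?thesis using True by simp
next
  case False
  hence pc: "parity_class (m - c) = parity_class 1" by (intro parity_class_cong) auto
  let ?a = "\<lambda>n. (if odd n then csch (of_int n * x) else 0) * sech (of_int (m - n) * x)"
  have "(\<Sum>\<^sub>\<infinity>n\<in>parity_class c. sech (of_int n * x) * (if odd (m - n) then csch (of_int (m - n) * x) else 0)) =
    (\<Sum>\<^sub>\<infinity>n\<in>parity_class c. ?a (m - n))" by (simp add: mult.commute)
  also have "\<dots> = infsum ?a (parity_class 1)"
    unfolding pc[symmetric] by (rule infsum_reindex_bij_betw[OF bij_betw_parity_class_diff])
  also have "\<dots> = (\<Sum>\<^sub>\<infinity>n\<in>parity_class 1. csch (of_int n * x) * sech (of_int (m - n) * x))"
    by (intro infsum_cong) (auto simp: parity_class_def)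
  finally have 1: "(\<Sum>\<^sub>\<infinity>n\<in>parity_class c. sech (of_int n * x) * (if odd (m - n) then csch (of_int (m - n) * x) else 0)) = \<dots>" .
  let ?\<rho> = "\<lambda>n. cosh (of_int n * x) * csch (of_int n * x)"
  have eq: "?\<rho> n + tanh (of_int (k - n) * x) =
      cosh (of_int k * x) * (csch (of_int n * x) * sech (of_int (k - n) * x))" if "n \<in> parity_class 1" for n k
  proof -
    have "n \<noteq> 0" using that by (auto simp: parity_class_def)
    thus ?thesis using assms by (subst coth_plus_tanh) (auto simp: algebra_simps)
  qed
  have "(\<Sum>\<^sub>\<infinity>n\<in>parity_class 1. ?\<rho> n + tanh (of_int (m - n) * x)) = of_int m"
  proof (rule tanh_series_telescope[OF assms(1)])
    show "(\<lambda>n. ?\<rho> n + tanh (of_int (k - n) * x)) summable_on parity_class 1" for k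
    proof -
      have "(\<lambda>n. cosh (of_int k * x) * (csch (of_int n * x) * sech (of_int (k - n) * x))) summable_on parity_class 1"
        by (intro summable_on_cmult_right summable_on_mult_sech summable_on_csch_0 assms)
      thus ?thesis using eq by (subst summable_on_cong) auto
    qed
  qed auto
  also have "(\<Sum>\<^sub>\<infinity>n\<in>parity_class 1. ?\<rho> n + tanh (of_int (m - n) * x)) =
     cosh (of_int m * x) * (\<Sum>\<^sub>\<infinity>n\<in>parity_class 1. csch (of_int n * x) * sech (of_int (m - n) * x))"
    unfolding infsum_cmult_right'[symmetric] by (intro infsum_cong) (use eq in auto)
  finally have "(\<Sum>\<^sub>\<infinity>n\<in>parity_class 1. csch (of_int n * x) * sech (of_int (m - n) * x)) = of_int m * sech (of_int m * x)"
    using cosh_real_pos[of "of_int m * x"] by (simp add: sech_def field_simps)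
  thus ?thesis using 1 False by simp
qed

section \<open>Lambert series and the squares of E and O\<close>

lemma has_sum_nat_int_pos:
  fixes f :: "int \<Rightarrow> real"
  assumes f: "\<And>n. f (- n) = f n" "\<And>n. f n \<ge> 0" and s: "(\<lambda>j. f (int d + 2 * int j)) sums s"
    and d: "d = 1 \<or> d = 2" and f0: "d = 2 \<Longrightarrow> f 0 = 0"
  shows "(f has_sum 2 * s) (parity_class d)"
proof -
  let ?p = "\<lambda>j. int d + 2 * int j"
  have inj: "inj ?p" by (auto simp: inj_on_def)
  have hs: "((\<lambda>j. f (?p j)) has_sum s) UNIV"
    using s f by (intro sums_nonneg_imp_has_sum) auto
  have 1: "(f has_sum s) (range ?p)"
    using hs has_sum_reindex[OF inj, of f] by (simp add: o_def)
  have inj2: "inj (\<lambda>j. - ?p j)" by (auto simp: inj_on_def)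
  have 2: "(f has_sum s) (range (\<lambda>j. - ?p j))"
    using hs has_sum_reindex[OF inj2, of f] by (simp only: o_def f(1))
  have 3: "(f has_sum (s + s)) (range ?p \<union> range (\<lambda>j. - ?p j))"
    using d by (intro has_sum_Un_disjoint 1 2) auto
  have "(f has_sum (s + s)) (parity_class d) \<longleftrightarrow> (f has_sum (s + s)) (range ?p \<union> range (\<lambda>j. - ?p j))"
  proof (rule has_sum_cong_neutral)
    fix n assume "n \<in> parity_class d - (range ?p \<union> range (\<lambda>j. - ?p j))"
    hence n: "even (n - d)" "n \<notin> range ?p" "n \<notin> range (\<lambda>j. - ?p j)" by (auto simp: parity_class_def)
    have "n = 0"
    proof (rule ccontr)
      assume "n \<noteq> 0"
      show False
      proof (cases "n > 0")
        case True
        have "n \<ge> d" using True n(1) d by (auto elim!: evenE)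
        moreover obtain k where "n - d = 2 * k" using n(1) by (rule evenE)
        ultimately have "n = ?p (nat k)" by auto
        thus False using n by blast
      next
        case False
        have "- n \<ge> d" using False \<open>n \<noteq> 0\<close> n(1) d by (auto elim!: evenE)
        moreover have "even (- n - d)" using n(1) by auto
        then obtain k where "- n - d = 2 * k" by (rule evenE)
        ultimately have "n = - ?p (nat k)" by auto
        thus False using n by blast
      qed
    qed
    \<comment> \<open>The two half-lines miss only n = 0, which lies in the class just for d = 2,
      the least positive even number.\<close>
    moreover have "d = 2" using \<open>n = 0\<close> n(1) d by auto
    ultimately show "f n = 0" using f0 by simp
  next
    fix n assume "n \<in> (range ?p \<union> range (\<lambda>j. - ?p j)) - parity_class d"
    thus "f n = 0" by (auto simp: parity_class_def)
  qed auto
  with 3 have "(f has_sum (s + s)) (parity_class d)" by blast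
  thus ?thesis unfolding mult_2 .
qed

lemma sinh_exp_minus: "sinh y = (1 - (exp (- y))\<^sup>2) / (2 * exp (- y))" for y :: real
  by (simp add: sinh_def exp_minus power2_eq_square field_simps)

lemma cosh_exp_minus: "cosh y = (1 + (exp (- y))\<^sup>2) / (2 * exp (- y))" for y :: real
  by (simp add: cosh_def exp_minus power2_eq_square field_simps)

lemma exp_minus_of_nat: "exp (- (real n * y)) = exp (- y) ^ n"
  by (simp flip: exp_of_nat_mult)

lemma has_sum_csch:
  assumes "(y::real) > 0"
  shows "((\<lambda>r. exp (- (\<bar>of_int r\<bar> * y))) has_sum csch y) (parity_class 1)"
proof -
  define \<rho> where "\<rho> = exp (- y)"
  have \<rho>: "0 < \<rho>" "\<rho> < 1" using assms by (auto simp: \<rho>_def)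
  have "(\<lambda>j. \<rho> * (\<rho>\<^sup>2) ^ j) sums (\<rho> * (1 / (1 - \<rho>\<^sup>2)))"
    using \<rho> by (intro sums_mult geometric_sums) (auto simp: abs_square_less_1)
  also have "(\<lambda>j. \<rho> * (\<rho>\<^sup>2) ^ j) = (\<lambda>j. exp (- (\<bar>of_int (int 1 + 2 * int j)\<bar> * y)))"
  proof
    fix j
    have "exp (- (\<bar>of_int (int 1 + 2 * int j)\<bar> * y)) = \<rho> ^ (1 + 2 * j)"
      unfolding \<rho>_def exp_minus_of_nat[symmetric] by simp
    thus "\<rho> * (\<rho>\<^sup>2) ^ j = exp (- (\<bar>of_int (int 1 + 2 * int j)\<bar> * y))" by (simp add: power_mult)
  qed
  finally have "((\<lambda>r. exp (- (\<bar>of_int r\<bar> * y))) has_sum 2 * (\<rho> * (1 / (1 - \<rho>\<^sup>2)))) (parity_class (int 1))"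
    by (intro has_sum_nat_int_pos) auto
  also have "2 * (\<rho> * (1 / (1 - \<rho>\<^sup>2))) = csch y"
    unfolding csch_def sinh_exp_minus \<rho>_def[symmetric] by simp
  finally show ?thesis by simp
qed

lemma has_sum_csch_coth:
  assumes "(y::real) > 0"
  shows "((\<lambda>r. \<bar>of_int r\<bar> * exp (- (\<bar>of_int r\<bar> * y))) has_sum cosh y * (csch y)\<^sup>2) (parity_class 1)"
proof -
  define \<rho> where "\<rho> = exp (- y)"
  have \<rho>: "0 < \<rho>" "\<rho> < 1" using assms by (auto simp: \<rho>_def)
  have \<rho>2: "\<rho>\<^sup>2 < 1" using \<rho> by (auto simp: abs_square_less_1)
  have "(\<lambda>j. \<rho> * (2 * (of_nat (Suc j) * (\<rho>\<^sup>2) ^ j) - (\<rho>\<^sup>2) ^ j)) sums (\<rho> * (2 * (1 / (1 - \<rho>\<^sup>2)\<^sup>2) - 1 / (1 - \<rho>\<^sup>2)))"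
    using \<rho>2 by (intro sums_mult sums_diff geometric_sums geometric_deriv_sums) auto
  also have "(\<lambda>j. \<rho> * (2 * (of_nat (Suc j) * (\<rho>\<^sup>2) ^ j) - (\<rho>\<^sup>2) ^ j)) =
     (\<lambda>j. \<bar>of_int (int 1 + 2 * int j)\<bar> * exp (- (\<bar>of_int (int 1 + 2 * int j)\<bar> * y)))"
  proof
    fix j
    have "exp (- (\<bar>of_int (int 1 + 2 * int j)\<bar> * y)) = \<rho> ^ (1 + 2 * j)"
      unfolding \<rho>_def exp_minus_of_nat[symmetric] by simp
    also have "\<dots> = \<rho> * (\<rho>\<^sup>2) ^ j" by (simp add: power_mult)
    finally have e: "exp (- (\<bar>of_int (int 1 + 2 * int j)\<bar> * y)) = \<rho> * (\<rho>\<^sup>2) ^ j" .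
    show "\<rho> * (2 * (of_nat (Suc j) * (\<rho>\<^sup>2) ^ j) - (\<rho>\<^sup>2) ^ j) =
       \<bar>of_int (int 1 + 2 * int j)\<bar> * exp (- (\<bar>of_int (int 1 + 2 * int j)\<bar> * y))"
      unfolding e by (simp add: algebra_simps)
  qed
  finally have "((\<lambda>r. \<bar>of_int r\<bar> * exp (- (\<bar>of_int r\<bar> * y))) has_sum 2 * (\<rho> * (2 * (1 / (1 - \<rho>\<^sup>2)\<^sup>2) - 1 / (1 - \<rho>\<^sup>2)))) (parity_class (int 1))"
    by (intro has_sum_nat_int_pos) auto
  also have "2 * (\<rho> * (2 * (1 / (1 - \<rho>\<^sup>2)\<^sup>2) - 1 / (1 - \<rho>\<^sup>2))) = cosh y * (csch y)\<^sup>2"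
  proof -
    define D where "D = 1 - \<rho>\<^sup>2"
    have D: "D \<noteq> 0" "1 + \<rho>\<^sup>2 = 2 - D" using \<rho>2 by (auto simp: D_def)
    have "2 * (\<rho> * (2 * (1 / D\<^sup>2) - 1 / D)) = 2 * \<rho> * (2 - D) / D\<^sup>2"
      using D(1) by (simp add: power2_eq_square field_simps)
    also have "\<dots> = (2 - D) / (2 * \<rho>) * (1 / (D / (2 * \<rho>)))\<^sup>2"
      using \<rho>(1) by (simp add: power2_eq_square)
    finally show ?thesis
      unfolding csch_def sinh_exp_minus cosh_exp_minus \<rho>_def[symmetric] D_def[symmetric] D(2) .
  qed
  finally show ?thesis by simp
qed

lemma has_sum_csch_square:
  assumes "(y::real) > 0"
  shows "((\<lambda>r. \<bar>of_int r\<bar> * exp (- (\<bar>of_int r\<bar> * y))) has_sum (csch y)\<^sup>2) (parity_class 0)"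
proof -
  define \<rho> where "\<rho> = exp (- y)"
  have \<rho>: "0 < \<rho>" "\<rho> < 1" using assms by (auto simp: \<rho>_def)
  have \<rho>2: "\<rho>\<^sup>2 < 1" using \<rho> by (auto simp: abs_square_less_1)
  have "(\<lambda>j. 2 * \<rho>\<^sup>2 * (of_nat (Suc j) * (\<rho>\<^sup>2) ^ j)) sums (2 * \<rho>\<^sup>2 * (1 / (1 - \<rho>\<^sup>2)\<^sup>2))"
    using \<rho>2 by (intro sums_mult geometric_deriv_sums) auto
  also have "(\<lambda>j. 2 * \<rho>\<^sup>2 * (of_nat (Suc j) * (\<rho>\<^sup>2) ^ j)) =
     (\<lambda>j. \<bar>of_int (int 2 + 2 * int j)\<bar> * exp (- (\<bar>of_int (int 2 + 2 * int j)\<bar> * y)))"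
  proof
    fix j
    have "exp (- (\<bar>of_int (int 2 + 2 * int j)\<bar> * y)) = \<rho> ^ (2 + 2 * j)"
      unfolding \<rho>_def exp_minus_of_nat[symmetric] by simp
    thus "2 * \<rho>\<^sup>2 * (of_nat (Suc j) * (\<rho>\<^sup>2) ^ j) =
       \<bar>of_int (int 2 + 2 * int j)\<bar> * exp (- (\<bar>of_int (int 2 + 2 * int j)\<bar> * y))"
      by (simp add: power_mult power_add power2_eq_square algebra_simps)
  qed
  finally have "((\<lambda>r. \<bar>of_int r\<bar> * exp (- (\<bar>of_int r\<bar> * y))) has_sum 2 * (2 * \<rho>\<^sup>2 * (1 / (1 - \<rho>\<^sup>2)\<^sup>2))) (parity_class (int 2))"
    by (intro has_sum_nat_int_pos) auto
  also have "2 * (2 * \<rho>\<^sup>2 * (1 / (1 - \<rho>\<^sup>2)\<^sup>2)) = (csch y)\<^sup>2"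
    unfolding csch_def sinh_exp_minus \<rho>_def[symmetric]
    by (simp add: field_simps power2_eq_square)
  also have "parity_class (int 2) = parity_class 0" by (intro parity_class_cong) auto
  finally show ?thesis .
qed

text \<open>The double series of |m| exp (-|m r| x) over m in the class and odd r is summed in both
  orders: over r it gives m csch (m x) by \<open>has_sum_csch\<close>, over m it gives
  \<open>h r\<close>.\<close>

lemma lambert_swap:
  assumes x: "x > 0" and h: "\<And>r. r \<in> parity_class 1 \<Longrightarrow>
    ((\<lambda>m. \<bar>of_int m\<bar> * exp (- (\<bar>of_int m\<bar> * \<bar>of_int r * x\<bar>))) has_sum h r) (parity_class c)"
  shows "(h has_sum (\<Sum>\<^sub>\<infinity>m\<in>parity_class c. of_int m * csch (of_int m * x))) (parity_class 1)"
proof -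
  let ?f = "\<lambda>(m, r). \<bar>real_of_int m\<bar> * exp (- (\<bar>of_int m\<bar> * \<bar>of_int r * x\<bar>))"
  have in1: "((\<lambda>r. ?f (m, r)) has_sum of_int m * csch (of_int m * x)) (parity_class 1)" for m
  proof (cases "m = 0")
    case False
    have "((\<lambda>r. \<bar>of_int m\<bar> * exp (- (\<bar>of_int r\<bar> * \<bar>of_int m * x\<bar>))) has_sum
       \<bar>of_int m\<bar> * csch \<bar>of_int m * x\<bar>) (parity_class 1)"
      using False x by (intro has_sum_cmult_right has_sum_csch) auto
    also have "\<bar>of_int m\<bar> * csch \<bar>of_int m * x\<bar> = of_int m * csch (of_int m * x)"
      using x by (cases "m > 0") (auto simp: abs_mult)
    also have "(\<lambda>r. \<bar>real_of_int m\<bar> * exp (- (\<bar>of_int r\<bar> * \<bar>of_int m * x\<bar>))) = (\<lambda>r. ?f (m, r))"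
      by (simp add: abs_mult mult_ac)
    finally show ?thesis .
  qed auto
  have s: "(\<lambda>m. of_int m * csch (of_int m * x)) summable_on parity_class c"
    by (rule summable_on_csch[OF x]) (rule abs_int_le_1_plus_square)
  have S: "?f summable_on parity_class c \<times> parity_class 1"
    by (rule summable_on_SigmaI[OF in1 s]) auto
  have 1: "(?f has_sum (\<Sum>\<^sub>\<infinity>m\<in>parity_class c. of_int m * csch (of_int m * x))) (parity_class c \<times> parity_class 1)"
    by (rule has_sum_SigmaI[OF in1 has_sum_infsum[OF s] S])
  have "((\<lambda>(r, m). ?f (m, r)) has_sum (\<Sum>\<^sub>\<infinity>m\<in>parity_class c. of_int m * csch (of_int m * x))) (parity_class 1 \<times> parity_class c)"
    using 1 by (subst (asm) has_sum_swap) (simp add: case_prod_unfold)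
  from has_sum_SigmaD[OF this, of h] show ?thesis using h by simp
qed

text \<open>The frequency m = 0 stands apart because the closed form of the convolution divides by
  sinh (m x); there the convolution is a sum of squares.\<close>

lemma infsum_sech_product:
  assumes x: "x > 0"
  shows "(\<Sum>\<^sub>\<infinity>n\<in>parity_class c. sech (of_int n * x) * cos (of_int n * u)) *
      (\<Sum>\<^sub>\<infinity>n\<in>parity_class d. sech (of_int n * x) * cos (of_int n * u)) =
    (\<Sum>\<^sub>\<infinity>m\<in>parity_class (c + d).
      (if m = 0 then (\<Sum>\<^sub>\<infinity>n\<in>parity_class c. (sech (of_int n * x))\<^sup>2) else of_int m * csch (of_int m * x)) * cos (of_int m * u))"
proof -
  have inner: "(\<Sum>\<^sub>\<infinity>n\<in>parity_class c. sech (of_int n * x) * sech (of_int (m - n) * x)) =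
      (if m = 0 then (\<Sum>\<^sub>\<infinity>n\<in>parity_class c. (sech (of_int n * x))\<^sup>2) else of_int m * csch (of_int m * x))" for m
    using sech_convolution[OF x, of m c] by (auto simp: power2_eq_square)
  show ?thesis
    by (subst cos_series_mult_cos_series) (auto simp only: summable_on_sech_0[OF x] inner of_int_minus mult_minus_left sech_minus)
qed

text \<open>Resummation by \<open>lambert_swap\<close> trades the series of m csch (m x) for squares
  of cosecants. In that form the squares of E and O can be compared with half-period values of the
  Weierstrass function.\<close>

lemma infsum_sech_square_plus:
  assumes x: "x > 0"
  shows "(\<Sum>\<^sub>\<infinity>m\<in>parity_class 0. if m = 0 then s else of_int m * csch (of_int m * x)) =
      s + (\<Sum>\<^sub>\<infinity>r\<in>parity_class 1. (csch (of_int r * x))\<^sup>2)"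
proof -
  let ?g = "\<lambda>m. of_int m * csch (of_int m * x)"
  have g: "?g summable_on parity_class 0"
    by (rule summable_on_csch[OF x]) (rule abs_int_le_1_plus_square)
  have "(\<Sum>\<^sub>\<infinity>m\<in>parity_class 0. if m = 0 then s else ?g m) =
     (\<Sum>\<^sub>\<infinity>m\<in>parity_class 0. (if m = 0 then s else 0) + ?g m)"
    by (intro infsum_cong) auto
  also have "\<dots> = (\<Sum>\<^sub>\<infinity>m\<in>parity_class 0. if m = 0 then s else 0) + infsum ?g (parity_class 0)"
    by (intro infsum_add g finite_nonzero_values_imp_summable_on) auto
  also have "(\<Sum>\<^sub>\<infinity>m\<in>parity_class 0. if m = 0 then s else 0) = infsum (\<lambda>_. s) {0::int}"
    by (rule infsum_cong_neutral) (auto simp: parity_class_def)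
  also have "infsum ?g (parity_class 0) = (\<Sum>\<^sub>\<infinity>r\<in>parity_class 1. (csch (of_int r * x))\<^sup>2)"
  proof (rule infsumI[symmetric], rule lambert_swap[OF x])
    fix r assume "r \<in> parity_class 1"
    hence "r \<noteq> 0" by (auto simp: parity_class_def)
    hence "\<bar>of_int r * x\<bar> > 0" using x by simp
    from has_sum_csch_square[OF this]
    show "((\<lambda>m. \<bar>of_int m\<bar> * exp (- (\<bar>of_int m\<bar> * \<bar>of_int r * x\<bar>))) has_sum (csch (of_int r * x))\<^sup>2) (parity_class 0)"
      unfolding csch_abs by simp
  qed
  finally show ?thesis by simp
qed

lemma sech_even_square:
  assumes x: "x > 0"
  shows "(sech_even x)\<^sup>2 = (\<Sum>\<^sub>\<infinity>n\<in>parity_class 0. (sech (of_int n * x))\<^sup>2) + (\<Sum>\<^sub>\<infinity>n\<in>parity_class 1. (csch (of_int n * x))\<^sup>2)"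
  using infsum_sech_product[OF x, of 0 0 0] infsum_sech_square_plus[OF x]
  by (simp add: sech_even_def power2_eq_square)

lemma sech_odd_square:
  assumes x: "x > 0"
  shows "(sech_odd x)\<^sup>2 = (\<Sum>\<^sub>\<infinity>n\<in>parity_class 1. (sech (of_int n * x))\<^sup>2) + (\<Sum>\<^sub>\<infinity>n\<in>parity_class 1. (csch (of_int n * x))\<^sup>2)"
proof -
  have "parity_class (1 + 1) = parity_class 0" by (intro parity_class_cong) auto
  thus ?thesis
    using infsum_sech_product[OF x, of 0 1 1] infsum_sech_square_plus[OF x]
    by (simp add: sech_odd_def power2_eq_square)
qed

text \<open>With K the complete elliptic integral for the nome exp (-2 x), this is the Fourier
  series of 2 K/pi times dn at 2 K u/pi, and \<open>cos_odd\<close> that of 2 K/pi times the modulus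
  times cn.\<close>

definition cos_even :: "real \<Rightarrow> real \<Rightarrow> real" where
  "cos_even x u = (\<Sum>\<^sub>\<infinity>n\<in>parity_class 0. sech (of_int n * x) * cos (of_int n * u))"

definition cos_odd :: "real \<Rightarrow> real \<Rightarrow> real" where
  "cos_odd x u = (\<Sum>\<^sub>\<infinity>n\<in>parity_class 1. sech (of_int n * x) * cos (of_int n * u))"

lemma cos_even_0: "cos_even x 0 = sech_even x"
  and cos_odd_0: "cos_odd x 0 = sech_odd x"
  by (simp_all add: cos_even_def cos_odd_def sech_even_def sech_odd_def)

lemma cos_even_times_cos_odd:
  assumes x: "x > 0"
  shows "cos_even x u * cos_odd x u = (\<Sum>\<^sub>\<infinity>m\<in>parity_class 1. of_int m * csch (of_int m * x) * cos (of_int m * u))"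
proof -
  have "cos_even x u * cos_odd x u = (\<Sum>\<^sub>\<infinity>m\<in>parity_class (0 + 1).
      (if m = 0 then (\<Sum>\<^sub>\<infinity>n\<in>parity_class 0. (sech (of_int n * x))\<^sup>2) else of_int m * csch (of_int m * x)) * cos (of_int m * u))"
    unfolding cos_even_def cos_odd_def by (rule infsum_sech_product[OF x])
  also have "\<dots> = (\<Sum>\<^sub>\<infinity>m\<in>parity_class 1. of_int m * csch (of_int m * x) * cos (of_int m * u))"
    unfolding add_0 by (intro infsum_cong) (auto simp: parity_class_def)
  finally show ?thesis .
qed

lemma sech_even_times_sech_odd:
  assumes x: "x > 0"
  shows "sech_even x * sech_odd x = (\<Sum>\<^sub>\<infinity>m\<in>parity_class 1. of_int m * csch (of_int m * x))"
  using cos_even_times_cos_odd[OF x, of 0] by (simp add: cos_even_0 cos_odd_0)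

lemma has_sum_cosh_csch_square:
  assumes x: "x > 0"
  shows "((\<lambda>r. cosh (of_int r * x) * (csch (of_int r * x))\<^sup>2) has_sum sech_even x * sech_odd x) (parity_class 1)"
  unfolding sech_even_times_sech_odd[OF x]
proof (rule lambert_swap[OF x])
  fix r assume "r \<in> parity_class 1"
  hence "r \<noteq> 0" by (auto simp: parity_class_def)
  hence "\<bar>of_int r * x\<bar> > 0" using x by simp
  from has_sum_csch_coth[OF this]
  show "((\<lambda>m. \<bar>of_int m\<bar> * exp (- (\<bar>of_int m\<bar> * \<bar>of_int r * x\<bar>))) has_sum cosh (of_int r * x) * (csch (of_int r * x))\<^sup>2) (parity_class 1)"
    unfolding csch_abs by simp
qed

section \<open>Landen's transformation\<close>

lemma sech_square_plus_csch_square: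
  assumes "y \<noteq> 0"
  shows "(sech y)\<^sup>2 + (csch y)\<^sup>2 = 4 * (cosh (2 * y) * (csch (2 * y))\<^sup>2)"
proof -
  have "sinh y \<noteq> 0" "cosh y \<noteq> 0" using assms cosh_real_pos[of y] by auto
  thus ?thesis
    unfolding sech_def csch_def cosh_double sinh_double by (simp add: power2_eq_square field_simps)
qed

lemma csch_square_minus_sech_square:
  assumes "y \<noteq> 0"
  shows "(csch y)\<^sup>2 - (sech y)\<^sup>2 = 4 * (csch (2 * y))\<^sup>2"
proof -
  have nz: "sinh y \<noteq> 0" "cosh y \<noteq> 0" using assms cosh_real_pos[of y] by auto
  show ?thesis
  proof -
    have "(csch y)\<^sup>2 - (sech y)\<^sup>2 = ((cosh y)\<^sup>2 - (sinh y)\<^sup>2) / ((sinh y)\<^sup>2 * (cosh y)\<^sup>2)"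
      using nz by (simp add: sech_def csch_def power_divide field_simps)
    thus ?thesis
      using hyperbolic_pythagoras[of y] by (simp add: csch_def sinh_double power_divide power_mult_distrib)
  qed
qed

lemma summable_on_sech_square: "x > 0 \<Longrightarrow> (\<lambda>n. (sech (of_int n * x))\<^sup>2) summable_on A"
  unfolding power2_eq_square by (intro summable_on_mult_sech summable_on_sech_0)

lemma summable_on_csch_square:
  assumes "x > 0"
  shows "(\<lambda>n. (csch (of_int n * x))\<^sup>2) summable_on A"
proof -
  define C where "C = 2 / (1 - exp (- 2 * x))"
  have "\<bar>(csch (of_int n * x))\<^sup>2\<bar> \<le> C\<^sup>2 * (1 + (real_of_int n)\<^sup>2) * exp (- (x * \<bar>real_of_int n\<bar>))" for n
  proof -
    have "\<bar>csch (of_int n * x)\<bar>\<^sup>2 \<le> (C * exp (- (x * \<bar>real_of_int n\<bar>)))\<^sup>2"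
      using csch_int_le[OF assms, of n] unfolding C_def by (intro power_mono) auto
    also have "\<dots> = C\<^sup>2 * 1 * (exp (- (x * \<bar>real_of_int n\<bar>)) * exp (- (x * \<bar>real_of_int n\<bar>)))"
      by (simp add: power2_eq_square)
    also have "\<dots> \<le> C\<^sup>2 * (1 + (real_of_int n)\<^sup>2) * (1 * exp (- (x * \<bar>real_of_int n\<bar>)))"
      using assms by (intro mult_mono) auto
    finally show ?thesis by simp
  qed
  from summable_on_int_rapid(2)[OF assms this] show ?thesis .
qed

lemma sech_even_double:
  assumes x: "x > 0"
  shows "sech_even x = sech_even (2 * x) + sech_odd (2 * x)"
proof -
  have "sech_even x = (\<Sum>\<^sub>\<infinity>j. sech (of_int (0 + 2 * j) * x))"
    unfolding sech_even_def by (rule infsum_reindex_bij_betw[OF bij_betw_parity_class, symmetric])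
  also have "\<dots> = (\<Sum>\<^sub>\<infinity>j. sech (of_int j * (2 * x)))" by (simp add: mult_ac)
  also have "\<dots> = sech_even (2 * x) + sech_odd (2 * x)"
    unfolding sech_even_def sech_odd_def using x
    by (intro infsum_int_parity summable_on_sech_0) auto
  finally show ?thesis .
qed

text \<open>Each pair sech^2 + csch^2 at r x equals 4 cosh / sinh^2 at 2 r x, and the sum of cosh /
  sinh^2 over odd r is \<open>sech_even * sech_odd\<close> by resummation of its Lambert
  series.\<close>

lemma sech_odd_square_double:
  assumes x: "x > 0"
  shows "(sech_odd x)\<^sup>2 = 4 * (sech_even (2 * x) * sech_odd (2 * x))"
proof -
  have "(sech_odd x)\<^sup>2 = (\<Sum>\<^sub>\<infinity>n\<in>parity_class 1. (sech (of_int n * x))\<^sup>2 + (csch (of_int n * x))\<^sup>2)"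
    unfolding sech_odd_square[OF x]
    by (intro infsum_add[symmetric] summable_on_sech_square summable_on_csch_square x)
  also have "\<dots> = (\<Sum>\<^sub>\<infinity>r\<in>parity_class 1. 4 * (cosh (of_int r * (2 * x)) * (csch (of_int r * (2 * x)))\<^sup>2))"
  proof (intro infsum_cong)
    fix r assume "r \<in> parity_class 1"
    hence "r \<noteq> 0" by (auto simp: parity_class_def)
    hence "real_of_int r * x \<noteq> 0" using x by simp
    from sech_square_plus_csch_square[OF this]
    show "(sech (of_int r * x))\<^sup>2 + (csch (of_int r * x))\<^sup>2 = 4 * (cosh (of_int r * (2 * x)) * (csch (of_int r * (2 * x)))\<^sup>2)"
      by (simp add: mult_ac)
  qed
  also have "\<dots> = 4 * (sech_even (2 * x) * sech_odd (2 * x))"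
    using infsumI[OF has_sum_cosh_csch_square[of "2 * x"]] x by (simp add: infsum_cmult_right')
  finally show ?thesis .
qed

text \<open>Eliminates the secants: the value of the Weierstrass function at a quarter period
  involves only cosecants.\<close>

lemma sech_odd_square':
  assumes x: "x > 0"
  shows "(sech_odd x)\<^sup>2 = (\<Sum>\<^sub>\<infinity>n\<in>parity_class 1. 2 * (csch (of_int n * x))\<^sup>2 - 4 * (csch (2 * (of_int n * x)))\<^sup>2)"
proof -
  have "(sech_odd x)\<^sup>2 = (\<Sum>\<^sub>\<infinity>n\<in>parity_class 1. (sech (of_int n * x))\<^sup>2 + (csch (of_int n * x))\<^sup>2)"
    unfolding sech_odd_square[OF x]
    by (intro infsum_add[symmetric] summable_on_sech_square summable_on_csch_square x)
  also have "\<dots> = (\<Sum>\<^sub>\<infinity>n\<in>parity_class 1. 2 * (csch (of_int n * x))\<^sup>2 - 4 * (csch (2 * (of_int n * x)))\<^sup>2)"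
  proof (intro infsum_cong)
    fix r assume "r \<in> parity_class 1"
    hence "r \<noteq> 0" by (auto simp: parity_class_def)
    hence "real_of_int r * x \<noteq> 0" using x by simp
    from csch_square_minus_sech_square[OF this]
    show "(sech (of_int r * x))\<^sup>2 + (csch (of_int r * x))\<^sup>2 = 2 * (csch (of_int r * x))\<^sup>2 - 4 * (csch (2 * (of_int r * x)))\<^sup>2"
      by simp
  qed
  finally show ?thesis .
qed

section \<open>The generating functions\<close>

lemma trig_series_derivative:
  fixes a :: "int \<Rightarrow> real"
  assumes a: "(\<lambda>n. norm (a n)) summable_on parity_class c" and na: "(\<lambda>n. norm (of_int n * a n)) summable_on parity_class c"
  shows "((\<lambda>u. \<Sum>\<^sub>\<infinity>n\<in>parity_class c. a n * cos (of_int n * u)) has_real_derivative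
      - (\<Sum>\<^sub>\<infinity>n\<in>parity_class c. of_int n * a n * sin (of_int n * u))) (at u)"
    and "((\<lambda>u. \<Sum>\<^sub>\<infinity>n\<in>parity_class c. a n * sin (of_int n * u)) has_real_derivative
      (\<Sum>\<^sub>\<infinity>n\<in>parity_class c. of_int n * a n * cos (of_int n * u))) (at u)"
proof -
  have S: "(\<lambda>n. a n * cos (of_int n * y)) summable_on parity_class c"
    "(\<lambda>n. a n * sin (of_int n * y)) summable_on parity_class c" for y
    by (rule abs_summable_summable, rule abs_summable_on_mult_bounded[OF a], simp)+
  have "((\<lambda>u. \<Sum>\<^sub>\<infinity>n\<in>parity_class c. a n * cos (of_int n * u)) has_real_derivative
      (\<Sum>\<^sub>\<infinity>n\<in>parity_class c. - (of_int n * a n * sin (of_int n * u)))) (at u)"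
  proof (rule infsum_has_field_derivative[where S = UNIV and M = "\<lambda>n. norm (of_int n * a n)"])
    show "((\<lambda>u. a n * cos (of_int n * u)) has_real_derivative - (of_int n * a n * sin (of_int n * y))) (at y)" for n y
      by (auto intro!: derivative_eq_intros)
    show "norm (- (of_int n * a n * sin (of_int n * y))) \<le> norm (of_int n * a n)" for n y
      by (auto simp: abs_mult intro!: mult_right_le_one_le)
  qed (use S na infinite_parity_class in auto)
  thus "((\<lambda>u. \<Sum>\<^sub>\<infinity>n\<in>parity_class c. a n * cos (of_int n * u)) has_real_derivative
      - (\<Sum>\<^sub>\<infinity>n\<in>parity_class c. of_int n * a n * sin (of_int n * u))) (at u)"
    unfolding infsum_uminus .
  show "((\<lambda>u. \<Sum>\<^sub>\<infinity>n\<in>parity_class c. a n * sin (of_int n * u)) has_real_derivative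
      (\<Sum>\<^sub>\<infinity>n\<in>parity_class c. of_int n * a n * cos (of_int n * u))) (at u)"
  proof (rule infsum_has_field_derivative[where S = UNIV and M = "\<lambda>n. norm (of_int n * a n)"])
    show "((\<lambda>u. a n * sin (of_int n * u)) has_real_derivative (of_int n * a n * cos (of_int n * y))) (at y)" for n y
      by (auto intro!: derivative_eq_intros)
    show "norm (of_int n * a n * cos (of_int n * y)) \<le> norm (of_int n * a n)" for n y
      by (auto simp: abs_mult intro!: mult_right_le_one_le)
  qed (use S na infinite_parity_class in auto)
qed

text \<open>Its derivative \<open>lam'\<close> is -2 K/pi times the modulus times sn. By
  \<open>cos_even_plus_cos_odd\<close>, \<open>lam\<close> is the logarithm of
  \<open>cos_even + cos_odd\<close> up to a constant, which makes \<open>lam x 0\<close> a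
  logarithmic parameter for E and O.\<close>

definition lam :: "real \<Rightarrow> real \<Rightarrow> real" where
  "lam x u = (\<Sum>\<^sub>\<infinity>n\<in>parity_class 1. csch (of_int n * x) / of_int n * cos (of_int n * u))"

definition lam' :: "real \<Rightarrow> real \<Rightarrow> real" where
  "lam' x u = - (\<Sum>\<^sub>\<infinity>n\<in>parity_class 1. csch (of_int n * x) * sin (of_int n * u))"

lemma inverse_int_le: "\<bar>1 / real_of_int n\<bar> \<le> 1 + (real_of_int n)\<^sup>2"
proof (cases "n = 0")
  case False
  hence "1 \<le> \<bar>real_of_int n\<bar>" by linarith
  hence "\<bar>1 / real_of_int n\<bar> \<le> 1" by (simp add: field_simps)
  thus ?thesis by (smt (verit) zero_le_power2)
qed auto

lemma has_derivative_lam: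
  assumes x: "x > 0"
  shows "(lam x has_real_derivative lam' x u) (at u)"
proof -
  have s: "(\<lambda>n. norm (csch (of_int n * x) / of_int n)) summable_on parity_class 1"
    using summable_on_csch(1)[OF x inverse_int_le, of "parity_class 1"] by simp
  have "(\<lambda>n. norm (of_int n * (csch (of_int n * x) / of_int n))) summable_on parity_class 1 \<longleftrightarrow>
     (\<lambda>n. norm (csch (of_int n * x))) summable_on parity_class 1"
    by (intro summable_on_cong) (auto simp: parity_class_def)
  hence s': "(\<lambda>n. norm (of_int n * (csch (of_int n * x) / of_int n))) summable_on parity_class 1"
    using summable_on_csch_0(1)[OF x] by blast
  have e: "- (\<Sum>\<^sub>\<infinity>n\<in>parity_class 1. of_int n * (csch (of_int n * x) / of_int n) * sin (of_int n * u)) = lam' x u"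
    unfolding lam'_def by (intro arg_cong[where f = uminus] infsum_cong) (auto simp: parity_class_def)
  show ?thesis
    using trig_series_derivative(1)[OF s s', of u] unfolding e lam_def[abs_def] .
qed

lemma has_derivative_lam':
  assumes x: "x > 0"
  shows "(lam' x has_real_derivative - (cos_even x u * cos_odd x u)) (at u)"
  unfolding lam'_def[abs_def] cos_even_times_cos_odd[OF x]
  by (intro DERIV_minus trig_series_derivative(2) summable_on_csch_0 summable_on_csch x abs_int_le_1_plus_square)

text \<open>By \<open>csch_sech_convolution\<close> the product has coefficients n sech (n x), those
  of the derivative of the cosine series of the opposite parity. These are the equations dn' = -k^2
  sn cn and cn' = -sn dn.\<close>

lemma cos_series_times_lam':
  assumes x: "x > 0" and d: "parity_class d = parity_class (c + 1)"
  shows "(\<Sum>\<^sub>\<infinity>n\<in>parity_class c. sech (of_int n * x) * cos (of_int n * u)) * lam' x u =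
    - (\<Sum>\<^sub>\<infinity>n\<in>parity_class d. of_int n * sech (of_int n * x) * sin (of_int n * u))"
proof -
  let ?b = "\<lambda>n. if odd n then csch (of_int n * x) else 0"
  have l: "lam' x u = - (\<Sum>\<^sub>\<infinity>n\<in>parity_class 1. ?b n * sin (of_int n * u))"
    unfolding lam'_def by (intro arg_cong[where f = uminus] infsum_cong) (auto simp: parity_class_def)
  have b: "(\<lambda>n. norm (?b n)) summable_on parity_class 1"
    using summable_on_csch_0(1)[OF x] by (rule summable_on_comparison_test) auto
  have "(\<Sum>\<^sub>\<infinity>n\<in>parity_class c. sech (of_int n * x) * cos (of_int n * u)) * (\<Sum>\<^sub>\<infinity>n\<in>parity_class 1. ?b n * sin (of_int n * u)) =
    (\<Sum>\<^sub>\<infinity>m\<in>parity_class (c + 1). (\<Sum>\<^sub>\<infinity>n\<in>parity_class c. sech (of_int n * x) * ?b (m - n)) * sin (of_int m * u))"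
    by (rule cos_series_mult_sin_series) (use summable_on_sech_0(1)[OF x] b in auto)
  also have "\<dots> = (\<Sum>\<^sub>\<infinity>n\<in>parity_class d. of_int n * sech (of_int n * x) * sin (of_int n * u))"
    unfolding csch_sech_convolution[OF x] d by (intro infsum_cong) (auto simp: parity_class_def)
  finally show ?thesis unfolding l by simp
qed

lemma has_derivative_cos_even:
  assumes x: "x > 0"
  shows "(cos_even x has_real_derivative cos_odd x u * lam' x u) (at u)"
proof -
  have "parity_class 0 = parity_class (1 + 1)" by (intro parity_class_cong) auto
  thus ?thesis
    unfolding cos_even_def[abs_def] cos_odd_def[abs_def] using x
    by (subst cos_series_times_lam'[of x 0])
       (auto intro!: trig_series_derivative summable_on_sech_0(1) summable_on_sech(1) abs_int_le_1_plus_square simp del: real_norm_def)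
qed

lemma has_derivative_cos_odd:
  assumes x: "x > 0"
  shows "(cos_odd x has_real_derivative cos_even x u * lam' x u) (at u)"
    and "cos_even x u * lam' x u = - (\<Sum>\<^sub>\<infinity>n\<in>parity_class 1. of_int n * sech (of_int n * x) * sin (of_int n * u))"
proof -
  show e: "cos_even x u * lam' x u = - (\<Sum>\<^sub>\<infinity>n\<in>parity_class 1. of_int n * sech (of_int n * x) * sin (of_int n * u))" for u
    unfolding cos_even_def by (rule cos_series_times_lam'[OF x]) simp
  show "(cos_odd x has_real_derivative cos_even x u * lam' x u) (at u)"
    unfolding e unfolding cos_odd_def[abs_def] using x
    by (intro trig_series_derivative summable_on_sech_0(1) summable_on_sech(1) abs_int_le_1_plus_square)
qed

lemma has_derivative_cos_even_eq:
  assumes x: "x > 0"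
  shows "cos_odd x u * lam' x u = - (\<Sum>\<^sub>\<infinity>n\<in>parity_class 0. of_int n * sech (of_int n * x) * sin (of_int n * u))"
  unfolding cos_odd_def by (rule cos_series_times_lam'[OF x]) (intro parity_class_cong, auto)

lemma lam'_0 [simp]: "lam' x 0 = 0"
  by (simp add: lam'_def)

lemma lam_pi: "lam x pi = - lam x 0"
proof -
  have "lam x pi = (\<Sum>\<^sub>\<infinity>n\<in>parity_class 1. - (csch (of_int n * x) / of_int n * cos (of_int n * 0)))"
    unfolding lam_def
  proof (intro infsum_cong)
    fix n :: int assume "n \<in> parity_class 1"
    hence "odd n" by (auto simp: parity_class_def)
    hence "cos (of_int n * pi) = -1" using cos_int_2pin by (auto elim!: oddE simp: cos_add distrib_right mult_ac) 
    thus "csch (of_int n * x) / of_int n * cos (of_int n * pi) = - (csch (of_int n * x) / of_int n * cos (of_int n * 0))" by simp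
  qed
  thus ?thesis by (simp add: lam_def infsum_uminus)
qed

lemma cos_even_pi: "cos_even x pi = sech_even x" and cos_odd_pi: "cos_odd x pi = - sech_odd x"
proof -
  show "cos_even x pi = sech_even x" unfolding cos_even_def sech_even_def
  proof (intro infsum_cong)
    fix n :: int assume "n \<in> parity_class 0"
    hence "even n" by (auto simp: parity_class_def)
    hence "cos (of_int n * pi) = 1" using cos_int_2pin by (auto elim!: evenE simp: mult_ac)
    thus "sech (of_int n * x) * cos (of_int n * pi) = sech (of_int n * x)" by simp
  qed
  have "cos_odd x pi = (\<Sum>\<^sub>\<infinity>n\<in>parity_class 1. - sech (of_int n * x))" unfolding cos_odd_def
  proof (intro infsum_cong)
    fix n :: int assume "n \<in> parity_class 1"
    hence "odd n" by (auto simp: parity_class_def)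
    hence "cos (of_int n * pi) = -1" using cos_int_2pin by (auto elim!: oddE simp: cos_add distrib_right mult_ac)
    thus "sech (of_int n * x) * cos (of_int n * pi) = - sech (of_int n * x)" by simp
  qed
  thus "cos_odd x pi = - sech_odd x" by (simp add: sech_odd_def infsum_uminus)
qed

text \<open>Adding the two differential equations gives y' = \<open>lam'\<close> y for the sum, so
  it is a constant times the exponential of \<open>lam\<close>.\<close>

lemma cos_even_plus_cos_odd:
  assumes x: "x > 0"
  shows "cos_even x u + cos_odd x u = (sech_even x + sech_odd x) * exp (lam x u - lam x 0)"
proof -
  define h where "h u = (cos_even x u + cos_odd x u) * exp (- lam x u)" for u
  have "(h has_real_derivative 0) (at u)" for u
    unfolding h_def[abs_def]
    by (auto intro!: derivative_eq_intros has_derivative_cos_even[OF x] has_derivative_cos_odd[OF x] has_derivative_lam[OF x] simp: algebra_simps)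
  hence "h u = h 0" by (intro DERIV_isconst_all) auto
  thus ?thesis by (simp add: h_def exp_diff exp_minus field_simps cos_even_0 cos_odd_0)
qed

text \<open>This is the value at u = pi, where both \<open>cos_odd\<close> and \<open>lam\<close>
  have changed sign.\<close>

lemma sech_even_minus_sech_odd:
  assumes x: "x > 0"
  shows "sech_even x - sech_odd x = (sech_even x + sech_odd x) * exp (- 2 * lam x 0)"
  using cos_even_plus_cos_odd[OF x, of pi] by (simp add: cos_even_pi cos_odd_pi lam_pi)

lemma sech_odd_less_even:
  assumes x: "x > 0"
  shows "sech_odd x < sech_even x"
proof -
  have "0 < (sech_even x + sech_odd x) * exp (- 2 * lam x 0)"
    using sech_odd_pos[OF x] sech_even_ge_1[OF x] by (intro mult_pos_pos add_pos_pos) auto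
  thus ?thesis using sech_even_minus_sech_odd[OF x] by simp
qed

text \<open>The identity dn^2 + k^2 sn^2 = 1: the derivatives of the two squares cancel.\<close>

lemma lam'_square:
  assumes x: "x > 0"
  shows "(lam' x u)\<^sup>2 = (sech_even x)\<^sup>2 - (cos_even x u)\<^sup>2"
proof -
  define h where "h u = (lam' x u)\<^sup>2 + (cos_even x u)\<^sup>2" for u
  have "(h has_real_derivative 0) (at u)" for u
    unfolding h_def[abs_def]
    by (auto intro!: derivative_eq_intros has_derivative_cos_even[OF x] has_derivative_lam'[OF x] simp: algebra_simps)
  hence "h u = h 0" by (intro DERIV_isconst_all) auto
  thus ?thesis by (simp add: h_def cos_even_0)
qed

text \<open>The products \<open>cos_even * lam'\<close> and \<open>cos_odd * lam'\<close> are
  differentiated at 0 both by the product rule and termwise. This moment is, up to a factor, the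
  derivative of the dilogarithm series.\<close>

lemma second_moment_sech:
  assumes x: "x > 0"
  shows "(\<Sum>\<^sub>\<infinity>n. (of_int n)\<^sup>2 * sech (of_int n * x)) = sech_even x * sech_odd x * (sech_even x + sech_odd x)"
proof -
  have s: "(\<lambda>n. norm (of_int n * sech (of_int n * x))) summable_on parity_class c"
    "(\<lambda>n. norm (of_int n * (of_int n * sech (of_int n * x)))) summable_on parity_class c" for c
    using summable_on_sech(1)[OF x, of "\<lambda>n. (of_int n)\<^sup>2"] summable_on_sech(1)[OF x abs_int_le_1_plus_square]
    by (auto simp: power2_eq_square mult.assoc)
  have eo: "(\<Sum>\<^sub>\<infinity>n\<in>parity_class 1. (of_int n)\<^sup>2 * sech (of_int n * x)) = sech_even x * sech_even x * sech_odd x"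
  proof -
    have "((\<lambda>u. cos_even x u * lam' x u) has_real_derivative
        - (sech_even x * sech_even x * sech_odd x)) (at 0)"
      by (auto intro!: derivative_eq_intros has_derivative_cos_even[OF x] has_derivative_lam'[OF x] simp: cos_even_0 cos_odd_0)
    moreover have "((\<lambda>u. cos_even x u * lam' x u) has_real_derivative
        - (\<Sum>\<^sub>\<infinity>n\<in>parity_class 1. of_int n * (of_int n * sech (of_int n * x)) * cos (of_int n * 0))) (at 0)"
      unfolding has_derivative_cos_odd(2)[OF x]
      by (intro DERIV_minus trig_series_derivative(2) s)
    ultimately have "- (sech_even x * sech_even x * sech_odd x) =
       - (\<Sum>\<^sub>\<infinity>n\<in>parity_class 1. of_int n * (of_int n * sech (of_int n * x)) * cos (of_int n * 0))"
      by (rule DERIV_unique)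
    thus ?thesis by (simp add: power2_eq_square mult.assoc)
  qed
  have ee: "(\<Sum>\<^sub>\<infinity>n\<in>parity_class 0. (of_int n)\<^sup>2 * sech (of_int n * x)) = sech_even x * sech_odd x * sech_odd x"
  proof -
    have "((\<lambda>u. cos_odd x u * lam' x u) has_real_derivative
        - (sech_even x * sech_odd x * sech_odd x)) (at 0)"
      by (auto intro!: derivative_eq_intros has_derivative_cos_odd[OF x] has_derivative_lam'[OF x] simp: cos_even_0 cos_odd_0)
    moreover have "((\<lambda>u. cos_odd x u * lam' x u) has_real_derivative
        - (\<Sum>\<^sub>\<infinity>n\<in>parity_class 0. of_int n * (of_int n * sech (of_int n * x)) * cos (of_int n * 0))) (at 0)"
      unfolding has_derivative_cos_even_eq[OF x]
      by (intro DERIV_minus trig_series_derivative(2) s)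
    ultimately have "- (sech_even x * sech_odd x * sech_odd x) =
       - (\<Sum>\<^sub>\<infinity>n\<in>parity_class 0. of_int n * (of_int n * sech (of_int n * x)) * cos (of_int n * 0))"
      by (rule DERIV_unique)
    thus ?thesis by (simp add: power2_eq_square mult.assoc)
  qed
  have "(\<Sum>\<^sub>\<infinity>n. (of_int n)\<^sup>2 * sech (of_int n * x)) =
     (\<Sum>\<^sub>\<infinity>n\<in>parity_class 0. (of_int n)\<^sup>2 * sech (of_int n * x)) + (\<Sum>\<^sub>\<infinity>n\<in>parity_class 1. (of_int n)\<^sup>2 * sech (of_int n * x))"
    by (intro infsum_int_parity summable_on_sech[OF x]) auto
  thus ?thesis unfolding eo ee by (simp add: algebra_simps)
qed

text \<open>On (0, pi) both factors of (E - cos_even) (E + cos_even), the square of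
  \<open>lam'\<close>, are positive, so \<open>lam'\<close> has constant sign there. The sign is
  negative because \<open>lam\<close> drops from \<open>lam x 0\<close> > 0 to its negative.\<close>

lemma lam'_neg:
  assumes x: "x > 0" and u: "0 < u" "u < pi"
  shows "lam' x u < 0"
proof -
  have nz: "lam' x v \<noteq> 0" if v: "0 < v" "v < pi" for v
  proof -
    have S: "(\<lambda>n. sech (of_int n * x) * cos (of_int n * v)) summable_on parity_class 0"
      by (rule abs_summable_summable, rule abs_summable_on_mult_bounded[OF summable_on_sech_0(1)[OF x]]) auto
    note S1 = summable_on_sech_0(2)[OF x, of "parity_class 0"]
    have c1: "cos (2 * v) < 1"
    proof -
      have "sin v > 0" using v by (rule sin_gt_zero)
      thus ?thesis by (simp add: cos_double_sin)
    qed
    have "sech_even x - cos_even x v = (\<Sum>\<^sub>\<infinity>n\<in>parity_class 0. sech (of_int n * x) + - (sech (of_int n * x) * cos (of_int n * v)))"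
      unfolding sech_even_def cos_even_def
      by (subst infsum_add[OF S1 summable_on_uminus[THEN iffD2, OF S]]) (simp only: infsum_uminus diff_conv_add_uminus)
    \<comment> \<open>The single term n = 2 gives a strictly positive lower bound, as cos (2 v) <
      1.\<close>
    also have "\<dots> \<ge> infsum (\<lambda>n. sech (of_int n * x) + - (sech (of_int n * x) * cos (of_int n * v))) {2}"
      by (intro infsum_mono2 summable_on_add S1 summable_on_uminus[THEN iffD2, OF S]) (auto simp: parity_class_def mult_le_cancel_left1 not_less)
    finally have 1: "sech_even x - cos_even x v \<ge> sech (2 * x) * (1 - cos (2 * v))" by (simp add: algebra_simps)
    have "sech (2 * x) * (1 - cos (2 * v)) > 0" using c1 by (intro mult_pos_pos) auto
    with 1 have A: "cos_even x v < sech_even x" by linarith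
    have "sech_even x + cos_even x v = (\<Sum>\<^sub>\<infinity>n\<in>parity_class 0. sech (of_int n * x) + sech (of_int n * x) * cos (of_int n * v))"
      unfolding sech_even_def cos_even_def by (subst infsum_add[OF S1 S]) simp
    also have "\<dots> \<ge> infsum (\<lambda>n. sech (of_int n * x) + sech (of_int n * x) * cos (of_int n * v)) {0}"
    proof (intro infsum_mono2 summable_on_add S1 S)
      fix n :: int
      have "0 \<le> 1 + cos (of_int n * v)" using cos_ge_minus_one[of "of_int n * v"] by linarith
      hence "sech (of_int n * x) * (1 + cos (of_int n * v)) \<ge> 0" by (simp add: zero_le_mult_iff less_imp_le)
      thus "0 \<le> sech (of_int n * x) + sech (of_int n * x) * cos (of_int n * v)" by (simp add: algebra_simps)
    qed (auto simp: parity_class_def)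
    finally have B: "sech_even x + cos_even x v \<ge> 2" by simp
    have "(lam' x v)\<^sup>2 = (sech_even x - cos_even x v) * (sech_even x + cos_even x v)"
      unfolding lam'_square[OF x] by (simp add: power2_eq_square algebra_simps)
    also have "\<dots> > 0" using A B by (intro mult_pos_pos) auto
    finally show ?thesis by auto
  qed
  have lpos: "lam x 0 > 0"
  proof -
    have "exp (- 2 * lam x 0) < 1"
    proof -
      have "(sech_even x + sech_odd x) * exp (- 2 * lam x 0) < (sech_even x + sech_odd x) * 1"
        using sech_even_minus_sech_odd[OF x] sech_odd_pos[OF x] by simp
      thus ?thesis using sech_odd_pos[OF x] sech_even_ge_1[OF x] by (subst (asm) mult_less_cancel_left_pos) auto
    qed
    thus ?thesis by simp
  qed
  obtain \<xi> where \<xi>: "0 < \<xi>" "\<xi> < pi" "lam x pi - lam x 0 = (pi - 0) * lam' x \<xi>"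
    using MVT2[of 0 pi "lam x" "lam' x"] has_derivative_lam[OF x] by auto
  hence neg: "lam' x \<xi> < 0" using lpos lam_pi[of x] by (simp add: zero_less_mult_iff mult_less_0_iff) (smt (verit) pi_gt_zero mult_nonneg_nonneg)
  have cont: "continuous_on A (lam' x)" for A
    using has_derivative_lam'[OF x] by (meson DERIV_isCont continuous_at_imp_continuous_on)
  show ?thesis
  proof (rule ccontr)
    assume "\<not> lam' x u < 0"
    hence p: "lam' x u > 0" using nz[OF u] by simp
    have "\<exists>v. min u \<xi> \<le> v \<and> v \<le> max u \<xi> \<and> lam' x v = 0"
    proof (cases "u \<le> \<xi>")
      case True
      with IVT2'[of "lam' x" \<xi> 0 u] p neg cont show ?thesis by auto
    next
      case False
      with IVT'[of "lam' x" \<xi> 0 u] p neg cont show ?thesis by auto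
    qed
    then obtain v where "min u \<xi> \<le> v" "v \<le> max u \<xi>" "lam' x v = 0" by blast
    thus False using nz[of v] u \<xi> by (auto simp: min_def max_def split: if_splits)
  qed
qed

section \<open>Dependence on the nome\<close>

lemma has_derivative_lam_0:
  assumes x: "x > 0"
  shows "((\<lambda>x. lam x 0) has_real_derivative - (sech_even x * sech_odd x)) (at x)"
proof -
  define C where "C = 2 / (1 - exp (- 2 * (x / 2)))"
  have "((\<lambda>y. \<Sum>\<^sub>\<infinity>n\<in>parity_class 1. csch (of_int n * y) / of_int n) has_real_derivative
     (\<Sum>\<^sub>\<infinity>n\<in>parity_class 1. - (cosh (of_int n * x) * (csch (of_int n * x))\<^sup>2))) (at x)"
  \<comment> \<open>On this half-line all arguments n y stay at distance x/2 from the pole of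
    \<open>csch\<close>, which fixes one constant \<open>C\<close>; cosh times csch^2 then decays
    like a single exponential.\<close>
  proof (rule infsum_has_field_derivative[where S = "{x/2<..}" and M = "\<lambda>n. C\<^sup>2 * exp (- (x / 2 * \<bar>of_int n\<bar>))"])
    fix n :: int and y assume n: "n \<in> parity_class 1" and y: "y \<in> {x/2<..}"
    have n0: "n \<noteq> 0" using n by (auto simp: parity_class_def)
    have y0: "y > 0" using x y by auto
    have s0: "sinh (of_int n * y) \<noteq> 0" using n0 y0 by simp
    show "((\<lambda>y. csch (of_int n * y) / of_int n) has_real_derivative - (cosh (of_int n * y) * (csch (of_int n * y))\<^sup>2)) (at y)"
      unfolding csch_def using n0 s0
      by (auto intro!: derivative_eq_intros simp: power2_eq_square field_simps)
    have "1 \<le> \<bar>real_of_int n\<bar>" using n0 by linarith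
    hence "x / 2 * 1 \<le> y * \<bar>real_of_int n\<bar>" using y x by (intro mult_mono) auto
    hence "x / 2 \<le> \<bar>of_int n * y\<bar>" using y0 by (simp add: abs_mult mult.commute)
    from csch_le[OF this] x have c: "\<bar>csch (of_int n * y)\<bar> \<le> C * exp (- \<bar>of_int n * y\<bar>)" by (simp add: C_def)
    have "cosh (of_int n * y) \<le> exp \<bar>of_int n * y\<bar>"
      by (auto simp: cosh_def abs_if)
    moreover have "(csch (of_int n * y))\<^sup>2 \<le> (C * exp (- \<bar>of_int n * y\<bar>))\<^sup>2"
      using c by (subst power2_abs[symmetric]) (intro power_mono, auto)
    ultimately have "cosh (of_int n * y) * (csch (of_int n * y))\<^sup>2 \<le> exp \<bar>of_int n * y\<bar> * (C * exp (- \<bar>of_int n * y\<bar>))\<^sup>2"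
      by (intro mult_mono) auto
    also have "\<dots> = C\<^sup>2 * exp (- \<bar>of_int n * y\<bar>)"
      by (simp add: power2_eq_square exp_minus field_simps)
    also have "\<dots> \<le> C\<^sup>2 * exp (- (x / 2 * \<bar>of_int n\<bar>))"
    proof -
      have "x / 2 * \<bar>real_of_int n\<bar> \<le> y * \<bar>real_of_int n\<bar>" using y by (intro mult_right_mono) auto
      thus ?thesis using y0 by (intro mult_left_mono) (auto simp: abs_mult mult.commute)
    qed
    finally show "norm (- (cosh (of_int n * y) * (csch (of_int n * y))\<^sup>2)) \<le> C\<^sup>2 * exp (- (x / 2 * \<bar>of_int n\<bar>))"
      using cosh_real_pos[of "of_int n * y"] by (simp add: abs_mult)
  next
    show "(\<lambda>n. C\<^sup>2 * exp (- (x / 2 * \<bar>real_of_int n\<bar>))) summable_on parity_class 1"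
      by (rule summable_on_int_rapid(2)[where c = "x/2" and C = "C\<^sup>2"]) (use x in \<open>auto simp: distrib_left\<close>)
  next
    fix y assume y: "y \<in> {x/2<..}"
    show "(\<lambda>n. csch (of_int n * y) / of_int n) summable_on parity_class 1"
      using summable_on_csch(2)[OF _ inverse_int_le, of y "parity_class 1"] y x by simp
  qed (use x infinite_parity_class in auto)
  moreover have "(\<lambda>y. lam y 0) = (\<lambda>y. \<Sum>\<^sub>\<infinity>n\<in>parity_class 1. csch (of_int n * y) / of_int n)"
    by (simp add: lam_def)
  ultimately show ?thesis
    using infsumI[OF has_sum_cosh_csch_square[OF x]] by (simp add: infsum_uminus)
qed

lemma has_derivative_sech_series:
  assumes x: "x > 0"
  shows "((\<lambda>x. \<Sum>\<^sub>\<infinity>n\<in>parity_class c. sech (of_int n * x)) has_real_derivative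
    (\<Sum>\<^sub>\<infinity>n\<in>parity_class c. - (of_int n * tanh (of_int n * x) * sech (of_int n * x)))) (at x)"
proof (rule infsum_has_field_derivative[where S = "{x/2<..}" and M = "\<lambda>n. 2 * (\<bar>of_int n\<bar> * exp (- (x / 2 * \<bar>of_int n\<bar>)))"])
  fix n :: int and y assume y: "y \<in> {x/2<..}"
  have y0: "y > 0" using x y by auto
  show "((\<lambda>y. sech (of_int n * y)) has_real_derivative - (of_int n * tanh (of_int n * y) * sech (of_int n * y))) (at y)"
    unfolding sech_def tanh_def using cosh_real_pos[of "of_int n * y"]
    by (auto intro!: derivative_eq_intros simp: power2_eq_square field_simps)
  have t: "\<bar>tanh (of_int n * y)\<bar> \<le> 1"
    using tanh_real_bounds[of "of_int n * y"] by auto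
  have "norm (- (of_int n * tanh (of_int n * y) * sech (of_int n * y))) = \<bar>of_int n\<bar> * \<bar>tanh (of_int n * y)\<bar> * sech (of_int n * y)"
    by (simp add: abs_mult)
  also have "\<dots> \<le> \<bar>of_int n\<bar> * 1 * (2 * exp (- (y * \<bar>real_of_int n\<bar>)))"
    using t sech_int_le[OF y0, of n] by (intro mult_mono) (auto intro: less_imp_le)
  also have "\<dots> \<le> \<bar>of_int n\<bar> * 1 * (2 * exp (- (x / 2 * \<bar>real_of_int n\<bar>)))"
  proof -
    have "x / 2 * \<bar>real_of_int n\<bar> \<le> y * \<bar>real_of_int n\<bar>" using y by (intro mult_right_mono) auto
    thus ?thesis by (intro mult_left_mono) auto
  qed
  finally show "norm (- (of_int n * tanh (of_int n * y) * sech (of_int n * y))) \<le> 2 * (\<bar>of_int n\<bar> * exp (- (x / 2 * \<bar>of_int n\<bar>)))"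
    by simp
next
  have "\<bar>2 * (\<bar>real_of_int n\<bar> * exp (- (x / 2 * \<bar>of_int n\<bar>)))\<bar> \<le> 2 * (1 + (real_of_int n)\<^sup>2) * exp (- (x / 2 * \<bar>of_int n\<bar>))" for n
    using mult_right_mono[OF abs_int_le_1_plus_square[of n], of "exp (- (x / 2 * \<bar>of_int n\<bar>))"] by (simp add: abs_mult algebra_simps)
  from summable_on_int_rapid(2)[OF _ this] x
  show "(\<lambda>n. 2 * (\<bar>real_of_int n\<bar> * exp (- (x / 2 * \<bar>of_int n\<bar>)))) summable_on parity_class c" by auto
next
  fix y assume "y \<in> {x/2<..}"
  thus "(\<lambda>n. sech (of_int n * y)) summable_on parity_class c"
    using x by (intro summable_on_sech_0) auto
qed (use x infinite_parity_class in auto)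

lemma continuous_on_sech_even: "continuous_on {0<..} sech_even"
  and continuous_on_sech_odd: "continuous_on {0<..} sech_odd"
  unfolding sech_even_def[abs_def] sech_odd_def[abs_def]
  by (intro continuous_at_imp_continuous_on ballI DERIV_isCont[OF has_derivative_sech_series], simp)+

definition ratio :: "real \<Rightarrow> real" where "ratio x = sech_even x / sech_odd x"

text \<open>Solving E - O = (E + O) exp (-2 lam) for the quotient. Hence \<open>ratio x\<close> is
  coth (lam x 0), and its derivative and its limit at 0 follow from those of
  \<open>lam x 0\<close>.\<close>

lemma sech_odd_div_even:
  assumes x: "x > 0"
  shows "sech_odd x / sech_even x = tanh (lam x 0)"
proof -
  define e where "e = exp (- 2 * lam x 0)"
  have e: "e > 0" by (simp add: e_def)
  have "tanh (lam x 0) = (1 - e) / (1 + e)"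
    unfolding e_def by (rule tanh_real_altdef)
  moreover have "sech_odd x * (1 + e) = sech_even x * (1 - e)"
    using sech_even_minus_sech_odd[OF x] unfolding e_def by (simp add: algebra_simps)
  hence "sech_odd x / sech_even x = (1 - e) / (1 + e)"
    using e sech_even_ge_1[OF x] by (simp add: field_simps)
  ultimately show ?thesis by simp
qed

lemma lam_0_pos:
  assumes x: "x > 0"
  shows "lam x 0 > 0"
proof -
  have "tanh (lam x 0) > 0"
    unfolding sech_odd_div_even[OF x, symmetric] using sech_even_ge_1[OF x] sech_odd_pos[OF x] by simp
  thus ?thesis by simp
qed

lemma has_derivative_ratio:
  assumes x: "x > 0"
  shows "(ratio has_real_derivative ratio x * ((sech_even x)\<^sup>2 - (sech_odd x)\<^sup>2)) (at x)"
proof -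
  define T where "T = tanh (lam x 0)"
  have T: "T \<noteq> 0" "T = sech_odd x / sech_even x"
    using lam_0_pos[OF x] sech_odd_div_even[OF x] by (auto simp: T_def)
  have pos: "sech_odd x > 0" "sech_even x > 0" using sech_even_ge_1[OF x] sech_odd_pos[OF x] by auto
  have "((\<lambda>x. 1 / tanh (lam x 0)) has_real_derivative (1 - T\<^sup>2) * (sech_even x * sech_odd x) / T\<^sup>2) (at x)"
    using T(1) lam_0_pos[OF x] unfolding T_def
    by (auto intro!: derivative_eq_intros has_derivative_lam_0[OF x] simp: power2_eq_square field_simps)
  also have "(1 - T\<^sup>2) * (sech_even x * sech_odd x) / T\<^sup>2 = ratio x * ((sech_even x)\<^sup>2 - (sech_odd x)\<^sup>2)"
    unfolding T(2) ratio_def using pos by (simp add: power2_eq_square field_simps)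
  finally show ?thesis
  proof (rule has_field_derivative_transform_within_open[of _ _ _ "{0<..}"])
    fix y :: real assume "y \<in> {0<..}"
    hence "ratio_eq": "tanh (lam y 0) = sech_odd y / sech_even y" using sech_odd_div_even[of y] by simp
    show "1 / tanh (lam y 0) = ratio y" unfolding ratio_eq ratio_def by simp
  qed (use x in auto)
qed

lemma continuous_on_ratio: "continuous_on {0<..} ratio"
  by (intro continuous_at_imp_continuous_on ballI DERIV_isCont[OF has_derivative_ratio]) simp

lemma ratio_gt_1: "x > 0 \<Longrightarrow> ratio x > 1"
  using sech_odd_less_even[of x] sech_odd_pos[of x] by (simp add: ratio_def)

lemma ratio_strict_mono:
  assumes "0 < x" "x < y"
  shows "ratio x < ratio y"
proof (rule DERIV_pos_imp_increasing_open[OF assms(2)])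
  fix z assume "x < z" "z < y"
  hence z: "z > 0" using assms by simp
  have "(sech_even z)\<^sup>2 - (sech_odd z)\<^sup>2 > 0"
    using sech_odd_less_even[OF z] sech_odd_pos[OF z] by (simp add: power_strict_mono)
  thus "\<exists>d. (ratio has_real_derivative d) (at z) \<and> 0 < d"
    using has_derivative_ratio[OF z] ratio_gt_1[OF z] by (intro exI[of _ "ratio z * ((sech_even z)\<^sup>2 - (sech_odd z)\<^sup>2)"]) auto
next
  show "continuous_on {x..y} ratio"
    by (rule continuous_on_subset[OF continuous_on_ratio]) (use assms in auto)
qed

lemma ratio_eq_iff: "x > 0 \<Longrightarrow> y > 0 \<Longrightarrow> ratio x = ratio y \<longleftrightarrow> x = y"
  using ratio_strict_mono[of x y] ratio_strict_mono[of y x] by (cases x y rule: linorder_cases) auto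

text \<open>All terms of \<open>lam x 0\<close> are nonnegative and the one with n = 1 is 1 / sinh
  x, so \<open>lam x 0\<close> tends to infinity and its coth to 1.\<close>

lemma ratio_tendsto_at_right_0: "(ratio \<longlongrightarrow> 1) (at_right 0)"
proof -
  have "filterlim (\<lambda>x. 1 / sinh x) at_top (at_right (0::real))" by real_asymp
  hence "filterlim (\<lambda>x. lam x 0) at_top (at_right (0::real))"
  proof (rule filterlim_at_top_mono)
    show "\<forall>\<^sub>F x in at_right 0. 1 / sinh x \<le> lam x 0"
    proof (rule eventually_at_right_less[THEN eventually_mono])
      fix x :: real assume x: "0 < x"
      have "infsum (\<lambda>n. csch (of_int n * x) / of_int n) {1} \<le> (\<Sum>\<^sub>\<infinity>n\<in>parity_class 1. csch (of_int n * x) / of_int n)"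
      proof (rule infsum_mono2)
        show "(\<lambda>n. csch (of_int n * x) / of_int n) summable_on parity_class 1"
          using summable_on_csch(2)[OF x inverse_int_le, of "parity_class 1"] by simp
        fix n :: int
        show "0 \<le> csch (of_int n * x) / of_int n"
          using x by (cases n "0::int" rule: linorder_cases)
            (auto simp: csch_def mult_less_0_iff zero_le_mult_iff intro: mult_nonpos_nonneg)
      qed (auto simp: parity_class_def)
      thus "1 / sinh x \<le> lam x 0" by (simp add: lam_def csch_def)
    qed
  qed
  hence "((\<lambda>x. 1 / tanh (lam x 0)) \<longlongrightarrow> 1 / 1) (at_right 0)"
    by (intro tendsto_divide tendsto_const filterlim_compose[OF tanh_real_at_top]) auto
  moreover have "\<forall>\<^sub>F x in at_right 0. 1 / tanh (lam x 0) = ratio x"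
  proof (rule eventually_at_right_less[THEN eventually_mono])
    fix x :: real assume "0 < x"
    from sech_odd_div_even[OF this] have e: "tanh (lam x 0) = sech_odd x / sech_even x" by simp
    show "1 / tanh (lam x 0) = ratio x" unfolding e ratio_def by simp
  qed
  ultimately show ?thesis by (simp add: tendsto_cong)
qed

text \<open>The bound 2 exp (-|n| x) for the secants sums to 2 csch x, while E >= 1. The growth
  serves to show that \<open>ratio\<close> takes every value above 1.\<close>

lemma ratio_ge_sinh:
  assumes x: "x > 0"
  shows "ratio x \<ge> sinh x / 2"
proof -
  have "sech_odd x \<le> (\<Sum>\<^sub>\<infinity>n\<in>parity_class 1. 2 * exp (- (\<bar>of_int n\<bar> * x)))"
    unfolding sech_odd_def
  proof (rule infsum_mono)
    show "(\<lambda>n. 2 * exp (- (\<bar>of_int n\<bar> * x))) summable_on parity_class 1"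
      using has_sum_csch[OF x] by (intro summable_on_cmult_right has_sum_imp_summable)
    show "sech (of_int n * x) \<le> 2 * exp (- (\<bar>of_int n\<bar> * x))" for n
      using sech_int_le[OF x, of n] by (simp add: mult.commute)
  qed (rule summable_on_sech_0[OF x])
  also have "\<dots> = 2 * csch x"
    using infsumI[OF has_sum_csch[OF x]] by (simp add: infsum_cmult_right')
  finally have "1 / (2 * csch x) \<le> sech_even x / sech_odd x"
    using sech_even_ge_1[OF x] sech_odd_pos[OF x] csch_pos[OF x] by (intro frac_le) auto
  thus ?thesis by (simp add: ratio_def csch_def)
qed

lemma ratio_surj:
  assumes "K > 1"
  obtains x where "x > 0" "ratio x = K"
proof -
  have "\<forall>\<^sub>F x in at_right 0. ratio x < K"
    using ratio_tendsto_at_right_0 assms by (rule order_tendstoD)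
  hence "\<forall>\<^sub>F x in at_right 0. ratio x < K \<and> 0 < x"
    by (intro eventually_conj eventually_at_right_less)
  then obtain x where x: "ratio x < K" "x > 0"
    using eventually_happens'[of "at_right (0::real)"] trivial_limit_at_right_real by blast
  have "filterlim (\<lambda>x::real. sinh x / 2) at_top at_top" by real_asymp
  hence "\<forall>\<^sub>F y in at_top. K \<le> sinh y / 2" by (simp add: filterlim_at_top)
  hence "\<forall>\<^sub>F y in at_top. K \<le> sinh y / 2 \<and> x \<le> y" by (intro eventually_conj eventually_ge_at_top)
  then obtain y where y: "K \<le> sinh y / 2" "x \<le> y"
    using eventually_happens'[of "at_top :: real filter"] trivial_limit_at_top_linorder by blast
  have "ratio y \<ge> K" using ratio_ge_sinh[of y] x y by simp
  moreover have "continuous_on {x..y} ratio"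
    by (rule continuous_on_subset[OF continuous_on_ratio]) (use x in auto)
  ultimately obtain z where "x \<le> z" "z \<le> y" "ratio z = K"
    using IVT'[of ratio x K y] x y by auto
  thus ?thesis using that[of z] x by simp
qed

section \<open>Jensen's formula\<close>

definition unit_circle :: "real \<Rightarrow> complex" where
  "unit_circle t = exp (2 * of_real pi * \<i> * of_real t)"

lemma norm_unit_circle [simp]: "cmod (unit_circle t) = 1"
  by (simp add: unit_circle_def)

lemma continuous_on_unit_circle [continuous_intros]: "continuous_on A unit_circle"
  unfolding unit_circle_def[abs_def] by (intro continuous_intros)

lemma borel_measurable_unit_circle [measurable]: "unit_circle \<in> borel_measurable borel"
  by (rule borel_measurable_continuous_onI[OF continuous_on_unit_circle])

lemma unit_circle_nonzero [simp]: "unit_circle t \<noteq> 0"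
  by (simp add: unit_circle_def)

lemma unit_circle_plus_inverse: "unit_circle t + inverse (unit_circle t) = of_real (2 * cos (2 * pi * t))"
proof -
  have "unit_circle t = cis (2 * pi * t)" by (simp add: unit_circle_def cis_conv_exp mult_ac)
  thus ?thesis by (simp add: complex_eq_iff)
qed

lemma countable_unit_circle_eq: "countable {t. unit_circle t = z}"
proof (cases "{t. unit_circle t = z} = {}")
  case False
  then obtain t0 where t0: "unit_circle t0 = z" by auto
  have "{t. unit_circle t = z} \<subseteq> range (\<lambda>n::int. t0 + of_int n)"
  proof
    fix t assume "t \<in> {t. unit_circle t = z}"
    hence "exp (2 * of_real pi * \<i> * of_real t) = exp (2 * of_real pi * \<i> * of_real t0)"
      using t0 by (simp add: unit_circle_def)
    then obtain n :: int where "2 * of_real pi * \<i> * of_real t = 2 * of_real pi * \<i> * of_real t0 + (of_int (2 * n) * pi) * \<i>"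
      unfolding exp_eq by blast
    hence "Im (2 * of_real pi * \<i> * of_real t) = Im (2 * of_real pi * \<i> * of_real t0 + (of_int (2 * n) * pi) * \<i>)" by simp
    hence "2 * pi * t = 2 * pi * (t0 + of_int n)" by (simp add: algebra_simps)
    hence "t = t0 + of_int n" by simp
    thus "t \<in> range (\<lambda>n::int. t0 + of_int n)" by blast
  qed
  thus ?thesis by (rule countable_subset) auto
qed auto

lemma AE_unit_circle: "AE t in lborel. \<rho> + unit_circle t \<noteq> 0"
proof -
  have "AE t in lborel. t \<notin> {t. unit_circle t = - \<rho>}"
    by (intro AE_not_in countable_imp_null_set_lborel countable_unit_circle_eq)
  thus ?thesis by eventually_elim (auto simp: add_eq_0_iff)
qed

text \<open>Mean value property: ln |\<rho> + y| - ln |\<rho>| is the real part of Ln (1 + y /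
  \<rho>), which is holomorphic in y on the closed disc and vanishes at its center.\<close>

lemma jensen_outside:
  assumes \<rho>: "cmod \<rho> > 1"
  shows "set_integrable lborel {0..1} (\<lambda>t. ln (cmod (\<rho> + unit_circle t)))"
    and "(LBINT t:{0..1}. ln (cmod (\<rho> + unit_circle t))) = ln (cmod \<rho>)"
proof -
  have nz: "\<rho> + unit_circle t \<noteq> 0" for t
  proof
    assume "\<rho> + unit_circle t = 0"
    hence "cmod \<rho> = cmod (unit_circle t)" by (metis add_eq_0_iff norm_minus_cancel)
    thus False using \<rho> by simp
  qed
  have \<rho>0: "\<rho> \<noteq> 0" using \<rho> by auto
  show int: "set_integrable lborel {0..1} (\<lambda>t. ln (cmod (\<rho> + unit_circle t)))"
    using nz by (intro borel_integrable_atLeastAtMost' continuous_intros) auto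
  have "((\<lambda>t. Re (Ln (1 + unit_circle t / \<rho>))) has_integral 0) {0..1}"
  proof -
    have "(\<lambda>z. Ln (1 + z / \<rho>)) holomorphic_on cball 0 1"
    proof (intro holomorphic_intros)
      fix z :: complex assume z: "z \<in> cball 0 1"
      have "cmod (z / \<rho>) < 1"
        using z \<rho> \<rho>0 by (simp add: norm_divide divide_simps)
      hence "Re (z / \<rho>) > -1" using abs_Re_le_cmod[of "z / \<rho>"] by linarith
      thus "1 + z / \<rho> \<notin> \<real>\<^sub>\<le>\<^sub>0" by (auto simp: complex_nonpos_Reals_iff)
    qed (use \<rho>0 in auto)
    from Cauchy_integral_circlepath_simple[OF this, of 0]
    have "((\<lambda>x. Ln (1 + circlepath 0 1 x / \<rho>) / circlepath 0 1 x * (2 * pi * \<i> * exp (2 * of_real pi * \<i> * of_real x))) has_integral 0) {0..1}"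
      by (simp add: has_contour_integral vector_derivative_circlepath)
    hence "((\<lambda>x. Ln (1 + unit_circle x / \<rho>) * (2 * pi * \<i>)) has_integral 0) {0..1}"
      by (simp add: circlepath unit_circle_def field_simps)
    from has_integral_mult_left[OF this, of "1 / (2 * pi * \<i>)"]
    have "((\<lambda>x. Ln (1 + unit_circle x / \<rho>)) has_integral 0) {0..1}" by simp
    from has_integral_Re[OF this] show ?thesis by simp
  qed
  hence "((\<lambda>t. ln (cmod \<rho>) + Re (Ln (1 + unit_circle t / \<rho>))) has_integral (ln (cmod \<rho>) + 0)) {0..1}"
    using has_integral_const_real[of "ln (cmod \<rho>)" 0 1] by (intro has_integral_add) auto
  also have "(\<lambda>t. ln (cmod \<rho>) + Re (Ln (1 + unit_circle t / \<rho>))) = (\<lambda>t. ln (cmod (\<rho> + unit_circle t)))"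
  proof
    fix t
    have eq: "\<rho> + unit_circle t = \<rho> * (1 + unit_circle t / \<rho>)" using \<rho>0 by (simp add: field_simps)
    hence "1 + unit_circle t / \<rho> \<noteq> 0" using nz[of t] by auto
    thus "ln (cmod \<rho>) + Re (Ln (1 + unit_circle t / \<rho>)) = ln (cmod (\<rho> + unit_circle t))"
      unfolding eq norm_mult using \<rho>0 by (simp add: ln_mult)
  qed
  finally show "(LBINT t:{0..1}. ln (cmod (\<rho> + unit_circle t))) = ln (cmod \<rho>)"
    using set_borel_integral_eq_integral(2)[OF int] integral_unique by simp
qed

lemma cmod_square_scaled_plus:
  assumes "cmod \<rho> = 1" "cmod y = 1"
  shows "(cmod (of_real R * \<rho> + y))\<^sup>2 = R\<^sup>2 + 2 * R * (Re \<rho> * Re y + Im \<rho> * Im y) + 1"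
proof -
  have "(Re \<rho>)\<^sup>2 + (Im \<rho>)\<^sup>2 = 1" "(Re y)\<^sup>2 + (Im y)\<^sup>2 = 1"
    using assms by (metis cmod_power2 one_power2)+
  thus ?thesis
    unfolding cmod_power2 by (simp add: power2_eq_square) algebra
qed

text \<open>For |\<rho>| = 1 the logarithm is unbounded, so \<rho> is approached by R \<rho> with R
  decreasing to 1. Then |R \<rho> + y| decreases as well, and monotone convergence applies to the
  negative logarithms.\<close>

lemma jensen_on_circle:
  assumes \<rho>: "cmod \<rho> = 1"
  shows "set_integrable lborel {0..1} (\<lambda>t. ln (cmod (\<rho> + unit_circle t)))"
    and "(LBINT t:{0..1}. ln (cmod (\<rho> + unit_circle t))) = 0"
proof -
  define R where "R n = 1 + 1 / real (Suc n)" for n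
  have R: "R n > 1" for n by (simp add: R_def)
  define F where "F n t = indicator {0..1::real} t *\<^sub>R (- ln (cmod (of_real (R n) * \<rho> + unit_circle t)))" for n t
  define u where "u t = indicator {0..1::real} t *\<^sub>R (- ln (cmod (\<rho> + unit_circle t)))" for t
  have cm: "cmod (of_real (R n) * \<rho>) = R n" for n using \<rho> R[of n] by (simp add: norm_mult)
  have iF: "integrable lborel (F n)" for n
    using integrable_minus[OF jensen_outside(1)[of "of_real (R n) * \<rho>", unfolded set_integrable_def]] R[of n] cm[of n]
    by (simp add: F_def[abs_def])
  have iF': "integral\<^sup>L lborel (F n) = - ln (R n)" for n
    using jensen_outside(2)[of "of_real (R n) * \<rho>"] R[of n] cm[of n]
    by (simp add: F_def[abs_def] set_lebesgue_integral_def)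
  have nz: "of_real (R n) * \<rho> + unit_circle t \<noteq> 0" for n t
  proof
    assume "of_real (R n) * \<rho> + unit_circle t = 0"
    hence "cmod (of_real (R n) * \<rho>) = cmod (unit_circle t)" by (metis add_eq_0_iff norm_minus_cancel)
    thus False using cm[of n] R[of n] by simp
  qed
  have mono: "mono (\<lambda>n. F n t)" for t
  proof (rule incseq_SucI)
    fix n
    let ?c = "Re \<rho> * Re (unit_circle t) + Im \<rho> * Im (unit_circle t)"
    \<comment> \<open>From |\<rho> + y|^2 = 2 + 2 c >= 0. It makes R^2 + 2 R c + 1 nondecreasing for
      R >= 1.\<close>
    have c: "?c \<ge> -1"
    proof -
      have "0 \<le> 1\<^sup>2 + 2 * 1 * ?c + 1"
        unfolding cmod_square_scaled_plus[OF \<rho> norm_unit_circle, of 1 t, symmetric] by (rule zero_le_power2)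
      thus ?thesis by simp
    qed
    have Rn: "R (Suc n) \<le> R n" by (auto simp: R_def intro!: divide_left_mono)
    have "(cmod (of_real (R (Suc n)) * \<rho> + unit_circle t))\<^sup>2 \<le> (cmod (of_real (R n) * \<rho> + unit_circle t))\<^sup>2"
    proof -
      have "0 \<le> (R n - R (Suc n)) * (R n + R (Suc n) + 2 * ?c)"
        using Rn c R[of n] R[of "Suc n"] by (intro mult_nonneg_nonneg) auto
      thus ?thesis unfolding cmod_square_scaled_plus[OF \<rho> norm_unit_circle]
        by (simp add: power2_eq_square algebra_simps)
    qed
    hence "cmod (of_real (R (Suc n)) * \<rho> + unit_circle t) \<le> cmod (of_real (R n) * \<rho> + unit_circle t)"
      by (rule power2_le_imp_le) simp
    hence "ln (cmod (of_real (R (Suc n)) * \<rho> + unit_circle t)) \<le> ln (cmod (of_real (R n) * \<rho> + unit_circle t))"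
      using nz by (intro ln_mono) auto
    thus "F n t \<le> F (Suc n) t" by (simp add: F_def indicator_def)
  qed
  have Rlim: "R \<longlonglongrightarrow> 1"
    unfolding R_def using tendsto_add[OF tendsto_const LIMSEQ_inverse_real_of_nat, of 1] by (simp add: inverse_eq_divide)
  have lim: "AE t in lborel. (\<lambda>n. F n t) \<longlonglongrightarrow> u t"
    using AE_unit_circle[of \<rho>]
  proof eventually_elim
    fix t assume t: "\<rho> + unit_circle t \<noteq> 0"
    have "(\<lambda>n. cmod (of_real (R n) * \<rho> + unit_circle t)) \<longlonglongrightarrow> cmod (of_real 1 * \<rho> + unit_circle t)"
      by (intro tendsto_intros Rlim)
    thus "(\<lambda>n. F n t) \<longlonglongrightarrow> u t"
      unfolding F_def u_def using t by (intro tendsto_scaleR tendsto_minus tendsto_ln tendsto_const) auto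
  qed
  have ilim: "(\<lambda>n. integral\<^sup>L lborel (F n)) \<longlonglongrightarrow> 0"
    unfolding iF' using tendsto_minus[OF tendsto_ln[OF Rlim]] by simp
  have meas: "u \<in> borel_measurable lborel" unfolding u_def[abs_def] by measurable
  note mc = integrable_monotone_convergence[OF iF _ lim ilim meas] integral_monotone_convergence[OF iF _ lim ilim meas]
  have "integrable lborel u" "integral\<^sup>L lborel u = 0"
    using mc mono by (auto intro!: AE_I2)
  thus "set_integrable lborel {0..1} (\<lambda>t. ln (cmod (\<rho> + unit_circle t)))"
    "(LBINT t:{0..1}. ln (cmod (\<rho> + unit_circle t))) = 0"
    by (simp_all add: u_def[abs_def] set_integrable_def set_lebesgue_integral_def)
qed

text \<open>The Mahler measure of c + y + 1/y for real c >= -2: the logarithm of the larger root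
  modulus when c > 2, and 0 when both roots lie on the unit circle. Here c = k + 2 cos (2 pi s) with
  k >= 0.\<close>

definition jensen :: "real \<Rightarrow> real" where
  "jensen c = arcosh (max 1 (c / 2))"

lemma continuous_on_jensen [continuous_intros]:
  "continuous_on A f \<Longrightarrow> continuous_on A (\<lambda>x. jensen (f x))"
  unfolding jensen_def
  by (rule continuous_on_compose2[OF continuous_on_arcosh[of "{1..}"]]) (auto intro!: continuous_intros)

lemma jensen_mean:
  assumes c: "c \<ge> -2"
  shows "(LBINT t:{0..1}. ln (cmod (of_real c + unit_circle t + inverse (unit_circle t)))) = jensen c"
proof (cases "c > 2")
  case True
  define v where "v = arcosh (c / 2)"
  have v: "v > 0" "c = exp v + exp (- v)"
    using True cosh_arcosh_real[of "c/2"] unfolding v_def[symmetric]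
    by (auto simp: v_def cosh_def)
  let ?\<rho> = "complex_of_real (exp v)"
  have \<rho>: "cmod ?\<rho> > 1" using v by simp
  \<comment> \<open>With c = exp v + exp (-v) the roots are -exp v and -exp (-v). Conjugation
    relates the moduli of the two factors, so only the root outside the circle is
    integrated.\<close>
  have "ln (cmod (of_real c + unit_circle t + inverse (unit_circle t))) = 2 * ln (cmod (?\<rho> + unit_circle t)) - v" for t
  proof -
    let ?y = "unit_circle t"
    have nz: "?\<rho> + ?y \<noteq> 0"
    proof
      assume "?\<rho> + ?y = 0"
      hence "cmod ?\<rho> = cmod ?y" by (metis add_eq_0_iff norm_minus_cancel)
      thus False using \<rho> by simp
    qed
    have e: "complex_of_real (exp (- v)) * ?\<rho> = 1" by (simp flip: of_real_mult exp_add)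
    have "of_real c + ?y + inverse ?y = (?\<rho> + ?y) * (?y + of_real (exp (- v))) / ?y"
      using e unfolding v(2) by (simp add: field_simps power2_eq_square)
    hence "cmod (of_real c + ?y + inverse ?y) = cmod (?\<rho> + ?y) * cmod (?y + of_real (exp (- v)))"
      by (simp add: norm_mult norm_divide)
    also have "?y + of_real (exp (- v)) = ?y * of_real (exp (- v)) * (?\<rho> + inverse ?y)"
      using e by (simp add: field_simps)
    also have "cmod \<dots> = exp (- v) * cmod (?\<rho> + inverse ?y)"
      by (simp add: norm_mult)
    also have "cmod (?\<rho> + inverse ?y) = cmod (?\<rho> + ?y)"
    proof -
      have "inverse ?y = cnj ?y"
        by (rule inverse_unique) (simp flip: complex_norm_square)
      thus ?thesis by (metis complex_cnj_add complex_cnj_complex_of_real complex_mod_cnj)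
    qed
    finally have "cmod (of_real c + ?y + inverse ?y) = exp (- v) * (cmod (?\<rho> + ?y))\<^sup>2"
      by (simp add: power2_eq_square)
    thus ?thesis using nz by (simp add: ln_mult ln_realpow)
  qed
  hence "(LBINT t:{0..1}. ln (cmod (of_real c + unit_circle t + inverse (unit_circle t)))) =
     (LBINT t:{0..1}. 2 * ln (cmod (?\<rho> + unit_circle t)) - v)" by simp
  also have "\<dots> = 2 * (LBINT t:{0..1}. ln (cmod (?\<rho> + unit_circle t))) - (LBINT t:{0..1::real}. v)"
    using set_integrable_mult_right[of 2, OF jensen_outside(1)[OF \<rho>]]
    by (subst set_integral_diff(2)) (auto intro!: borel_integrable_atLeastAtMost')
  also have "(LBINT t:{0..1::real}. v) = v" by (simp add: set_lebesgue_integral_def)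
  finally show ?thesis
    using jensen_outside(2)[OF \<rho>] True by (simp add: jensen_def v_def max_def)
next
  case False
  define \<rho> where "\<rho> = cis (arccos (c / 2))"
  have \<rho>: "cmod \<rho> = 1" "cmod (cnj \<rho>) = 1" by (auto simp: \<rho>_def)
  have \<rho>c: "\<rho> + cnj \<rho> = of_real c" "\<rho> * cnj \<rho> = 1"
    using False c complex_norm_square[of \<rho>] \<rho> by (auto simp: \<rho>_def complex_eq_iff cos_arccos)
  have "AE t in lborel. ln (cmod (of_real c + unit_circle t + inverse (unit_circle t))) =
     ln (cmod (\<rho> + unit_circle t)) + ln (cmod (cnj \<rho> + unit_circle t))"
    using AE_unit_circle[of \<rho>] AE_unit_circle[of "cnj \<rho>"]
  proof eventually_elim
    fix t assume nz: "\<rho> + unit_circle t \<noteq> 0" "cnj \<rho> + unit_circle t \<noteq> 0"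
    have "of_real c + unit_circle t + inverse (unit_circle t) = (\<rho> + unit_circle t) * (cnj \<rho> + unit_circle t) / unit_circle t"
      using \<rho>c by (simp add: field_simps power2_eq_square flip: \<rho>c(1))
    hence "cmod (of_real c + unit_circle t + inverse (unit_circle t)) = cmod (\<rho> + unit_circle t) * cmod (cnj \<rho> + unit_circle t)"
      by (simp add: norm_mult norm_divide)
    thus "ln (cmod (of_real c + unit_circle t + inverse (unit_circle t))) =
     ln (cmod (\<rho> + unit_circle t)) + ln (cmod (cnj \<rho> + unit_circle t))"
      using nz by (simp add: ln_mult)
  qed
  hence "(LBINT t:{0..1}. ln (cmod (of_real c + unit_circle t + inverse (unit_circle t)))) =
     (LBINT t:{0..1}. ln (cmod (\<rho> + unit_circle t)) + ln (cmod (cnj \<rho> + unit_circle t)))"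
    by (intro set_lebesgue_integral_cong_AE) (auto elim: eventually_mono)
  also have "\<dots> = 0"
    using jensen_on_circle[OF \<rho>(1)] jensen_on_circle[OF \<rho>(2)] by (subst set_integral_add) auto
  finally show ?thesis using False by (simp add: jensen_def max_def)
qed

lemma mahler_eq_jensen:
  assumes "k \<ge> 0"
  shows "mahler k = (LBINT s:{0..1}. jensen (k + 2 * cos (2 * pi * s)))"
proof -
  have "(LBINT t:{0..1}. (let x = exp (2 * of_real pi * \<i> * of_real s); y = exp (2 * of_real pi * \<i> * of_real t)
         in ln (cmod (of_real k + x + inverse x + y + inverse y)))) = jensen (k + 2 * cos (2 * pi * s))" for s
  proof -
    have "k + 2 * cos (2 * pi * s) \<ge> -2" using assms cos_ge_minus_one[of "2 * pi * s"] by linarith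
    from jensen_mean[OF this]
    have "(LBINT t:{0..1}. ln (cmod (of_real k + (unit_circle s + inverse (unit_circle s)) + unit_circle t + inverse (unit_circle t)))) = jensen (k + 2 * cos (2 * pi * s))"
      unfolding unit_circle_plus_inverse by simp
    thus ?thesis by (simp add: Let_def unit_circle_def add.assoc)
  qed
  thus ?thesis by (simp add: mahler_def)
qed

lemma continuous_on_mahler: "continuous_on {0..B} mahler"
proof -
  have "continuous_on {0..B} (\<lambda>k. integral (cbox 0 1) (\<lambda>s. jensen (k + 2 * cos (2 * pi * s))))"
    by (rule integral_continuous_on_param) (auto intro!: continuous_intros simp: split_beta)
  moreover have "integral (cbox 0 1) (\<lambda>s. jensen (k + 2 * cos (2 * pi * s))) = mahler k" if "k \<in> {0..B}" for k
    using that by (subst mahler_eq_jensen) (auto intro!: set_borel_integral_eq_integral(2)[symmetric] borel_integrable_atLeastAtMost' continuous_intros)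
  ultimately show ?thesis by (subst (asm) continuous_on_cong) auto
qed

section \<open>The Mahler measure as an integral of elliptic periods\<close>

text \<open>The derivative of \<open>jensen\<close>. Being nonnegative, it lets Tonelli's theorem
  replace differentiation under the integral sign, where its singularity at 2 would be in the
  way.\<close>

definition jensen_density :: "real \<Rightarrow> real" where
  "jensen_density c = (if c > 2 then 1 / sqrt (c\<^sup>2 - 4) else 0)"

lemma borel_measurable_jensen_density [measurable]: "jensen_density \<in> borel_measurable borel"
  unfolding jensen_density_def[abs_def] by measurable

lemma jensen_density_nonneg [simp]: "jensen_density c \<ge> 0"
proof (cases "c > 2")
  case True
  hence "c\<^sup>2 > 2\<^sup>2" by (intro power_strict_mono) auto
  thus ?thesis by (simp add: jensen_density_def)
qed (simp add: jensen_density_def)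

lemma jensen_nonneg [simp]: "jensen c \<ge> 0"
  by (simp add: jensen_def)

text \<open>The substitutions below make integrands constant in the interior, while at an end point
  they may take a default value such as 1 / 0 = 0.\<close>

lemma nn_integral_const_AE:
  fixes f :: "real \<Rightarrow> real"
  assumes "a \<le> b" "\<And>x. a < x \<Longrightarrow> x < b \<Longrightarrow> f x = c"
  shows "(\<integral>\<^sup>+x. ennreal (f x * indicator {a..b} x) \<partial>lborel) = ennreal c * ennreal (b - a)"
proof -
  have "AE x in lborel. x \<noteq> a" "AE x in lborel. x \<noteq> b" by (rule AE_lborel_singleton)+
  hence "AE x in lborel. ennreal (f x * indicator {a..b} x) = ennreal c * indicator {a..b} x"
  proof eventually_elim
    fix x assume "x \<noteq> a" "x \<noteq> b"
    thus "ennreal (f x * indicator {a..b} x) = ennreal c * indicator {a..b} x"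
      using assms(2)[of x] by (cases "x \<in> {a..b}") auto
  qed
  hence "(\<integral>\<^sup>+x. ennreal (f x * indicator {a..b} x) \<partial>lborel) = (\<integral>\<^sup>+x. ennreal c * indicator {a..b} x \<partial>lborel)"
    by (rule nn_integral_cong_AE)
  also have "\<dots> = ennreal c * ennreal (b - a)" using assms by (simp add: nn_integral_cmult_indicator)
  finally show ?thesis .
qed

text \<open>The substitution l + C = 2 cosh v turns the density into dv. Since C <= 2, the density
  sets in at l = 2 - C >= 0, so nothing is cut off at 0.\<close>

lemma nn_integral_jensen_density:
  assumes C: "C \<le> 2" and k: "k \<ge> 0"
  shows "(\<integral>\<^sup>+l. ennreal (jensen_density (l + C)) * indicator {0..k} l \<partial>lborel) = ennreal (jensen (k + C))"
proof (cases "k + C > 2")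
  case False
  have "(\<integral>\<^sup>+l. ennreal (jensen_density (l + C)) * indicator {0..k} l \<partial>lborel) = (\<integral>\<^sup>+(l::real). 0 \<partial>lborel)"
    by (intro nn_integral_cong) (use False in \<open>auto simp: jensen_density_def indicator_def\<close>)
  thus ?thesis using False by (simp add: jensen_def max_def)
next
  case True
  define V where "V = jensen (k + C)"
  have V: "V \<ge> 0" "2 * cosh V = k + C"
    using True by (auto simp: V_def jensen_def max_def)
  let ?g = "\<lambda>v. 2 * cosh v - C"
  have "(\<integral>\<^sup>+l. ennreal (jensen_density (l + C)) * indicator {0..k} l \<partial>lborel) =
     (\<integral>\<^sup>+l. ennreal (jensen_density (l + C) * indicator {?g 0..?g V} l) \<partial>lborel)"
    by (intro nn_integral_cong)
      (use C V(2) in \<open>auto simp: jensen_density_def indicator_def\<close>)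
  also have "\<dots> = (\<integral>\<^sup>+v. ennreal (jensen_density (?g v + C) * (2 * sinh v) * indicator {0..V} v) \<partial>lborel)"
    by (rule nn_integral_substitution)
       (use V in \<open>auto intro!: derivative_eq_intros continuous_intros simp: set_borel_measurable_def\<close>)
  also have "\<dots> = ennreal 1 * ennreal (V - 0)"
  proof (rule nn_integral_const_AE[OF V(1)])
    fix v :: real assume "0 < v" "v < V"
    hence s: "sinh v > 0" by simp
    have c: "cosh v > 1" using cosh_real_nonneg_less_iff[of 0 v] \<open>0 < v\<close> by simp
    have e: "(2 * cosh v)\<^sup>2 - 4 = (2 * sinh v)\<^sup>2" by (simp add: power_mult_distrib cosh_square_eq)
    have "sqrt ((2 * cosh v)\<^sup>2 - 4) = 2 * sinh v" unfolding e real_sqrt_abs using s by simp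
    thus "jensen_density (?g v + C) * (2 * sinh v) = 1"
      using s c by (simp add: jensen_density_def)
  qed
  finally show ?thesis by (simp add: V_def)
qed

text \<open>The derivative of \<open>mahler\<close> at l. Its values are extended because it is
  infinite at l = 4: near s = 1/2 the density then grows like 1 / |s - 1/2|.\<close>

definition period_integral :: "real \<Rightarrow> ennreal" where
  "period_integral l = (\<integral>\<^sup>+s. ennreal (jensen_density (l + 2 * cos (2 * pi * s))) * indicator {0..1} s \<partial>lborel)"

lemma borel_measurable_period_integral [measurable]: "period_integral \<in> borel_measurable borel"
  unfolding period_integral_def[abs_def] by measurable

lemma mahler_nonneg: assumes "k \<ge> 0" shows "mahler k \<ge> 0"
  unfolding mahler_eq_jensen[OF assms] set_lebesgue_integral_def by (intro Bochner_Integration.integral_nonneg) auto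

lemma mahler_eq_nn_integral:
  assumes k: "k \<ge> 0"
  shows "ennreal (mahler k) = (\<integral>\<^sup>+l. period_integral l * indicator {0..k} l \<partial>lborel)"
proof -
  let ?f = "\<lambda>s. jensen (k + 2 * cos (2 * pi * s))"
  have int: "set_integrable lborel {0..1} ?f"
    by (intro borel_integrable_atLeastAtMost' continuous_intros)
  have "ennreal (mahler k) = (\<integral>\<^sup>+s. ennreal (indicator {0..1} s *\<^sub>R ?f s) \<partial>lborel)"
    unfolding mahler_eq_jensen[OF k] set_lebesgue_integral_def
    by (intro nn_integral_eq_integral[symmetric] int[unfolded set_integrable_def]) (auto intro!: AE_I2)
  also have "\<dots> = (\<integral>\<^sup>+s. (\<integral>\<^sup>+l. ennreal (jensen_density (l + 2 * cos (2 * pi * s))) * indicator {0..1} s * indicator {0..k} l \<partial>lborel) \<partial>lborel)"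
  proof (intro nn_integral_cong)
    fix s :: real
    have "2 * cos (2 * pi * s) \<le> 2" by simp
    from nn_integral_jensen_density[OF this k]
    show "ennreal (indicator {0..1} s *\<^sub>R ?f s) = (\<integral>\<^sup>+l. ennreal (jensen_density (l + 2 * cos (2 * pi * s))) * indicator {0..1} s * indicator {0..k} l \<partial>lborel)"
      by (cases "s \<in> {0..1}") auto
  qed
  also have "\<dots> = (\<integral>\<^sup>+l. (\<integral>\<^sup>+s. ennreal (jensen_density (l + 2 * cos (2 * pi * s))) * indicator {0..1} s * indicator {0..k} l \<partial>lborel) \<partial>lborel)"
    by (rule lborel_pair.Fubini') measurable
  also have "\<dots> = (\<integral>\<^sup>+l. period_integral l * indicator {0..k} l \<partial>lborel)"
    unfolding period_integral_def by (intro nn_integral_cong nn_integral_multc) measurable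
  finally show ?thesis .
qed

text \<open>The substitution to follow needs cos (2 pi s) to be monotone, hence the restriction to
  the half period on which it increases.\<close>

lemma period_integral_reflect:
  "period_integral l = 2 * (\<integral>\<^sup>+s. ennreal (jensen_density (l + 2 * cos (2 * pi * s))) * indicator {1/2..1} s \<partial>lborel)"
proof -
  let ?h = "\<lambda>s. ennreal (jensen_density (l + 2 * cos (2 * pi * s)))"
  have "period_integral l = (\<integral>\<^sup>+s. ?h s * indicator {0..1/2} s + ?h s * indicator {1/2..1} s \<partial>lborel)"
    unfolding period_integral_def
  proof (rule nn_integral_cong_AE)
    have "AE s in lborel. s \<noteq> (1/2::real)" by (rule AE_lborel_singleton)
    thus "AE s in lborel. ?h s * indicator {0..1} s = ?h s * indicator {0..1/2} s + ?h s * indicator {1/2..1} s"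
      by eventually_elim (auto simp: indicator_def)
  qed
  also have "\<dots> = (\<integral>\<^sup>+s. ?h s * indicator {0..1/2} s \<partial>lborel) + (\<integral>\<^sup>+s. ?h s * indicator {1/2..1} s \<partial>lborel)"
    by (rule nn_integral_add) measurable
  also have "(\<integral>\<^sup>+s. ?h s * indicator {0..1/2} s \<partial>lborel) = (\<integral>\<^sup>+s. ?h (1 + (-1) * s) * indicator {0..1/2} (1 + (-1) * s) \<partial>lborel)"
    by (subst nn_integral_real_affine[where c = "-1" and t = 1]) auto
  also have "\<dots> = (\<integral>\<^sup>+s. ?h s * indicator {1/2..1} s \<partial>lborel)"
  proof (intro nn_integral_cong)
    fix s :: real
    have "cos (2 * pi * (1 + (-1) * s)) = cos (2 * pi * s)"
      by (simp add: algebra_simps cos_diff)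
    thus "?h (1 + (-1) * s) * indicator {0..1/2} (1 + (-1) * s) = ?h s * indicator {1/2..1} s"
      by (simp only:) (auto simp: indicator_def)
  qed
  finally show ?thesis unfolding mult_2 .
qed

lemma quartic_factor: "((h + 2)\<^sup>2 - w\<^sup>2) * (w\<^sup>2 - (h - 2)\<^sup>2) = ((w + h)\<^sup>2 - 4) * (4 - (w - h)\<^sup>2)"
  for h w :: real
  by (simp add: power2_eq_square algebra_simps)

lemma quartic_scale: "((r * a)\<^sup>2 - (r * f)\<^sup>2) * ((r * f)\<^sup>2 - (r * b)\<^sup>2) = (r\<^sup>2)\<^sup>2 * ((a\<^sup>2 - f\<^sup>2) * (f\<^sup>2 - b\<^sup>2))"
  for r a f b :: real
  by (simp add: power2_eq_square algebra_simps)

text \<open>The substitution \<open>w = l/2 + 2 cos (2 \<pi> s)\<close> gives a complete elliptic integral.\<close>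

lemma period_integral_quartic:
  assumes l: "l > 0"
  shows "period_integral l = (\<integral>\<^sup>+w. ennreal (1 / (pi * sqrt (((l/2 + 2)\<^sup>2 - w\<^sup>2) * (w\<^sup>2 - (l/2 - 2)\<^sup>2))) *
     indicator {\<bar>l/2 - 2\<bar>..l/2 + 2} w) \<partial>lborel)"
proof -
  define F where "F w = jensen_density (w + l/2) / (2 * pi * sqrt (4 - (w - l/2)\<^sup>2))" for w
  let ?g = "\<lambda>s. l/2 + 2 * cos (2 * pi * s)"
  let ?g' = "\<lambda>s. - 4 * pi * sin (2 * pi * s)"
  have Fm [measurable]: "F \<in> borel_measurable borel" unfolding F_def[abs_def] by measurable
  have cos_bound: "w\<^sup>2 \<le> 4" if "w \<in> {-2..2}" for w :: real
    using that abs_le_square_iff[of w 2] by auto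
  have "(\<integral>\<^sup>+s. ennreal (jensen_density (l + 2 * cos (2 * pi * s))) * indicator {1/2..1} s \<partial>lborel) =
     (\<integral>\<^sup>+s. ennreal (F (?g s) * ?g' s * indicator {1/2..1} s) \<partial>lborel)"
  proof (rule nn_integral_cong_AE)
    have "AE s in lborel. s \<noteq> (1/2::real)" "AE s in lborel. s \<noteq> (1::real)" by (rule AE_lborel_singleton)+
    thus "AE s in lborel. ennreal (jensen_density (l + 2 * cos (2 * pi * s))) * indicator {1/2..1} s = ennreal (F (?g s) * ?g' s * indicator {1/2..1} s)"
    proof eventually_elim
      fix s :: real assume s: "s \<noteq> 1/2" "s \<noteq> 1"
      show "ennreal (jensen_density (l + 2 * cos (2 * pi * s))) * indicator {1/2..1} s = ennreal (F (?g s) * ?g' s * indicator {1/2..1} s)"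
      proof (cases "s \<in> {1/2..1}")
        case True
        with s have "1/2 < s" "s < 1" by auto
        hence "pi * (1/2) < pi * s" "pi * s < pi * 1" by (intro mult_strict_left_mono; simp)+
        hence neg: "sin (2 * pi * s) < 0" by (intro sin_lt_zero) auto
        have "4 - (2 * cos (2 * pi * s))\<^sup>2 = (2 * sin (2 * pi * s))\<^sup>2"
          by (simp add: power_mult_distrib cos_squared_eq)
        hence "sqrt (4 - (?g s - l/2)\<^sup>2) = sqrt ((2 * sin (2 * pi * s))\<^sup>2)"
          by (simp only: add_diff_cancel_left')
        also have "\<dots> = \<bar>2 * sin (2 * pi * s)\<bar>" by (rule real_sqrt_abs)
        finally have "sqrt (4 - (?g s - l/2)\<^sup>2) = - 2 * sin (2 * pi * s)" using neg by simp
        hence "F (?g s) * ?g' s = jensen_density (l + 2 * cos (2 * pi * s))"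
          unfolding F_def using neg by (simp add: algebra_simps)
        thus ?thesis using True by simp
      qed auto
    qed
  qed
  also have "\<dots> = (\<integral>\<^sup>+w. ennreal (F w * indicator {?g (1/2)..?g 1} w) \<partial>lborel)"
  proof (rule nn_integral_substitution[symmetric])
    show "set_borel_measurable borel {?g (1/2)..?g 1} F" using Fm by (auto simp: set_borel_measurable_def)
    fix s :: real assume s: "s \<in> {1/2..1}"
    show "((\<lambda>s. l/2 + 2 * cos (2 * pi * s)) has_real_derivative ?g' s) (at s)"
      by (auto intro!: derivative_eq_intros)
    have "sin (2 * pi * s) \<le> 0"
    proof (cases "s = 1")
      case False
      thus ?thesis using s by (intro sin_le_zero) auto
    qed simp
    thus "0 \<le> ?g' s" by (simp add: mult_nonneg_nonpos)
  qed (auto intro!: continuous_intros)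
  finally have 1: "period_integral l = 2 * (\<integral>\<^sup>+w. ennreal (F w * indicator {l/2 - 2..l/2 + 2} w) \<partial>lborel)"
    by (simp add: period_integral_reflect)
  have "\<dots> = (\<integral>\<^sup>+w. 2 * ennreal (F w * indicator {l/2 - 2..l/2 + 2} w) \<partial>lborel)"
    by (intro nn_integral_cmult[symmetric]) measurable
  also have "\<dots> = (\<integral>\<^sup>+w. ennreal (1 / (pi * sqrt (((l/2 + 2)\<^sup>2 - w\<^sup>2) * (w\<^sup>2 - (l/2 - 2)\<^sup>2))) *
     indicator {\<bar>l/2 - 2\<bar>..l/2 + 2} w) \<partial>lborel)"
  proof (rule nn_integral_cong_AE)
    have "AE w in lborel. w \<noteq> l/2 - 2" "AE w in lborel. w \<noteq> 2 - l/2" by (rule AE_lborel_singleton)+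
    thus "AE w in lborel. 2 * ennreal (F w * indicator {l/2 - 2..l/2 + 2} w) =
      ennreal (1 / (pi * sqrt (((l/2 + 2)\<^sup>2 - w\<^sup>2) * (w\<^sup>2 - (l/2 - 2)\<^sup>2))) * indicator {\<bar>l/2 - 2\<bar>..l/2 + 2} w)"
    proof eventually_elim
      fix w assume w: "w \<noteq> l/2 - 2" "w \<noteq> 2 - l/2"
      \<comment> \<open>For l < 4 the stretch from l/2 - 2 to 2 - l/2 has w + l/2 <= 2 and carries
        no density; this is how the lower limit becomes an absolute value.\<close>
      consider "w \<in> {\<bar>l/2 - 2\<bar>..l/2 + 2}" | "w \<in> {l/2 - 2..l/2 + 2}" "w \<notin> {\<bar>l/2 - 2\<bar>..l/2 + 2}" | "w \<notin> {l/2 - 2..l/2 + 2}" "w \<notin> {\<bar>l/2 - 2\<bar>..l/2 + 2}"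
        by blast
      thus "2 * ennreal (F w * indicator {l/2 - 2..l/2 + 2} w) =
        ennreal (1 / (pi * sqrt (((l/2 + 2)\<^sup>2 - w\<^sup>2) * (w\<^sup>2 - (l/2 - 2)\<^sup>2))) * indicator {\<bar>l/2 - 2\<bar>..l/2 + 2} w)"
      proof cases
        case 1
        hence big: "w + l/2 > 2" using w by auto
        have in2: "w \<in> {l/2 - 2..l/2 + 2}" using 1 by auto
        have f: "((l/2 + 2)\<^sup>2 - w\<^sup>2) * (w\<^sup>2 - (l/2 - 2)\<^sup>2) = ((w + l/2)\<^sup>2 - 4) * (4 - (w - l/2)\<^sup>2)"
          by (rule quartic_factor)
        have "2 * F w = 1 / (pi * sqrt (((l/2 + 2)\<^sup>2 - w\<^sup>2) * (w\<^sup>2 - (l/2 - 2)\<^sup>2)))"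
          unfolding F_def f real_sqrt_mult using big by (simp add: jensen_density_def)
        moreover have "2 * ennreal (F w) = ennreal (2 * F w)"
          by (simp add: ennreal_mult' flip: ennreal_numeral)
        ultimately show ?thesis using 1 in2 by simp
      next
        case 2
        hence "w + l/2 \<le> 2" by auto
        thus ?thesis using 2 by (simp add: F_def jensen_density_def)
      next
        case 3
        thus ?thesis by simp
      qed
    qed
  qed
  finally show ?thesis unfolding 1 .
qed

lemma cos_even_minus [simp]: "cos_even x (- u) = cos_even x u"
  and cos_odd_minus [simp]: "cos_odd x (- u) = cos_odd x u"
  and lam'_minus [simp]: "lam' x (- u) = - lam' x u"
  by (simp_all add: cos_even_def cos_odd_def lam'_def infsum_uminus)

text \<open>For f = \<open>cos_even + cos_odd\<close>, with value a = E + O at 0 and b = E - O at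
  pi, this is the equation (a^2 - f^2) (f^2 - b^2) = 4 f'^2, as f' = f \<open>lam'\<close>.\<close>

lemma quartic_identity:
  assumes x: "x > 0"
  shows "((sech_even x + sech_odd x)\<^sup>2 - (cos_even x u + cos_odd x u)\<^sup>2) * ((cos_even x u + cos_odd x u)\<^sup>2 - (sech_even x - sech_odd x)\<^sup>2)
     = (2 * (cos_even x u + cos_odd x u) * lam' x u)\<^sup>2"
proof -
  \<comment> \<open>dn^2 - k^2 cn^2 is constant because each of the two functions has the other one
    times \<open>lam'\<close> as its derivative.\<close>
  define h where "h u = (cos_even x u)\<^sup>2 - (cos_odd x u)\<^sup>2" for u
  have "(h has_real_derivative 0) (at u)" for u
    unfolding h_def[abs_def]
    by (auto intro!: derivative_eq_intros has_derivative_cos_even[OF x] has_derivative_cos_odd[OF x])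
  hence "h u = h 0" by (intro DERIV_isconst_all) auto
  hence h: "(cos_odd x u)\<^sup>2 = (cos_even x u)\<^sup>2 - (sech_even x)\<^sup>2 + (sech_odd x)\<^sup>2"
    by (simp add: h_def cos_even_0 cos_odd_0)
  have "(2 * (cos_even x u + cos_odd x u) * lam' x u)\<^sup>2 = 4 * (cos_even x u + cos_odd x u)\<^sup>2 * ((sech_even x)\<^sup>2 - (cos_even x u)\<^sup>2)"
    unfolding power_mult_distrib lam'_square[OF x] by simp
  thus ?thesis using h by algebra
qed

text \<open>
  \<open>cos_even x + cos_odd x\<close> is a constant times the Jacobi function \<open>dn\<close>, so it inverts this elliptic
  integral.
\<close>

lemma period_integral_eq:
  assumes x: "x > 0" and r: "r > 0" and l: "l > 0"
    and \<alpha>: "l/2 + 2 = r * (sech_even x + sech_odd x)" and \<beta>: "\<bar>l/2 - 2\<bar> = r * (sech_even x - sech_odd x)"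
  shows "period_integral l = ennreal (1 / (2 * r))"
proof -
  define f where "f u = cos_even x u + cos_odd x u" for u
  define H where "H w = 1 / (pi * sqrt (((l/2 + 2)\<^sup>2 - w\<^sup>2) * (w\<^sup>2 - (l/2 - 2)\<^sup>2)))" for w
  have fpos: "f u > 0" for u
    unfolding f_def cos_even_plus_cos_odd[OF x] using sech_even_ge_1[OF x] sech_odd_pos[OF x]
    by (intro mult_pos_pos add_pos_pos) auto
  have f': "(f has_real_derivative f u * lam' x u) (at u)" for u
    unfolding f_def[abs_def]
    by (auto intro!: derivative_eq_intros has_derivative_cos_even[OF x] has_derivative_cos_odd[OF x] simp: algebra_simps)
  have ends: "r * f (- pi) = \<bar>l/2 - 2\<bar>" "r * f 0 = l/2 + 2"
    by (simp_all add: f_def \<alpha> \<beta> cos_even_0 cos_odd_0 cos_even_pi cos_odd_pi)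
  have cont: "continuous_on A f" "continuous_on A (lam' x)" for A
    using f' has_derivative_lam'[OF x] by (meson DERIV_isCont continuous_at_imp_continuous_on)+
  have lam'_pos: "lam' x u > 0" if "- pi < u" "u < 0" for u
    using lam'_neg[OF x, of "- u"] that by simp
  have b2: "(l/2 - 2)\<^sup>2 = (r * (sech_even x - sech_odd x))\<^sup>2" unfolding \<beta>[symmetric] by simp
  \<comment> \<open>The substitution w = r f(u) runs over -pi <= u <= 0, where f increases. By the
    quartic identity the integrand becomes the constant 1 / (2 pi r) on an interval of length
    pi.\<close>
  have "period_integral l = (\<integral>\<^sup>+w. ennreal (H w * indicator {r * f (- pi)..r * f 0} w) \<partial>lborel)"
    unfolding ends H_def by (rule period_integral_quartic[OF l])
  also have "\<dots> = (\<integral>\<^sup>+u. ennreal (H (r * f u) * (r * (f u * lam' x u)) * indicator {- pi..0} u) \<partial>lborel)"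
  proof (rule nn_integral_substitution)
    show "set_borel_measurable borel {r * f (- pi)..r * f 0} H"
      unfolding set_borel_measurable_def H_def[abs_def] by measurable
    fix u assume u: "u \<in> {- pi..0}"
    show "((\<lambda>u. r * f u) has_real_derivative r * (f u * lam' x u)) (at u)"
      by (intro DERIV_cmult f')
    show "r * (f u * lam' x u) \<ge> 0"
    proof (cases "u = - pi \<or> u = 0")
      case True
      hence "lam' x u = 0"
        using lam'_square[OF x, of pi] by (auto simp: cos_even_pi)
      thus ?thesis by simp
    next
      case False
      thus ?thesis using u r fpos[of u] lam'_pos[of u] by simp
    qed
  qed (auto intro!: continuous_intros cont)
  also have "\<dots> = ennreal (1 / (2 * pi * r)) * ennreal (0 - (- pi))"
  proof (rule nn_integral_const_AE)
    fix u assume u: "- pi < u" "u < 0"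
    have "((l/2 + 2)\<^sup>2 - (r * f u)\<^sup>2) * ((r * f u)\<^sup>2 - (l/2 - 2)\<^sup>2) = (r\<^sup>2 * (2 * f u * lam' x u))\<^sup>2"
      unfolding \<alpha> b2 quartic_scale unfolding f_def quartic_identity[OF x] power_mult_distrib[of "r\<^sup>2"] ..
    hence "sqrt (((l/2 + 2)\<^sup>2 - (r * f u)\<^sup>2) * ((r * f u)\<^sup>2 - (l/2 - 2)\<^sup>2)) = r\<^sup>2 * (2 * f u * lam' x u)"
      using fpos[of u] lam'_pos[OF u] by (simp add: real_sqrt_abs)
    thus "H (r * f u) * (r * (f u * lam' x u)) = 1 / (2 * pi * r)"
      unfolding H_def using fpos[of u] lam'_pos[OF u] r by (simp add: power2_eq_square field_simps)
  qed auto
  also have "\<dots> = ennreal (1 / (2 * pi * r) * pi)" using r by (subst ennreal_mult) auto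
  also have "1 / (2 * pi * r) * pi = 1 / (2 * r)" by simp
  finally show ?thesis .
qed

text \<open>The scale r is 2 / O, respectively 2 / E. Passing from E / O to O / E turns l/2 - 2 = 2
  (E - O) / O into -2 (E - O) / E, and the absolute value absorbs the sign.\<close>

lemma period_integral_ratio:
  assumes x: "x > 0"
  shows "period_integral (4 * ratio x) = ennreal (sech_odd x / 4)"
    and "period_integral (4 / ratio x) = ennreal (sech_even x / 4)"
proof -
  note pos = sech_odd_pos[OF x] sech_even_ge_1[OF x] sech_odd_less_even[OF x]
  have "period_integral (4 * ratio x) = ennreal (1 / (2 * (2 / sech_odd x)))"
    by (rule period_integral_eq[OF x]) (use pos in \<open>auto simp: ratio_def field_simps abs_if\<close>)
  thus "period_integral (4 * ratio x) = ennreal (sech_odd x / 4)" by simp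
  have "period_integral (4 / ratio x) = ennreal (1 / (2 * (2 / sech_even x)))"
    by (rule period_integral_eq[OF x]) (use pos in \<open>auto simp: ratio_def field_simps abs_if\<close>)
  thus "period_integral (4 / ratio x) = ennreal (sech_even x / 4)" by simp
qed

section \<open>Increments of the Mahler measure along the parametrization\<close>

lemma mahler_diff_nn_integral:
  assumes "0 \<le> k1" "k1 \<le> k2"
  shows "ennreal (mahler k2) = ennreal (mahler k1) + (\<integral>\<^sup>+l. period_integral l * indicator {k1..k2} l \<partial>lborel)"
proof -
  have "ennreal (mahler k2) = (\<integral>\<^sup>+l. period_integral l * indicator {0..k1} l + period_integral l * indicator {k1..k2} l \<partial>lborel)"
    unfolding mahler_eq_nn_integral[OF order.trans[OF assms]]
  proof (rule nn_integral_cong_AE)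
    have "AE l in lborel. l \<noteq> k1" by (rule AE_lborel_singleton)
    thus "AE l in lborel. period_integral l * indicator {0..k2} l = period_integral l * indicator {0..k1} l + period_integral l * indicator {k1..k2} l"
      by eventually_elim (use assms in \<open>auto simp: indicator_def\<close>)
  qed
  also have "\<dots> = ennreal (mahler k1) + (\<integral>\<^sup>+l. period_integral l * indicator {k1..k2} l \<partial>lborel)"
    unfolding mahler_eq_nn_integral[OF assms(1)] by (rule nn_integral_add) measurable
  finally show ?thesis .
qed

text \<open>Change of variables l = g x in the integral representation, followed by the fundamental
  theorem of calculus. This yields the increment without differentiating
  \<open>mahler\<close>.\<close>

lemma mahler_diff_substitution:
  assumes ab: "a \<le> b"
    and g: "\<And>x. x \<in> {a..b} \<Longrightarrow> (g has_real_derivative g' x) (at x)" "continuous_on {a..b} g'"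
      "\<And>x. x \<in> {a..b} \<Longrightarrow> g' x \<ge> 0" "\<And>x. x \<in> {a..b} \<Longrightarrow> g x \<ge> 0"
    and p: "\<And>x. x \<in> {a..b} \<Longrightarrow> period_integral (g x) = ennreal (p x)" "\<And>x. x \<in> {a..b} \<Longrightarrow> p x \<ge> 0" "continuous_on {a..b} p"
    and A: "\<And>x. x \<in> {a..b} \<Longrightarrow> (A has_real_derivative p x * g' x) (at x)"
  shows "mahler (g b) - mahler (g a) = A b - A a"
proof -
  have mono: "g x \<le> g y" if "a \<le> x" "x \<le> y" "y \<le> b" for x y
  proof (rule DERIV_nonneg_imp_nondecreasing[OF that(2)])
    fix z assume "x \<le> z" "z \<le> y"
    thus "\<exists>d. (g has_real_derivative d) (at z) \<and> 0 \<le> d"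
      using that g(1)[of z] g(3)[of z] by (intro exI[of _ "g' z"]) auto
  qed
  have contg: "continuous_on {a..b} g"
    using g(1) by (meson DERIV_isCont continuous_at_imp_continuous_on)
  let ?P = "\<lambda>l. enn2real (period_integral l)"
  have P: "period_integral l = ennreal (?P l)" if l: "l \<in> {g a..g b}" for l
  proof -
    obtain x where "a \<le> x" "x \<le> b" "g x = l"
      using IVT'[of g a l b] l ab contg by auto
    thus ?thesis using p by auto
  qed
  let ?q = "\<lambda>x. p x * g' x * indicator {a..b} x"
  have qm: "?q \<in> borel_measurable borel"
    using borel_measurable_continuous_on_indicator[of "{a..b}" "\<lambda>x. p x * g' x"] p(3) g(2)
    by (auto intro!: continuous_intros simp: mult.commute)
  have "(\<integral>\<^sup>+l. period_integral l * indicator {g a..g b} l \<partial>lborel) = (\<integral>\<^sup>+l. ennreal (?P l * indicator {g a..g b} l) \<partial>lborel)"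
  proof (intro nn_integral_cong)
    fix l show "period_integral l * indicator {g a..g b} l = ennreal (?P l * indicator {g a..g b} l)"
      by (cases "l \<in> {g a..g b}") (use P in auto)
  qed
  also have "\<dots> = (\<integral>\<^sup>+x. ennreal (?P (g x) * g' x * indicator {a..b} x) \<partial>lborel)"
    by (rule nn_integral_substitution) (use g ab in \<open>auto simp: set_borel_measurable_def\<close>)
  also have "\<dots> = (\<integral>\<^sup>+x. ennreal (?q x) * indicator {a..b} x \<partial>lborel)"
    by (intro nn_integral_cong) (use p in \<open>auto simp: indicator_def\<close>)
  also have "\<dots> = ennreal (A b - A a)"
    by (rule nn_integral_FTC_Icc[OF qm]) (use A g p ab in \<open>auto simp: indicator_def\<close>)
  finally have 1: "(\<integral>\<^sup>+l. period_integral l * indicator {g a..g b} l \<partial>lborel) = ennreal (A b - A a)" .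
  have A_le: "A a \<le> A b"
    by (rule DERIV_nonneg_imp_nondecreasing[OF ab]) (use A g(3) p(2) in \<open>force intro: mult_nonneg_nonneg\<close>)
  have ga: "0 \<le> g a" "0 \<le> g b" "g a \<le> g b" using g(4)[of a] g(4)[of b] mono[of a b] ab by auto
  have "ennreal (mahler (g b)) = ennreal (mahler (g a)) + ennreal (A b - A a)"
    using mahler_diff_nn_integral[OF ga(1,3)] unfolding 1 .
  also have "\<dots> = ennreal (mahler (g a) + (A b - A a))"
    using A_le mahler_nonneg[OF ga(1)] by simp
  finally have "mahler (g b) = mahler (g a) + (A b - A a)"
    using A_le mahler_nonneg[OF ga(1)] mahler_nonneg[OF ga(2)] by (subst (asm) ennreal_inj) auto
  thus ?thesis by simp
qed

lemma continuous_on_ratio_derivative: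
  "continuous_on {0<..} (\<lambda>x. ratio x * ((sech_even x)\<^sup>2 - (sech_odd x)\<^sup>2))"
  by (intro continuous_intros continuous_on_ratio continuous_on_sech_even continuous_on_sech_odd)

lemma mahler_diff_ratio:
  assumes x: "0 < x1" "x1 \<le> x2"
    and A: "\<And>x. x > 0 \<Longrightarrow> (A has_real_derivative sech_even x * ((sech_even x)\<^sup>2 - (sech_odd x)\<^sup>2)) (at x)"
  shows "mahler (4 * ratio x2) - mahler (4 * ratio x1) = A x2 - A x1"
proof (rule mahler_diff_substitution[OF x(2)])
  fix x assume "x \<in> {x1..x2}"
  hence x0: "x > 0" using x by auto
  note pos = sech_odd_pos[OF x0] sech_even_ge_1[OF x0] sech_odd_less_even[OF x0] ratio_gt_1[OF x0]
  show "((\<lambda>x. 4 * ratio x) has_real_derivative 4 * (ratio x * ((sech_even x)\<^sup>2 - (sech_odd x)\<^sup>2))) (at x)"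
    by (intro DERIV_cmult has_derivative_ratio x0)
  show "0 \<le> 4 * (ratio x * ((sech_even x)\<^sup>2 - (sech_odd x)\<^sup>2))" using pos by (simp add: power_mono)
  show "0 \<le> 4 * ratio x" using pos by simp
  show "period_integral (4 * ratio x) = ennreal (sech_odd x / 4)" by (rule period_integral_ratio[OF x0])
  show "0 \<le> sech_odd x / 4" using pos by simp
  have e: "sech_odd x / 4 * (4 * (ratio x * ((sech_even x)\<^sup>2 - (sech_odd x)\<^sup>2))) = sech_even x * ((sech_even x)\<^sup>2 - (sech_odd x)\<^sup>2)"
    using pos by (simp add: ratio_def)
  show "(A has_real_derivative sech_odd x / 4 * (4 * (ratio x * ((sech_even x)\<^sup>2 - (sech_odd x)\<^sup>2)))) (at x)"
    unfolding e by (rule A[OF x0])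
next
  show "continuous_on {x1..x2} (\<lambda>x. 4 * (ratio x * ((sech_even x)\<^sup>2 - (sech_odd x)\<^sup>2)))"
    by (intro continuous_on_mult continuous_on_const continuous_on_subset[OF continuous_on_ratio_derivative]) (use x in auto)
  show "continuous_on {x1..x2} (\<lambda>x. sech_odd x / 4)"
    by (intro continuous_intros continuous_on_subset[OF continuous_on_sech_odd]) (use x in auto)
qed

lemma mahler_diff_inverse_ratio:
  assumes x: "0 < x1" "x1 \<le> x2"
    and B: "\<And>x. x > 0 \<Longrightarrow> (B has_real_derivative sech_odd x * ((sech_even x)\<^sup>2 - (sech_odd x)\<^sup>2)) (at x)"
  shows "mahler (4 / ratio x1) - mahler (4 / ratio x2) = B x2 - B x1"
proof -
  let ?d = "\<lambda>x. 4 * ((sech_even x)\<^sup>2 - (sech_odd x)\<^sup>2) / ratio x"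
  \<comment> \<open>4 / ratio x decreases in x, so the increasing parametrization is by y =
    -x.\<close>
  have "mahler (4 / ratio (- (- x1))) - mahler (4 / ratio (- (- x2))) = - B (- (- x1)) - (- B (- (- x2)))"
  proof (rule mahler_diff_substitution[where g = "\<lambda>y. 4 / ratio (- y)" and A = "\<lambda>y. - B (- y)" and g' = "\<lambda>y. ?d (- y)" and p = "\<lambda>y. sech_even (- y) / 4"])
    show "- x2 \<le> - x1" using x by simp
    fix y assume "y \<in> {- x2..- x1}"
    hence x0: "- y > 0" using x by auto
    note pos = sech_odd_pos[OF x0] sech_even_ge_1[OF x0] sech_odd_less_even[OF x0] ratio_gt_1[OF x0]
    have um: "(uminus has_real_derivative -1) (at y)" by (auto intro!: derivative_eq_intros)
    show "((\<lambda>y. 4 / ratio (- y)) has_real_derivative ?d (- y)) (at y)"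
      using pos by (auto intro!: derivative_eq_intros DERIV_chain2[where g = uminus, OF has_derivative_ratio[OF x0] um] simp: field_simps)
    show "0 \<le> ?d (- y)" using pos by (simp add: power_mono)
    show "0 \<le> 4 / ratio (- y)" using pos by simp
    show "period_integral (4 / ratio (- y)) = ennreal (sech_even (- y) / 4)" by (rule period_integral_ratio[OF x0])
    show "0 \<le> sech_even (- y) / 4" using pos by simp
    have e: "sech_even (- y) / 4 * ?d (- y) = sech_odd (- y) * ((sech_even (- y))\<^sup>2 - (sech_odd (- y))\<^sup>2)"
      using pos by (simp add: ratio_def)
    show "((\<lambda>y. - B (- y)) has_real_derivative sech_even (- y) / 4 * ?d (- y)) (at y)"
      unfolding e by (auto intro!: derivative_eq_intros DERIV_chain2[where g = uminus, OF B[OF x0] um])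
  next
    have nz: "\<forall>x\<in>{x1..x2}. ratio x \<noteq> 0"
    proof
      fix z assume "z \<in> {x1..x2}"
      thus "ratio z \<noteq> 0" using ratio_gt_1[of z] x by simp
    qed
    have "continuous_on {x1..x2} ?d"
      by (intro continuous_intros continuous_on_subset[OF continuous_on_ratio]
         continuous_on_subset[OF continuous_on_sech_even] continuous_on_subset[OF continuous_on_sech_odd])
        (use x nz in auto)
    thus "continuous_on {- x2..- x1} (\<lambda>y. ?d (- y))"
      by (rule continuous_on_compose2[where f = uminus]) (auto intro: continuous_on_minus)
    have "continuous_on {x1..x2} (\<lambda>x. sech_even x / 4)"
      by (intro continuous_intros continuous_on_subset[OF continuous_on_sech_even]) (use x in auto)
    thus "continuous_on {- x2..- x1} (\<lambda>y. sech_even (- y) / 4)"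
      by (rule continuous_on_compose2[where f = uminus]) (auto intro: continuous_on_minus)
  qed
  thus ?thesis by simp
qed

section \<open>The dilogarithm on the imaginary axis\<close>

definition arctan_quot :: "real \<Rightarrow> real" where
  "arctan_quot v = (if v = 0 then 1 else arctan v / v)"

lemma continuous_on_arctan_quot: "continuous_on A arctan_quot"
proof (rule continuous_at_imp_continuous_on, rule ballI)
  fix v :: real
  show "isCont arctan_quot v"
  proof (cases "v = 0")
    case True
    have "(arctan has_real_derivative 1) (at 0)" by (auto intro!: derivative_eq_intros)
    hence "(\<lambda>y. arctan y / y) \<midarrow>0\<rightarrow> 1" by (simp add: has_field_derivative_iff)
    moreover have "eventually (\<lambda>y. arctan y / y = arctan_quot y) (at 0)"
      by (auto simp: arctan_quot_def eventually_at_filter)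
    ultimately have "arctan_quot \<midarrow>0\<rightarrow> 1" by (rule Lim_transform_eventually)
    thus ?thesis using True by (simp add: isCont_def arctan_quot_def)
  next
    case False
    have "isCont (\<lambda>v. arctan v / v) v" using False by (auto intro!: continuous_intros)
    moreover have "eventually (\<lambda>y. y \<noteq> 0) (nhds v)"
      using False by (intro t1_space_nhds) 
    hence "eventually (\<lambda>y. arctan_quot y = arctan y / y) (nhds v)"
      by eventually_elim (simp add: arctan_quot_def)
    ultimately show ?thesis by (simp add: isCont_cong)
  qed
qed

text \<open>The inverse tangent integral Ti_2; its value at 1 is Catalan's constant.\<close>

definition arctan_integral :: "real \<Rightarrow> real" where
  "arctan_integral r = integral {0..r} arctan_quot"

lemma has_derivative_arctan_integral_within:
  assumes "0 \<le> r" "r \<le> b"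
  shows "(arctan_integral has_real_derivative arctan_quot r) (at r within {0..b})"
  unfolding arctan_integral_def[abs_def]
  by (rule integral_has_real_derivative[OF continuous_on_arctan_quot]) (use assms in auto)

lemma has_derivative_arctan_integral:
  assumes "0 < r"
  shows "(arctan_integral has_real_derivative arctan r / r) (at r)"
  using has_derivative_arctan_integral_within[of r "r + 1"] assms
  by (simp add: at_within_Icc_at arctan_quot_def)

lemma arctan_integral_scale:
  assumes r: "r > 0"
  shows "((\<lambda>t. r * arctan_quot (r * t)) has_integral arctan_integral r) {0..1}"
proof -
  have "((\<lambda>t. r * arctan_quot (r * t)) has_integral arctan_integral (r * 1) - arctan_integral (r * 0)) {0..1}"
  proof (rule fundamental_theorem_of_calculus)
    fix t :: real assume t: "t \<in> {0..1}"
    have "((\<lambda>t. arctan_integral (r * t)) has_real_derivative arctan_quot (r * t) * r) (at t within {0..1})"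
    proof (rule DERIV_image_chain[unfolded o_def, where f = arctan_integral and g = "(*) r"])
      have "r * t \<le> r * 1" using t r by (intro mult_left_mono) auto
      hence "(arctan_integral has_real_derivative arctan_quot (r * t)) (at (r * t) within {0..r})"
        using t r by (intro has_derivative_arctan_integral_within) auto
      thus "(arctan_integral has_real_derivative arctan_quot (r * t)) (at (r * t) within (*) r ` {0..1})"
        by (rule DERIV_subset) (use r in \<open>auto simp: mult_left_le\<close>)
      show "((*) r has_real_derivative r) (at t within {0..1})" by (auto intro!: derivative_eq_intros)
    qed
    thus "((\<lambda>t. arctan_integral (r * t)) has_vector_derivative r * arctan_quot (r * t)) (at t within {0..1})"
      by (simp add: has_real_derivative_iff_has_vector_derivative mult.commute)
  qed auto
  thus ?thesis by (simp add: arctan_integral_def)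
qed

text \<open>The value of D at z = -i r for r > 0: there 1 - z = 1 + i r has argument arctan r, and
  Li_2 has imaginary part -Ti_2(r).\<close>

definition dilog_imag :: "real \<Rightarrow> real" where
  "dilog_imag r = ln r * arctan r - arctan_integral r"

text \<open>For imaginary c the point 1 + c t stays off the branch cut of Ln, and filling the
  removable singularity at t = 0 makes the integrand continuous.\<close>

lemma Ln_quot_integrable:
  fixes c :: complex
  assumes c: "Re c = 0"
  shows "(\<lambda>t. Ln (1 + c * of_real t) / of_real t) integrable_on {0..1}"
proof -
  define k where "k w = (if w = 0 then 1 else Ln (1 + w) / w)" for w :: complex
  have k: "isCont k w" if "Re w = 0" for w
  proof (cases "w = 0")
    case True
    have "((\<lambda>w. Ln (1 + w)) has_field_derivative 1) (at 0)" by (auto intro!: derivative_eq_intros)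
    hence "(\<lambda>w. Ln (1 + w) / w) \<midarrow>0\<rightarrow> 1" by (simp add: has_field_derivative_iff)
    moreover have "eventually (\<lambda>y. Ln (1 + y) / y = k y) (at 0)"
      by (auto simp: k_def eventually_at_filter)
    ultimately have "k \<midarrow>0\<rightarrow> 1" by (rule Lim_transform_eventually)
    thus ?thesis using True by (simp add: isCont_def k_def)
  next
    case False
    have "1 + w \<notin> \<real>\<^sub>\<le>\<^sub>0" using that by (auto simp: complex_nonpos_Reals_iff)
    hence "isCont (\<lambda>w. Ln (1 + w) / w) w" using False by (auto intro!: continuous_intros)
    moreover have "eventually (\<lambda>y. y \<noteq> 0) (nhds w)"
      using False by (intro t1_space_nhds)
    hence "eventually (\<lambda>y. k y = Ln (1 + y) / y) (nhds w)"
      by eventually_elim (simp add: k_def)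
    ultimately show ?thesis by (simp add: isCont_cong)
  qed
  have "continuous_on {0..1} (\<lambda>t. c * k (c * of_real t))"
  proof (intro continuous_at_imp_continuous_on ballI)
    fix t :: real
    have "isCont (\<lambda>t. k (c * of_real t)) t"
      by (rule isCont_o2[of t "\<lambda>t. c * of_real t" k]) (use c k in \<open>auto intro!: continuous_intros\<close>)
    thus "isCont (\<lambda>t. c * k (c * of_real t)) t" by (intro continuous_intros)
  qed
  hence "(\<lambda>t. c * k (c * of_real t)) integrable_on {0..1}" by (rule integrable_continuous_interval)
  thus ?thesis
    by (rule integrable_spike[of _ _ "{0}"]) (auto simp: k_def)
qed

lemma Im_Ln_imag: "Im (Ln (1 + \<i> * of_real r)) = arctan r"
  using arg_conv_arctan[of "1 + \<i> * of_real r"] Arg_eq_Im_Ln[of "1 + \<i> * of_real r"]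
  by (simp add: complex_eq_iff)

lemma bloch_wigner_imag:
  assumes r: "r > 0"
  shows "bloch_wigner (- \<i> * of_real r) = dilog_imag r"
proof -
  let ?z = "- \<i> * complex_of_real r"
  have z: "?z \<notin> branch_cut" using r by (auto simp: branch_cut_def complex_eq_iff)
  have "Im (Li2 ?z) = - arctan_integral r"
  proof -
    have "Li2 ?z = - integral {0..1} (\<lambda>t. Ln (1 - linepath 0 ?z t) / linepath 0 ?z t * ?z)"
      by (simp add: Li2_def contour_integral_integral)
    also have "integral {0..1} (\<lambda>t. Ln (1 - linepath 0 ?z t) / linepath 0 ?z t * ?z) =
       integral {0..1} (\<lambda>t. Ln (1 + \<i> * of_real r * of_real t) / of_real t)"
      using r by (intro integral_cong) (auto simp: linepath_def scaleR_conv_of_real field_simps)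
    finally have L: "Li2 ?z = - integral {0..1} (\<lambda>t. Ln (1 + \<i> * of_real r * of_real t) / of_real t)" .
    have int: "(\<lambda>t. Ln (1 + \<i> * of_real r * of_real t) / of_real t) integrable_on {0..1}"
      by (rule Ln_quot_integrable) simp
    have "((\<lambda>t. Im (Ln (1 + \<i> * of_real r * of_real t) / of_real t)) has_integral
       Im (integral {0..1} (\<lambda>t. Ln (1 + \<i> * of_real r * of_real t) / of_real t))) {0..1}"
      by (rule has_integral_Im[OF integrable_integral[OF int]])
    moreover have "((\<lambda>t. Im (Ln (1 + \<i> * of_real r * of_real t) / of_real t)) has_integral arctan_integral r) {0..1}"
    proof (rule has_integral_spike[OF _ _ arctan_integral_scale[OF r], of "{0}"])
      fix t :: real assume t: "t \<in> {0..1} - {0}"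
      have "Im (Ln (1 + \<i> * of_real r * of_real t) / of_real t) = arctan (r * t) / t"
        using Im_Ln_imag[of "r * t"] by (simp add: mult.assoc Im_divide_of_real)
      thus "Im (Ln (1 + \<i> * of_real r * of_real t) / of_real t) = r * arctan_quot (r * t)"
        using t r by (simp add: arctan_quot_def)
    qed auto
    ultimately have "Im (integral {0..1} (\<lambda>t. Ln (1 + \<i> * of_real r * of_real t) / of_real t)) = arctan_integral r"
      by (rule has_integral_unique)
    thus ?thesis unfolding L by simp
  qed
  moreover have "Im (of_real (ln (cmod ?z)) * Ln (1 - ?z)) = ln r * arctan r"
    using Im_Ln_imag[of r] r by (simp add: norm_mult)
  ultimately show ?thesis
    using z unfolding bloch_wigner_def Let_def dilog_imag_def by simp
qed

lemma has_derivative_dilog_imag: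
  assumes r: "r > 0"
  shows "(dilog_imag has_real_derivative ln r / (1 + r\<^sup>2)) (at r)"
proof -
  have "1 + r\<^sup>2 \<noteq> 0" by (smt (verit) zero_le_power2)
  thus ?thesis
    unfolding dilog_imag_def[abs_def] using r
    by (auto intro!: derivative_eq_intros has_derivative_arctan_integral simp: inverse_eq_divide)
qed

text \<open>D changes sign under inversion and under conjugation, and the two together take -i r to
  -i / r. In real terms both sides have derivative ln r / (1 + r^2) and agree at 1. Consequently the
  terms of the series for n and -n are equally small.\<close>

lemma dilog_imag_inverse:
  assumes r: "r > 0"
  shows "dilog_imag (1 / r) = dilog_imag r"
proof -
  define h where "h r = dilog_imag (1 / r) - dilog_imag r" for r
  have "(h has_real_derivative 0) (at y within {0<..})" if "y \<in> {0<..}" for y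
  proof -
    have y: "y > 0" using that by simp
    have "((\<lambda>r. dilog_imag (1 / r)) has_real_derivative ln (1 / y) / (1 + (1 / y)\<^sup>2) * (- 1 / y\<^sup>2)) (at y)"
      by (rule DERIV_chain2[OF has_derivative_dilog_imag]) (use y in \<open>auto intro!: derivative_eq_intros simp: power2_eq_square\<close>)
    moreover have "1 + y\<^sup>2 \<noteq> 0" by (smt (verit) zero_le_power2)
    hence "ln (1 / y) / (1 + (1 / y)\<^sup>2) * (- 1 / y\<^sup>2) = ln y / (1 + y\<^sup>2)"
      using y by (simp add: ln_div power_divide field_simps)
    ultimately have "((\<lambda>r. dilog_imag (1 / r)) has_real_derivative ln y / (1 + y\<^sup>2)) (at y)" by simp
    from DERIV_diff[OF this has_derivative_dilog_imag[OF y]]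
    have "(h has_real_derivative 0) (at y)" by (simp add: h_def[abs_def])
    thus ?thesis by (rule has_field_derivative_at_within)
  qed
  from has_field_derivative_zero_constant[OF _ this] obtain c where "h y = c" if "y \<in> {0<..}" for y
    by (auto simp: convex_real_interval)
  hence "h r = h 1" using r by simp
  thus ?thesis by (simp add: h_def)
qed

lemma arctan_quot_le: "0 \<le> arctan_quot v" "arctan_quot v \<le> 1"
proof -
  have *: "arctan v \<le> v" if "v \<ge> 0" for v :: real
  proof -
    have "(\<lambda>v. v - arctan v) 0 \<le> (\<lambda>v. v - arctan v) v"
    proof (rule DERIV_nonneg_imp_nondecreasing[OF that])
      fix y :: real
      have "1 / (1 + y\<^sup>2) \<le> 1" by (simp add: divide_le_eq_1 add_pos_nonneg)
      thus "\<exists>d. ((\<lambda>v. v - arctan v) has_real_derivative d) (at y) \<and> 0 \<le> d"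
        by (intro exI[of _ "1 - 1 / (1 + y\<^sup>2)"]) (auto intro!: derivative_eq_intros simp: inverse_eq_divide)
    qed
    thus ?thesis by simp
  qed
  show "0 \<le> arctan_quot v"
    by (cases v "0::real" rule: linorder_cases) (auto simp: arctan_quot_def zero_le_divide_iff)
  show "arctan_quot v \<le> 1"
    using *[of v] *[of "- v"]
    by (cases v "0::real" rule: linorder_cases) (auto simp: arctan_quot_def arctan_minus divide_le_eq_1)
qed

text \<open>The square root absorbs the logarithm: ln (1 / sqrt r) <= 1 / sqrt r bounds |ln r| r by
  2 sqrt r, and the integral adds at most r <= sqrt r.\<close>

lemma dilog_imag_bound:
  assumes r: "0 < r" "r \<le> 1"
  shows "\<bar>dilog_imag r\<bar> \<le> 3 * sqrt r"
proof -
  have s: "0 < sqrt r" "sqrt r \<le> 1" "sqrt r * sqrt r = r" using r by auto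
  have "arctan_integral r \<le> integral {0..r} (\<lambda>_. 1)"
    unfolding arctan_integral_def
    by (intro integral_le integrable_continuous_interval continuous_on_arctan_quot continuous_intros arctan_quot_le)
  hence 1: "arctan_integral r \<le> r" using r by simp
  have 2: "0 \<le> arctan_integral r"
    unfolding arctan_integral_def
    by (intro integral_nonneg integrable_continuous_interval continuous_on_arctan_quot arctan_quot_le)
  have 3: "0 \<le> arctan r" "arctan r \<le> r"
    using arctan_quot_le(2)[of r] r by (auto simp: arctan_quot_def divide_le_eq)
  have "ln (1 / sqrt r) \<le> 1 / sqrt r" using ln_le_minus_one[of "1 / sqrt r"] s by simp
  hence 4: "- ln r \<le> 2 / sqrt r" using r by (simp add: ln_div ln_sqrt)
  have "(- ln r) * arctan r \<le> 2 / sqrt r * r"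
    using 3 4 r s by (intro mult_mono) auto
  also have "2 / sqrt r * r = 2 * sqrt r" using s by (simp add: field_simps)
  finally have 5: "- (ln r * arctan r) \<le> 2 * sqrt r" by simp
  have 6: "ln r * arctan r \<le> 0" using 3 r by (intro mult_nonpos_nonneg) auto
  have 7: "r \<le> sqrt r" using s mult_right_le_one_le[of "sqrt r" "sqrt r"] by simp
  show ?thesis unfolding dilog_imag_def using 1 2 5 6 7 by linarith
qed

lemma dilog_imag_exp_bound: "\<bar>dilog_imag (exp (- s))\<bar> \<le> 3 * exp (- (\<bar>s\<bar> / 2))"
proof -
  have pos: "\<bar>dilog_imag (exp (- s))\<bar> \<le> 3 * exp (- (s / 2))" if "s \<ge> 0" for s
  proof -
    have "sqrt (exp (- s)) = exp (- (s / 2))"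
      by (rule real_sqrt_unique) (auto simp flip: exp_of_nat_mult exp_double)
    thus ?thesis using dilog_imag_bound[of "exp (- s)"] that by simp
  qed
  show ?thesis
  proof (cases "s \<ge> 0")
    case False
    have "dilog_imag (exp (- s)) = dilog_imag (exp (- (- s)))"
      using dilog_imag_inverse[of "exp s"] by (simp add: exp_minus inverse_eq_divide)
    thus ?thesis using pos[of "- s"] False by simp
  qed (use pos in auto)
qed

section \<open>The dilogarithm series, its derivative and its limit\<close>

definition dilog_series :: "real \<Rightarrow> real" where
  "dilog_series y = (\<Sum>\<^sub>\<infinity>n::int. dilog_imag (exp (- (of_int n * y))))"

lemma dilog_imag_term_bound:
  assumes "y > 0"
  shows "\<bar>dilog_imag (exp (- (of_int n * y)))\<bar> \<le> 3 * exp (- (y / 2 * \<bar>of_int n\<bar>))"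
  using dilog_imag_exp_bound[of "of_int n * y"] assms by (simp add: abs_mult mult.commute)

lemma summable_on_exp_int:
  fixes c :: real
  assumes "c > 0"
  shows "(\<lambda>n::int. exp (- (c * \<bar>of_int n\<bar>))) summable_on A"
  by (rule summable_on_int_rapid(2)[where c = c and C = 1]) (use assms in \<open>auto simp: distrib_right\<close>)

lemma summable_on_dilog_series:
  assumes "y > 0"
  shows "(\<lambda>n::int. dilog_imag (exp (- (of_int n * y)))) summable_on A"
proof (rule summable_on_int_rapid(2)[where c = "y/2" and C = 3])
  fix n :: int
  have "3 * 1 * exp (- (y / 2 * \<bar>real_of_int n\<bar>)) \<le> 3 * (1 + (real_of_int n)\<^sup>2) * exp (- (y / 2 * \<bar>real_of_int n\<bar>))"
    by (intro mult_right_mono mult_left_mono) auto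
  thus "\<bar>dilog_imag (exp (- (of_int n * y)))\<bar> \<le> 3 * (1 + (real_of_int n)\<^sup>2) * exp (- (y / 2 * \<bar>real_of_int n\<bar>))"
    unfolding mult_1_right by (rule order.trans[OF dilog_imag_term_bound[OF assms]])
qed (use assms in auto)

text \<open>With e = exp (-n y) the chain rule gives each term the derivative ln e / (1 + e^2) times
  -n e, which is (y/2) n^2 sech (n y); \<open>second_moment_sech\<close> sums these.\<close>

lemma has_derivative_dilog_series:
  assumes y: "y > 0"
  shows "(dilog_series has_real_derivative y / 2 * (sech_even y * sech_odd y * (sech_even y + sech_odd y))) (at y)"
proof -
  have "((\<lambda>y. \<Sum>\<^sub>\<infinity>n::int. dilog_imag (exp (- (of_int n * y)))) has_real_derivative
     (\<Sum>\<^sub>\<infinity>n::int. y / 2 * ((of_int n)\<^sup>2 * sech (of_int n * y)))) (at y)"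
  \<comment> \<open>The neighbourhood is bounded above as well, since the factor v/2 of the terms
    has to be majorized.\<close>
  proof (rule infsum_has_field_derivative[where S = "{y/2<..<2*y}" and M = "\<lambda>n. 2 * y * ((of_int n)\<^sup>2 * exp (- (y / 2 * \<bar>of_int n\<bar>)))"])
    fix n :: int and v assume v: "v \<in> {y/2<..<2*y}"
    have v0: "v > 0" using v y by auto
    define e where "e = exp (- (of_int n * v))"
    have e: "e > 0" by (simp add: e_def)
    have "((\<lambda>v. dilog_imag (exp (- (of_int n * v)))) has_real_derivative ln e / (1 + e\<^sup>2) * (- (of_int n * e))) (at v)"
      unfolding e_def by (rule DERIV_chain2[OF has_derivative_dilog_imag]) (auto intro!: derivative_eq_intros)
    also have "ln e / (1 + e\<^sup>2) * (- (of_int n * e)) = v / 2 * ((of_int n)\<^sup>2 * sech (of_int n * v))"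
    proof -
      have "sech (of_int n * v) = 2 * e / (1 + e\<^sup>2)"
        unfolding sech_def cosh_exp_minus e_def[symmetric] by simp
      moreover have "ln e = - (of_int n * v)" by (simp add: e_def)
      ultimately show ?thesis by (simp add: power2_eq_square)
    qed
    finally show "((\<lambda>v. dilog_imag (exp (- (of_int n * v)))) has_real_derivative v / 2 * ((of_int n)\<^sup>2 * sech (of_int n * v))) (at v)" .
    have "sech (of_int n * v) \<le> 2 * exp (- (v * \<bar>of_int n\<bar>))" by (rule sech_int_le[OF v0])
    also have "\<dots> \<le> 2 * exp (- (y / 2 * \<bar>of_int n\<bar>))"
    proof -
      have "y / 2 * \<bar>real_of_int n\<bar> \<le> v * \<bar>real_of_int n\<bar>" using v by (intro mult_right_mono) auto
      thus ?thesis by simp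
    qed
    finally have "v / 2 * ((of_int n)\<^sup>2 * sech (of_int n * v)) \<le> y * ((of_int n)\<^sup>2 * (2 * exp (- (y / 2 * \<bar>of_int n\<bar>))))"
      using v v0 y by (intro mult_mono) (auto simp: zero_le_mult_iff less_imp_le)
    thus "norm (v / 2 * ((of_int n)\<^sup>2 * sech (of_int n * v))) \<le> 2 * y * ((of_int n)\<^sup>2 * exp (- (y / 2 * \<bar>of_int n\<bar>)))"
      using v0 by (simp add: abs_mult)
  next
    have "\<bar>2 * y * ((real_of_int n)\<^sup>2 * exp (- (y / 2 * \<bar>of_int n\<bar>)))\<bar> \<le> 2 * y * (1 + (real_of_int n)\<^sup>2) * exp (- (y / 2 * \<bar>of_int n\<bar>))" for n
      using y by (simp add: abs_mult algebra_simps)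
    from summable_on_int_rapid(2)[OF _ this] y
    show "(\<lambda>n. 2 * y * ((real_of_int n)\<^sup>2 * exp (- (y / 2 * \<bar>of_int n\<bar>)))) summable_on UNIV" by auto
  next
    fix v assume "v \<in> {y/2<..<2*y}"
    thus "(\<lambda>n::int. dilog_imag (exp (- (of_int n * v)))) summable_on UNIV"
      using y by (intro summable_on_dilog_series) auto
  qed (use y in auto)
  thus ?thesis
    unfolding infsum_cmult_right' second_moment_sech[OF y] dilog_series_def[abs_def] .
qed

text \<open>Only n = 0 survives: for |n| >= 1 and y >= 1 one has y |n| >= |n| + (y - 1), which
  separates a summable factor from one that tends to 0.\<close>

lemma dilog_series_tendsto: "(dilog_series \<longlongrightarrow> dilog_imag 1) at_top"
proof -
  define C where "C = 3 * (\<Sum>\<^sub>\<infinity>n\<in>- {0::int}. exp (- (1 / 2 * \<bar>real_of_int n\<bar>)))"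
  have bound: "\<bar>dilog_series y - dilog_imag 1\<bar> \<le> C * exp (- ((y - 1) / 2))" if y: "y \<ge> 1" for y
  proof -
    have y0: "y > 0" using y by simp
    let ?f = "\<lambda>n::int. dilog_imag (exp (- (of_int n * y)))"
    have "infsum ?f (insert 0 (- {0})) = ?f 0 + infsum ?f (- {0})"
      by (rule infsum_insert[OF summable_on_dilog_series[OF y0]]) auto
    moreover have "insert 0 (- {0::int}) = UNIV" by auto
    ultimately have "dilog_series y - dilog_imag 1 = infsum ?f (- {0})"
      by (simp add: dilog_series_def)
    moreover have "norm (infsum ?f (- {0})) \<le> C * exp (- ((y - 1) / 2))"
    proof (rule norm_infsum_le)
      show "(?f has_sum infsum ?f (- {0})) (- {0})" by (rule has_sum_infsum[OF summable_on_dilog_series[OF y0]])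
      show "((\<lambda>n. 3 * exp (- (1 / 2 * \<bar>of_int n\<bar>)) * exp (- ((y - 1) / 2))) has_sum C * exp (- ((y - 1) / 2))) (- {0::int})"
        unfolding C_def by (intro has_sum_cmult_left has_sum_cmult_right has_sum_infsum summable_on_exp_int) auto
      fix n :: int assume "n \<in> - {0}"
      hence "n \<noteq> 0" by simp
      hence "1 \<le> \<bar>real_of_int n\<bar>" by linarith
      hence "(y - 1) * 1 \<le> (y - 1) * \<bar>real_of_int n\<bar>" using y by (intro mult_left_mono) auto
      hence "- (y / 2 * \<bar>real_of_int n\<bar>) \<le> - (1 / 2 * \<bar>of_int n\<bar>) + - ((y - 1) / 2)"
        by (simp add: field_simps)
      hence "exp (- (y / 2 * \<bar>real_of_int n\<bar>)) \<le> exp (- (1 / 2 * \<bar>of_int n\<bar>) + - ((y - 1) / 2))"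
        by (simp only: exp_le_cancel_iff)
      also have "\<dots> = exp (- (1 / 2 * \<bar>of_int n\<bar>)) * exp (- ((y - 1) / 2))" by (rule exp_add)
      finally show "norm (?f n) \<le> 3 * exp (- (1 / 2 * \<bar>of_int n\<bar>)) * exp (- ((y - 1) / 2))"
        using dilog_imag_term_bound[OF y0, of n] by simp
    qed
    ultimately show ?thesis by simp
  qed
  have "((\<lambda>y::real. C * exp (- ((y - 1) / 2))) \<longlongrightarrow> 0) at_top" by real_asymp
  hence "((\<lambda>y. dilog_series y - dilog_imag 1) \<longlongrightarrow> 0) at_top"
    by (rule Lim_null_comparison[rotated]) (use bound in \<open>auto intro!: eventually_mono[OF eventually_ge_at_top[of 1]]\<close>)
  thus ?thesis by (simp add: LIM_zero_iff)
qed

section \<open>The Mahler measure at the critical parameter\<close>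

lemma jensen_4: "jensen (4 + 2 * cos (2 * pi * s)) = 2 * arsinh \<bar>cos (pi * s)\<bar>"
proof -
  let ?v = "2 * arsinh \<bar>cos (pi * s)\<bar>"
  have v0: "?v \<ge> 0" using arsinh_real_neg_iff[of "\<bar>cos (pi * s)\<bar>"] by (simp add: not_less[symmetric])
  have "cosh ?v = 1 + 2 * (cos (pi * s))\<^sup>2"
    unfolding cosh_double cosh_square_eq by simp
  also have "\<dots> = (4 + 2 * cos (2 * pi * s)) / 2"
    using cos_double_cos[of "pi * s"] by (simp add: mult.assoc)
  finally have "(4 + 2 * cos (2 * pi * s)) / 2 = cosh ?v" ..
  thus ?thesis unfolding jensen_def using v0 cosh_real_ge_1[of ?v] by (simp add: max_def arcosh_cosh_real)
qed

text \<open>Writing arsinh |c| as the integral of |c| / sqrt (1 + t^2 c^2) over 0 <= t <= 1 and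
  exchanging the integrals leaves an elementary inner integral, arctan t / t up to a factor.\<close>

lemma arctan_integral_1: "mahler 4 = 4 / pi * arctan_integral 1"
proof -
  let ?f = "\<lambda>s t. \<bar>cos (pi * s)\<bar> / sqrt (1 + t\<^sup>2 * (cos (pi * s))\<^sup>2)"
  have nz: "1 + t\<^sup>2 * c\<^sup>2 > 0" for t c :: real by (intro add_pos_nonneg) auto
  have m: "mahler 4 = integral {0..1} (\<lambda>s. 2 * arsinh \<bar>cos (pi * s)\<bar>)"
    using mahler_eq_jensen[of 4] unfolding jensen_4
    by (auto intro!: set_borel_integral_eq_integral(2) borel_integrable_atLeastAtMost' continuous_intros)
  have inner1: "integral {0..1} (?f s) = arsinh \<bar>cos (pi * s)\<bar>" for s
  proof -
    let ?c = "\<bar>cos (pi * s)\<bar>"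
    have "(?f s has_integral arsinh (1 * ?c) - arsinh (0 * ?c)) {0..1}"
    proof (rule fundamental_theorem_of_calculus)
      fix t :: real
      have "((\<lambda>t. arsinh (t * ?c)) has_real_derivative 1 / sqrt ((t * ?c)\<^sup>2 + 1) * ?c) (at t within {0..1})"
        by (rule DERIV_chain2[OF arsinh_real_has_field_derivative]) (auto intro!: derivative_eq_intros)
      thus "((\<lambda>t. arsinh (t * ?c)) has_vector_derivative ?f s t) (at t within {0..1})"
        by (simp add: has_real_derivative_iff_has_vector_derivative power_mult_distrib add.commute)
    qed auto
    thus ?thesis by (simp add: integral_unique)
  qed
  have inner2: "integral {0..1} (\<lambda>s. ?f s t) = 2 / pi * arctan_quot t" if t: "t > 0" for t
  proof -
    \<comment> \<open>With z = sin (pi s) the radicand is 1 + t^2 - t^2 z^2, so the antiderivative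
      is arcsin (t z / sqrt (1 + t^2)) / (pi t), written here with arctan.\<close>
    define W where "W s = arctan (t * sin (pi * s) / sqrt (1 + t\<^sup>2 * (cos (pi * s))\<^sup>2)) / (pi * t)" for s
    have W: "(W has_real_derivative cos (pi * s) / sqrt (1 + t\<^sup>2 * (cos (pi * s))\<^sup>2)) (at s)" for s
    proof -
      define c where "c = cos (pi * s)"
      define \<sigma> where "\<sigma> = sin (pi * s)"
      define Q where "Q = sqrt (1 + t\<^sup>2 * c\<^sup>2)"
      have Q: "Q > 0" "Q\<^sup>2 = 1 + t\<^sup>2 * c\<^sup>2" using nz[of t c] by (auto simp: Q_def less_imp_le)
      have sc: "\<sigma>\<^sup>2 = 1 - c\<^sup>2" by (simp add: c_def \<sigma>_def sin_squared_eq)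
      have dQ: "((\<lambda>s. sqrt (1 + t\<^sup>2 * (cos (pi * s))\<^sup>2)) has_real_derivative - (t\<^sup>2 * c * \<sigma> * pi / Q)) (at s)"
        unfolding c_def \<sigma>_def Q_def using nz[of t "cos (pi * s)"]
        by (auto intro!: derivative_eq_intros simp: field_simps)
      have "((\<lambda>s. t * sin (pi * s) / sqrt (1 + t\<^sup>2 * (cos (pi * s))\<^sup>2)) has_real_derivative
         ((t * (c * pi)) * Q - (t * \<sigma>) * (- (t\<^sup>2 * c * \<sigma> * pi / Q))) / (Q * Q)) (at s)"
        using Q(1) unfolding Q_def c_def \<sigma>_def
        by (intro DERIV_divide dQ[unfolded Q_def c_def \<sigma>_def]) (auto intro!: derivative_eq_intros)
      hence "(W has_real_derivative inverse (1 + (t * \<sigma> / Q)\<^sup>2) *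
         (((t * (c * pi)) * Q - (t * \<sigma>) * (- (t\<^sup>2 * c * \<sigma> * pi / Q))) / (Q * Q)) / (pi * t)) (at s)"
        unfolding W_def[abs_def] Q_def c_def \<sigma>_def
        by (intro DERIV_cdivide DERIV_chain2[OF DERIV_arctan])
      also have "inverse (1 + (t * \<sigma> / Q)\<^sup>2) *
         (((t * (c * pi)) * Q - (t * \<sigma>) * (- (t\<^sup>2 * c * \<sigma> * pi / Q))) / (Q * Q)) / (pi * t) = c / Q"
      proof -
        have 1: "1 + (t * \<sigma> / Q)\<^sup>2 = (1 + t\<^sup>2) / Q\<^sup>2"
        proof -
          have "1 + (t * \<sigma> / Q)\<^sup>2 = (Q\<^sup>2 + t\<^sup>2 * \<sigma>\<^sup>2) / Q\<^sup>2"
            using Q(1) by (simp add: power_divide power_mult_distrib field_simps)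
          also have "Q\<^sup>2 + t\<^sup>2 * \<sigma>\<^sup>2 = 1 + t\<^sup>2" unfolding Q(2) sc by (simp add: algebra_simps)
          finally show ?thesis .
        qed
        have 2: "(t * (c * pi)) * Q - (t * \<sigma>) * (- (t\<^sup>2 * c * \<sigma> * pi / Q)) = t * c * pi * (1 + t\<^sup>2) / Q"
        proof -
          have "(t * (c * pi)) * Q - (t * \<sigma>) * (- (t\<^sup>2 * c * \<sigma> * pi / Q)) = t * c * pi * (Q\<^sup>2 + t\<^sup>2 * \<sigma>\<^sup>2) / Q"
            using Q(1) by (simp add: power2_eq_square field_simps)
          also have "Q\<^sup>2 + t\<^sup>2 * \<sigma>\<^sup>2 = 1 + t\<^sup>2" unfolding Q(2) sc by (simp add: algebra_simps)
          finally show ?thesis .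
        qed
        have "1 + t\<^sup>2 \<noteq> 0" using nz[of t 1] by simp
        thus ?thesis unfolding 1 2 using Q(1) t by (simp add: power2_eq_square)
      qed
      finally show ?thesis unfolding c_def Q_def .
    qed
    have W': "((\<lambda>s. cos (pi * s) / sqrt (1 + t\<^sup>2 * (cos (pi * s))\<^sup>2)) has_integral W b - W a) {a..b}" if "a \<le> b" for a b
      by (rule fundamental_theorem_of_calculus[OF that])
         (use W in \<open>auto simp: has_real_derivative_iff_has_vector_derivative intro: has_vector_derivative_at_within\<close>)
    have 1: "((\<lambda>s. ?f s t) has_integral W (1/2) - W 0) {0..1/2}"
    proof (rule has_integral_eq[OF _ W'])
      fix s :: real assume s: "s \<in> {0..1/2}"
      hence "pi * s \<le> pi * (1/2)" by (intro mult_left_mono) auto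
      hence "cos (pi * s) \<ge> 0" using s by (intro cos_ge_zero) (auto intro: order_trans[of _ 0])
      thus "cos (pi * s) / sqrt (1 + t\<^sup>2 * (cos (pi * s))\<^sup>2) = ?f s t" by simp
    qed auto
    have 2: "((\<lambda>s. ?f s t) has_integral - (W 1 - W (1/2))) {1/2..1}"
    proof (rule has_integral_eq[OF _ has_integral_neg[OF W']])
      fix s :: real assume s: "s \<in> {1/2..1}"
      have b: "pi * (1/2) \<le> pi * s" "pi * s \<le> pi * 1" using s by (auto intro!: mult_left_mono)
      have "cos (pi - pi * s) \<ge> 0"
      proof (rule cos_ge_zero)
        show "- (pi / 2) \<le> pi - pi * s" using b(2) pi_gt_zero by linarith
        show "pi - pi * s \<le> pi / 2" using b(1) by linarith
      qed
      hence "cos (pi * s) \<le> 0" by (simp add: cos_diff)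
      thus "- (cos (pi * s) / sqrt (1 + t\<^sup>2 * (cos (pi * s))\<^sup>2)) = ?f s t" by simp
    qed auto
    have "((\<lambda>s. ?f s t) has_integral (W (1/2) - W 0) + - (W 1 - W (1/2))) {0..1}"
      by (rule has_integral_combine[OF _ _ 1 2]) auto
    moreover have "W (1/2) = arctan t / (pi * t)" "W 0 = 0" "W 1 = 0" by (simp_all add: W_def)
    ultimately show ?thesis using t by (simp add: integral_unique arctan_quot_def)
  qed
  have "mahler 4 = 2 * integral {0..1} (\<lambda>s. integral {0..1} (?f s))"
    unfolding m inner1 by simp
  also have "integral {0..1} (\<lambda>s. integral {0..1} (?f s)) = integral {0..1} (\<lambda>t. integral {0..1} (\<lambda>s. ?f s t))"
  proof -
    have "continuous_on (cbox (0, 0) (1, 1)) (\<lambda>(s, t). ?f s t)"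
      unfolding split_beta using nz by (intro continuous_intros) (auto simp: less_imp_neq[symmetric])
    from integral_swap_continuous[OF this] show ?thesis by simp
  qed
  also have "\<dots> = integral {0..1} (\<lambda>t. 2 / pi * arctan_quot t)"
    by (rule integral_spike[of "{0}"]) (auto simp: inner2)
  also have "\<dots> = 2 / pi * arctan_integral 1" by (simp add: arctan_integral_def)
  finally show ?thesis by simp
qed

lemma mahler_4: "mahler 4 = - (4 / pi) * dilog_imag 1"
  by (simp add: arctan_integral_1 dilog_imag_def)

section \<open>The cosecant series\<close>

lemma summable_on_int_powr:
  assumes "p > 1"
  shows "(\<lambda>n::int. (1 + \<bar>of_int n\<bar>) powr (- p) :: real) summable_on UNIV"
proof -
  have "summable (\<lambda>n. real (Suc n) powr (- p))"
    using assms by (subst summable_Suc_iff) (simp add: summable_real_powr_iff)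
  from summable_on_int_abs[OF this] show ?thesis by (simp add: add.commute)
qed

lemma inverse_power_mono:
  fixes a b :: real
  assumes "0 < a" "a \<le> b"
  shows "1 / b ^ k \<le> 1 / a ^ k"
  using assms by (intro frac_le power_mono) auto

text \<open>The finitely many n with |n| <= K are controlled by the positive distance of w from the
  integers, the others by the triangle inequality; \<kappa> is the smaller of the two
  constants.\<close>

lemma int_dist_lower_bound:
  fixes w :: complex
  assumes "w \<notin> \<int>"
  obtains \<kappa> where "\<kappa> > 0" "\<And>n. \<kappa> * (1 + \<bar>of_int n\<bar>) \<le> cmod (w + of_int n)"
proof -
  have "open (- (\<int> :: complex set))" by (simp add: open_Compl)
  then obtain \<delta> where \<delta>: "\<delta> > 0" "ball w \<delta> \<subseteq> - \<int>"
    using assms openE by (metis ComplI)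
  have d: "\<delta> \<le> cmod (w + of_int n)" for n
  proof (rule ccontr)
    assume "\<not> \<delta> \<le> cmod (w + of_int n)"
    hence "of_int (- n) \<in> ball w \<delta>" by (simp add: dist_norm)
    thus False using \<delta>(2) by auto
  qed
  define K where "K = 2 * (cmod w + 1)"
  have K: "K > 0" by (simp add: K_def add_nonneg_pos)
  define \<kappa> where "\<kappa> = min (\<delta> / (1 + K)) (1 / 4)"
  show thesis
  proof
    show "\<kappa> > 0" using \<delta> K by (simp add: \<kappa>_def)
    fix n :: int
    show "\<kappa> * (1 + \<bar>of_int n\<bar>) \<le> cmod (w + of_int n)"
    proof (cases "\<bar>of_int n\<bar> \<le> K")
      case True
      have "\<kappa> * (1 + \<bar>of_int n\<bar>) \<le> \<delta> / (1 + K) * (1 + K)"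
        using True \<delta> K by (intro mult_mono) (auto simp: \<kappa>_def)
      also have "\<dots> = \<delta>" using K by simp
      finally show ?thesis using d[of n] by simp
    next
      case False
      define N where "N = \<bar>real_of_int n\<bar>"
      have "cmod (of_int n) - cmod w \<le> cmod (w + of_int n)"
        using norm_triangle_ineq2[of "of_int n" "- w"] by (simp add: add.commute)
      hence 1: "N - cmod w \<le> cmod (w + of_int n)" by (simp add: N_def)
      have "\<kappa> \<le> 1 / 4" unfolding \<kappa>_def by (rule min.cobounded2)
      hence 2: "\<kappa> * (1 + N) \<le> 1 / 4 * (1 + N)" by (intro mult_right_mono) (auto simp: N_def)
      have 3: "2 * cmod w + 2 < N" using False by (simp add: N_def K_def algebra_simps)
      have "1 + 4 * cmod w \<le> 3 * N" using 3 norm_ge_zero[of w] by linarith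
      hence "1 / 4 * (1 + N) \<le> N - cmod w" by (simp add: field_simps)
      with 1 2 show ?thesis unfolding N_def[symmetric] by linarith
    qed
  qed
qed

lemma summable_on_inverse_square_int:
  fixes w :: complex
  assumes "w \<notin> \<int>"
  shows "(\<lambda>n::int. norm (1 / (w + of_int n)\<^sup>2)) summable_on UNIV"
proof -
  obtain \<kappa> where \<kappa>: "\<kappa> > 0" "\<And>n. \<kappa> * (1 + \<bar>of_int n\<bar>) \<le> cmod (w + of_int n)"
    using int_dist_lower_bound[OF assms] by metis
  have "(\<lambda>n::int. 1 / \<kappa>\<^sup>2 * (1 + \<bar>of_int n\<bar>) powr (- 2)) summable_on UNIV"
    by (intro summable_on_cmult_right summable_on_int_powr) auto
  thus ?thesis
  proof (rule summable_on_comparison_test)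
    fix n :: int
    have pos: "0 < \<kappa> * (1 + \<bar>real_of_int n\<bar>)" using \<kappa> by (intro mult_pos_pos) auto
    have "norm (1 / (w + of_int n)\<^sup>2) = 1 / (cmod (w + of_int n))\<^sup>2"
      by (simp add: norm_divide norm_power)
    also have "\<dots> \<le> 1 / (\<kappa> * (1 + \<bar>of_int n\<bar>))\<^sup>2"
      by (rule inverse_power_mono[OF pos \<kappa>(2)])
    also have "\<dots> = 1 / \<kappa>\<^sup>2 * (1 + \<bar>of_int n\<bar>) powr (- 2)"
      by (simp add: powr_minus powr_numeral power_mult_distrib divide_inverse)
    finally show "norm (1 / (w + of_int n)\<^sup>2) \<le> 1 / \<kappa>\<^sup>2 * (1 + \<bar>of_int n\<bar>) powr (- 2)" .
  qed auto
qed

lemma sin_pi_times_nonzero: "w \<notin> \<int> \<Longrightarrow> sin (of_real pi * w) \<noteq> (0::complex)"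
  by (auto simp: sin_eq_0 mult.commute)

text \<open>Logarithmic derivative of Gamma z Gamma (1 - z) sin (pi z) = pi, which is constant off
  the integers.\<close>

lemma Digamma_reflection:
  fixes w :: complex
  assumes w: "w \<notin> \<int>"
  shows "(Digamma w - Digamma (1 - w)) * sin (of_real pi * w) = - of_real pi * cos (of_real pi * w)"
proof -
  have nonpos: "w \<notin> \<int>\<^sub>\<le>\<^sub>0" "1 - w \<notin> \<int>\<^sub>\<le>\<^sub>0"
    using w by (auto elim!: nonpos_Ints_cases) (metis Ints_1 Ints_diff Ints_of_int diff_diff_eq2 add_diff_cancel_left')
  let ?f = "\<lambda>z. Gamma z * Gamma (1 - z) * sin (of_real pi * z)"
  have "(?f has_field_derivative Gamma w * Gamma (1 - w) *
      ((Digamma w - Digamma (1 - w)) * sin (of_real pi * w) + of_real pi * cos (of_real pi * w))) (at w)"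
    using nonpos by (auto intro!: derivative_eq_intros simp: algebra_simps)
  moreover have "(?f has_field_derivative 0) (at w)"
  proof (rule has_field_derivative_transform_within_open[where f = "\<lambda>_. of_real pi" and S = "- \<int>"])
    show "open (- (\<int>::complex set))" by (simp add: open_Compl)
    fix z :: complex assume "z \<in> - \<int>"
    thus "of_real pi = ?f z" using sin_pi_times_nonzero[of z] by (simp add: Gamma_reflection_complex)
  qed (use w in auto)
  ultimately have "Gamma w * Gamma (1 - w) *
      ((Digamma w - Digamma (1 - w)) * sin (of_real pi * w) + of_real pi * cos (of_real pi * w)) = 0"
    by (rule DERIV_unique)
  thus ?thesis using nonpos by (simp add: Gamma_eq_zero_iff eq_neg_iff_add_eq_0)
qed

lemma Polygamma_1_reflection:
  fixes w :: complex
  assumes w: "w \<notin> \<int>"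
  shows "Polygamma 1 w + Polygamma 1 (1 - w) = (of_real pi / sin (of_real pi * w))\<^sup>2"
proof -
  have nonpos: "w \<notin> \<int>\<^sub>\<le>\<^sub>0" "1 - w \<notin> \<int>\<^sub>\<le>\<^sub>0"
    using w by (auto elim!: nonpos_Ints_cases) (metis Ints_1 Ints_diff Ints_of_int diff_diff_eq2 add_diff_cancel_left')
  note s = sin_pi_times_nonzero[OF w]
  have "((\<lambda>z. Digamma z - Digamma (1 - z)) has_field_derivative Polygamma 1 w + Polygamma 1 (1 - w)) (at w)"
    using nonpos by (auto intro!: derivative_eq_intros)
  moreover have "((\<lambda>z. Digamma z - Digamma (1 - z)) has_field_derivative (of_real pi / sin (of_real pi * w))\<^sup>2) (at w)"
  proof (rule has_field_derivative_transform_within_open[where f = "\<lambda>z. - of_real pi * cos (of_real pi * z) / sin (of_real pi * z)" and S = "- \<int>"])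
    have alg: "(P * s * P) * s - (- P * c) * (c * P) = P\<^sup>2 * (s\<^sup>2 + c\<^sup>2)" for P s c :: complex
      by (simp add: power2_eq_square algebra_simps)
    let ?P = "complex_of_real pi" and ?s = "sin (of_real pi * w)" and ?c = "cos (of_real pi * w)"
    have "((\<lambda>z. - of_real pi * cos (of_real pi * z) / sin (of_real pi * z)) has_field_derivative
        ((?P * ?s * ?P) * ?s - (- ?P * ?c) * (?c * ?P)) / (?s * ?s)) (at w)"
      using s by (intro DERIV_divide) (auto intro!: derivative_eq_intros)
    also have "((?P * ?s * ?P) * ?s - (- ?P * ?c) * (?c * ?P)) = ?P\<^sup>2 * (?s\<^sup>2 + ?c\<^sup>2)"
      by (rule alg)
    also have "?P\<^sup>2 * (?s\<^sup>2 + ?c\<^sup>2) / (?s * ?s) = (?P / ?s)\<^sup>2"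
      by (simp add: power_divide power2_eq_square[of ?s, symmetric])
    finally show "((\<lambda>z. - of_real pi * cos (of_real pi * z) / sin (of_real pi * z)) has_field_derivative (?P / ?s)\<^sup>2) (at w)" .
    show "open (- (\<int>::complex set))" by (simp add: open_Compl)
    fix z :: complex assume "z \<in> - \<int>"
    thus "- of_real pi * cos (of_real pi * z) / sin (of_real pi * z) = Digamma z - Digamma (1 - z)"
      using sin_pi_times_nonzero[of z] Digamma_reflection[of z] by (simp add: field_simps)
  qed (use w in auto)
  ultimately show ?thesis by (rule DERIV_unique)
qed

text \<open>The trigamma series at w covers n >= 0 and the one at 1 - w covers n < 0, the square
  hiding the sign; the reflection formula adds the two.\<close>

lemma has_sum_inverse_square_int:
  fixes w :: complex
  assumes w: "w \<notin> \<int>"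
  shows "((\<lambda>n::int. 1 / (w + of_int n)\<^sup>2) has_sum (of_real pi / sin (of_real pi * w))\<^sup>2) UNIV"
proof -
  let ?f = "\<lambda>n::int. 1 / (w + of_int n)\<^sup>2"
  have w0: "w \<noteq> 0" "1 - w \<noteq> 0" using w by auto
  have s: "?f summable_on A" for A
    by (rule summable_on_subset_banach[OF abs_summable_summable[OF summable_on_inverse_square_int[OF w]]]) auto
  have "?f summable_on range int" "?f summable_on range (\<lambda>k. - int k - 1)" by (rule s)+
  have 1: "infsum ?f (range int) = Polygamma 1 w"
  proof -
    have "(\<lambda>k. inverse ((w + of_nat k) ^ Suc 1)) sums ((-1) ^ Suc 1 * Polygamma 1 w / fact 1)"
      by (rule Polygamma_LIMSEQ) (use w0 in auto)
    hence "(\<lambda>k. ?f (int k)) sums Polygamma 1 w" by (simp add: power2_eq_square inverse_eq_divide)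
    moreover have "(\<lambda>k. ?f (int k)) sums infsum (\<lambda>k. ?f (int k)) UNIV"
      using s[of "range int"] by (intro has_sum_imp_sums has_sum_infsum)
        (subst (asm) summable_on_reindex, auto simp: o_def)
    ultimately have "infsum (\<lambda>k. ?f (int k)) UNIV = Polygamma 1 w" by (rule sums_unique2[symmetric])
    thus ?thesis by (subst infsum_reindex) (auto simp: o_def)
  qed
  have 2: "infsum ?f (range (\<lambda>k. - int k - 1)) = Polygamma 1 (1 - w)"
  proof -
    have inj: "inj (\<lambda>k. - int k - 1)" by (auto simp: inj_on_def)
    have sq: "((1 - w) + of_nat k)\<^sup>2 = (w + of_int (- int k - 1))\<^sup>2" for k
      by (simp add: power2_eq_square algebra_simps)
    have "(\<lambda>k. inverse (((1 - w) + of_nat k) ^ Suc 1)) sums ((-1) ^ Suc 1 * Polygamma 1 (1 - w) / fact 1)"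
      by (rule Polygamma_LIMSEQ) (use w0 in auto)
    hence "(\<lambda>k. ?f (- int k - 1)) sums Polygamma 1 (1 - w)"
      unfolding Suc_1 sq by (simp add: inverse_eq_divide)
    moreover have "(\<lambda>k. ?f (- int k - 1)) sums infsum (\<lambda>k. ?f (- int k - 1)) UNIV"
      using s[of "range (\<lambda>k. - int k - 1)"] inj by (intro has_sum_imp_sums has_sum_infsum)
        (subst (asm) summable_on_reindex, auto simp: o_def)
    ultimately have "infsum (\<lambda>k. ?f (- int k - 1)) UNIV = Polygamma 1 (1 - w)" by (rule sums_unique2[symmetric])
    thus ?thesis using inj by (subst infsum_reindex) (auto simp: o_def)
  qed
  have U: "range int \<union> range (\<lambda>k. - int k - 1) = UNIV"
  proof (intro equalityI subsetI)
    fix n :: int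
    show "n \<in> range int \<union> range (\<lambda>k. - int k - 1)"
    proof (cases "n \<ge> 0")
      case True thus ?thesis using zero_le_imp_eq_int by blast
    next
      case False
      hence "n = - int (nat (-n-1)) - 1" by auto
      thus ?thesis by blast
    qed
  qed auto
  have "infsum ?f (range int \<union> range (\<lambda>k. - int k - 1)) = Polygamma 1 w + Polygamma 1 (1 - w)"
    unfolding 1[symmetric] 2[symmetric] by (rule infsum_Un_disjoint[OF s s]) auto
  hence "infsum ?f UNIV = (of_real pi / sin (of_real pi * w))\<^sup>2"
    unfolding U Polygamma_1_reflection[OF w] .
  thus ?thesis using s by (metis has_sum_infsum)
qed

section \<open>Rectangular lattices\<close>

locale rectangular_lattice =
  fixes \<omega> \<eta> :: real
  assumes \<omega>_pos: "\<omega> > 0" and \<eta>_pos: "\<eta> > 0"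
begin

definition latt :: "int \<times> int \<Rightarrow> complex" where
  "latt p = of_int (fst p) * of_real \<omega> + of_int (snd p) * (\<i> * of_real \<eta>)"

abbreviation L :: "complex set" where "L \<equiv> period_lattice (of_real \<omega>) (\<i> * of_real \<eta>)"

lemma L_eq: "L = range latt"
  by (auto simp: period_lattice_def latt_def image_def)

lemma Re_latt [simp]: "Re (latt p) = of_int (fst p) * \<omega>"
  and Im_latt [simp]: "Im (latt p) = of_int (snd p) * \<eta>"
  by (simp_all add: latt_def)

lemma inj_latt: "inj latt"
  using \<omega>_pos \<eta>_pos by (auto simp: inj_def complex_eq_iff prod_eq_iff)

lemma bij_latt: "bij_betw latt UNIV L"
  using inj_latt by (simp add: bij_betw_def L_eq)

lemma latt_0: "latt (0, 0) = 0" by (simp add: latt_def)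

lemma L_0 [simp]: "0 \<in> L" unfolding L_eq using latt_0 by (metis rangeI)

lemma L_add: "u \<in> L \<Longrightarrow> v \<in> L \<Longrightarrow> u + v \<in> L"
proof -
  assume "u \<in> L" "v \<in> L"
  then obtain p q where "u = latt p" "v = latt q" unfolding L_eq by blast
  hence "u + v = latt (fst p + fst q, snd p + snd q)" by (simp add: latt_def algebra_simps)
  thus ?thesis by (auto simp: L_eq)
qed

lemma L_uminus: "- u \<in> L \<longleftrightarrow> u \<in> L"
proof -
  have *: "- u \<in> L" if "u \<in> L" for u
  proof -
    obtain p where "u = latt p" using \<open>u \<in> L\<close> unfolding L_eq by blast
    hence "- u = latt (- fst p, - snd p)" by (simp add: latt_def)
    thus ?thesis by (auto simp: L_eq)
  qed
  show ?thesis using *[of u] *[of "- u"] by auto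
qed

lemma L_diff: "u \<in> L \<Longrightarrow> v \<in> L \<Longrightarrow> u - v \<in> L"
  using L_add[of u "- v"] by (simp add: L_uminus)

lemma L_add_iff: "v \<in> L \<Longrightarrow> u + v \<in> L \<longleftrightarrow> u \<in> L"
  using L_add[of u v] L_diff[of "u + v" v] by auto

lemma countable_L: "countable L" unfolding L_eq by simp

lemma infinite_L: "infinite L"
  unfolding L_eq using inj_latt finite_imageD[of latt UNIV]
  by (metis finite_prod infinite_UNIV_int UNIV_Times_UNIV finite_cartesian_productD1 empty_not_UNIV)

definition gap :: real where "gap = min \<omega> \<eta>"

lemma gap_pos: "gap > 0" using \<omega>_pos \<eta>_pos by (simp add: gap_def)

lemma gap_le: assumes "v \<in> L" "v \<noteq> 0" shows "gap \<le> cmod v"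
proof -
  obtain p where p: "v = latt p" using assms unfolding L_eq by blast
  have "fst p \<noteq> 0 \<or> snd p \<noteq> 0" using assms p latt_0 by (metis prod.collapse)
  thus ?thesis
  proof
    assume "fst p \<noteq> 0"
    hence "1 \<le> \<bar>real_of_int (fst p)\<bar>" by linarith
    hence "\<omega> * 1 \<le> \<omega> * \<bar>real_of_int (fst p)\<bar>" using \<omega>_pos by (intro mult_left_mono) auto
    also have "\<dots> = \<bar>Re v\<bar>" using \<omega>_pos by (simp add: p abs_mult)
    also have "\<dots> \<le> cmod v" by (rule abs_Re_le_cmod)
    finally show ?thesis by (simp add: gap_def)
  next
    assume "snd p \<noteq> 0"
    hence "1 \<le> \<bar>real_of_int (snd p)\<bar>" by linarith
    hence "\<eta> * 1 \<le> \<eta> * \<bar>real_of_int (snd p)\<bar>" using \<eta>_pos by (intro mult_left_mono) auto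
    also have "\<dots> = \<bar>Im v\<bar>" using \<eta>_pos by (simp add: p abs_mult)
    also have "\<dots> \<le> cmod v" by (rule abs_Im_le_cmod)
    finally show ?thesis by (simp add: gap_def)
  qed
qed

lemma closed_subset_L:
  assumes "S \<subseteq> L"
  shows "closed S"
proof (rule discrete_imp_closed[OF gap_pos], intro ballI impI, rule ccontr)
  fix x y assume xy: "x \<in> S" "y \<in> S" "dist y x < gap" "y \<noteq> x"
  hence "gap \<le> cmod (y - x)" using assms by (intro gap_le L_diff) auto
  thus False using xy(3) by (simp add: dist_norm)
qed

lemma open_Compl_L: "open (- L)"
  using closed_subset_L[of L] by (simp add: open_Compl)

lemma connected_Compl_L: "countable A \<Longrightarrow> connected (- A :: complex set)"
  by (intro path_connected_imp_connected path_connected_complement_countable) auto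

lemma ball_gap: "u \<in> ball 0 gap \<Longrightarrow> u \<in> L \<longleftrightarrow> u = 0"
  using gap_le[of u] by auto

text \<open>For (m, n) other than (0, 0), (1 + |m|) (1 + |n|) <= 3 (m^2 + n^2). Raised to the power
  3/2, this bounds 1 / |v|^3 by a product of two convergent series in one variable.\<close>

lemma summable_on_inverse_cube: "(\<lambda>v. 1 / cmod v ^ 3) summable_on (L - {0})"
proof -
  let ?p = "\<lambda>n::int. (1 + \<bar>real_of_int n\<bar>) powr (- (3/2))"
  have p: "(\<lambda>n. norm (?p n)) summable_on UNIV" using summable_on_int_powr[of "3/2"] by simp
  define C where "C = 3 powr (3/2) / gap ^ 3"
  have "(\<lambda>x. C * (case x of (m, n) \<Rightarrow> ?p m * ?p n)) summable_on UNIV \<times> UNIV"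
    by (intro summable_on_cmult_right infsum_mult_infsum(2) p)
  hence s: "(\<lambda>x. C * (case x of (m, n) \<Rightarrow> ?p m * ?p n)) summable_on (UNIV - {(0, 0)})"
    by (rule summable_on_subset) auto
  have "(\<lambda>p. 1 / cmod (latt p) ^ 3) summable_on (UNIV - {(0, 0)})"
  proof (rule summable_on_comparison_test[OF s])
    fix q :: "int \<times> int" assume q: "q \<in> UNIV - {(0, 0)}"
    obtain m n where mn: "q = (m, n)" by (cases q)
    define M where "M = \<bar>real_of_int m\<bar>"
    define N where "N = \<bar>real_of_int n\<bar>"
    have MN: "M \<ge> 0" "N \<ge> 0" "M \<le> M\<^sup>2" "N \<le> N\<^sup>2" "1 \<le> M\<^sup>2 + N\<^sup>2"
    proof -
      have "x \<le> x\<^sup>2" if "x = \<bar>real_of_int k\<bar>" for x k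
      proof (cases "k = 0")
        case False
        hence "1 \<le> x" using that by simp
        thus ?thesis using mult_right_mono[of 1 x x] by (simp add: power2_eq_square)
      qed (use that in auto)
      thus "M \<le> M\<^sup>2" "N \<le> N\<^sup>2" by (auto simp: M_def N_def)
      have "m \<noteq> 0 \<or> n \<noteq> 0" using q mn by auto
      hence "1 \<le> M \<or> 1 \<le> N" unfolding M_def N_def by linarith
      thus "1 \<le> M\<^sup>2 + N\<^sup>2" using \<open>M \<le> M\<^sup>2\<close> \<open>N \<le> N\<^sup>2\<close> zero_le_power2[of M] zero_le_power2[of N] by linarith
    qed (auto simp: M_def N_def)
    have "0 \<le> (M - N)\<^sup>2" by simp
    hence "2 * (M * N) \<le> M\<^sup>2 + N\<^sup>2" by (simp add: power2_diff)
    hence key: "(1 + M) * (1 + N) \<le> 3 * (M\<^sup>2 + N\<^sup>2)" using MN by (simp add: algebra_simps)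
    have "gap\<^sup>2 * (M\<^sup>2 + N\<^sup>2) \<le> (cmod (latt q))\<^sup>2"
    proof -
      have "gap\<^sup>2 * M\<^sup>2 \<le> \<omega>\<^sup>2 * M\<^sup>2" "gap\<^sup>2 * N\<^sup>2 \<le> \<eta>\<^sup>2 * N\<^sup>2"
        using gap_pos by (auto intro!: mult_right_mono power_mono simp: gap_def)
      thus ?thesis unfolding cmod_power2 by (simp add: mn M_def N_def power_mult_distrib algebra_simps)
    qed
    moreover have "gap\<^sup>2 * ((1 + M) * (1 + N)) \<le> gap\<^sup>2 * (3 * (M\<^sup>2 + N\<^sup>2))"
      using key by (intro mult_left_mono) auto
    moreover have "gap\<^sup>2 * (3 * (M\<^sup>2 + N\<^sup>2)) = 3 * (gap\<^sup>2 * (M\<^sup>2 + N\<^sup>2))" by (rule mult.left_commute)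
    ultimately have "gap\<^sup>2 * ((1 + M) * (1 + N)) / 3 \<le> (cmod (latt q))\<^sup>2" by linarith
    hence "(gap\<^sup>2 * ((1 + M) * (1 + N)) / 3) powr (3/2) \<le> ((cmod (latt q))\<^sup>2) powr (3/2)"
      using MN gap_pos by (intro powr_mono2) auto
    also have "((cmod (latt q))\<^sup>2) powr (3/2) = cmod (latt q) ^ 3"
    proof -
      have "latt q \<noteq> 0" using q inj_latt latt_0 by (metis Diff_iff injD insertI1)
      hence "((cmod (latt q))\<^sup>2) powr (3/2) = cmod (latt q) powr (2 * (3/2))"
        by (subst powr_powr[symmetric]) (simp_all add: powr_numeral)
      thus ?thesis using \<open>latt q \<noteq> 0\<close> by (simp add: powr_numeral)
    qed
    also have "(gap\<^sup>2 * ((1 + M) * (1 + N)) / 3) powr (3/2) = gap ^ 3 * ((1 + M) powr (3/2) * (1 + N) powr (3/2)) / 3 powr (3/2)"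
    proof -
      have "(gap\<^sup>2) powr (3/2) = gap powr (2 * (3/2))"
        using gap_pos by (subst powr_powr[symmetric]) (simp_all add: powr_numeral)
      hence "(gap\<^sup>2) powr (3/2) = gap ^ 3" using gap_pos by (simp add: powr_numeral)
      thus ?thesis using MN by (simp add: powr_divide powr_mult)
    qed
    finally have "1 / cmod (latt q) ^ 3 \<le> 1 / (gap ^ 3 * ((1 + M) powr (3/2) * (1 + N) powr (3/2)) / 3 powr (3/2))"
      using gap_pos MN by (intro frac_le) (auto intro!: mult_pos_pos divide_pos_pos zero_less_power)
    also have "\<dots> = C * (case q of (m, n) \<Rightarrow> ?p m * ?p n)"
      unfolding C_def mn by (simp add: M_def[symmetric] N_def[symmetric] powr_minus field_simps)
    finally show "1 / cmod (latt q) ^ 3 \<le> C * (case q of (m, n) \<Rightarrow> ?p m * ?p n)" .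
  qed auto
  moreover have "bij_betw latt (UNIV - {(0, 0)}) (L - {0})"
    using bij_betw_DiffI[OF bij_latt, of "{(0,0)}" "{0}"] latt_0 by (auto simp: bij_betw_def)
  ultimately show ?thesis
    using summable_on_reindex_bij_betw[of latt "UNIV - {(0,0)}" "L - {0}" "\<lambda>v. 1 / cmod v ^ 3"] by simp
qed

text \<open>A bound uniform near u is needed to differentiate termwise. Removing 0 from the lattice
  admits u = 0, where \<open>wp_regular\<close> is to be expanded.\<close>

lemma lattice_dist_lower_bound:
  assumes u: "u \<notin> L - {0}"
  obtains \<delta> \<kappa> where "\<delta> > 0" "\<kappa> > 0" "\<And>y v. y \<in> ball u \<delta> \<Longrightarrow> v \<in> L - {0} \<Longrightarrow> \<kappa> * cmod v \<le> cmod (y - v)"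
proof -
  have "open (- (L - {0}))" by (intro open_Compl closed_subset_L) auto
  then obtain \<epsilon> where \<epsilon>: "\<epsilon> > 0" "ball u \<epsilon> \<subseteq> - (L - {0})"
    using u openE by (metis ComplI)
  define \<delta> where "\<delta> = \<epsilon> / 2"
  define K where "K = 2 * (cmod u + \<delta>)"
  have \<delta>: "\<delta> > 0" using \<epsilon> by (simp add: \<delta>_def)
  have K: "K > 0" using \<delta> by (simp add: K_def add_nonneg_pos)
  define \<kappa> where "\<kappa> = min (\<delta> / K) (1/2)"
  show thesis
  proof
    show "\<delta> > 0" "\<kappa> > 0" using \<delta> K by (auto simp: \<kappa>_def)
    fix y v assume y: "y \<in> ball u \<delta>" and v: "v \<in> L - {0}"
    have yu: "cmod (u - y) < \<delta>" using y by (simp add: dist_norm)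
    show "\<kappa> * cmod v \<le> cmod (y - v)"
    proof (cases "cmod v \<le> K")
      case True
      have "v \<notin> ball u \<epsilon>" using \<epsilon> v by auto
      hence "\<epsilon> \<le> cmod (u - v)" by (simp add: dist_norm)
      also have "\<dots> \<le> cmod (u - y) + cmod (y - v)" using norm_triangle_ineq[of "u - y" "y - v"] by simp
      finally have "\<delta> \<le> cmod (y - v)" using yu by (simp add: \<delta>_def)
      moreover have "\<kappa> * cmod v \<le> \<delta> / K * K" using True \<delta> K by (intro mult_mono) (auto simp: \<kappa>_def)
      ultimately show ?thesis using K by simp
    next
      case False
      have "cmod v - cmod y \<le> cmod (y - v)" using norm_triangle_ineq2[of v y] by (simp add: norm_minus_commute)
      moreover have "cmod y \<le> cmod u + \<delta>" using yu norm_triangle_ineq2[of y u] by (simp add: norm_minus_commute)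
      moreover have "\<kappa> \<le> 1/2" unfolding \<kappa>_def by (rule min.cobounded2)
      hence "\<kappa> * cmod v \<le> 1/2 * cmod v" by (intro mult_right_mono) auto
      moreover have "2 * cmod u + 2 * \<delta> < cmod v" using False by (simp add: K_def)
      ultimately show ?thesis by linarith
    qed
  qed
qed

lemma summable_on_wp:
  assumes u: "u \<notin> L - {0}"
  shows "(\<lambda>v. norm (1 / (u - v)\<^sup>2 - 1 / v\<^sup>2)) summable_on (L - {0})"
proof -
  obtain \<delta> \<kappa> where dk: "\<delta> > 0" "\<kappa> > 0" "\<And>y v. y \<in> ball u \<delta> \<Longrightarrow> v \<in> L - {0} \<Longrightarrow> \<kappa> * cmod v \<le> cmod (y - v)"
    using lattice_dist_lower_bound[OF u] by blast
  define C where "C = cmod u * (2 + cmod u / gap) / \<kappa>\<^sup>2"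
  have "(\<lambda>v. C * (1 / cmod v ^ 3)) summable_on (L - {0})"
    by (intro summable_on_cmult_right summable_on_inverse_cube)
  thus ?thesis
  proof (rule summable_on_comparison_test)
    fix v assume v: "v \<in> L - {0}"
    hence v0: "v \<noteq> 0" "cmod v > 0" by auto
    have k: "\<kappa> * cmod v \<le> cmod (u - v)" using dk v by auto
    hence uv: "u - v \<noteq> 0" using dk(2) v0 by (smt (verit) mult_pos_pos norm_zero)
    \<comment> \<open>The subtraction gains one order: the numerator is linear in v, so the term is
      of order |v|^-3.\<close>
    have "1 / (u - v)\<^sup>2 - 1 / v\<^sup>2 = u * (2 * v - u) / ((u - v)\<^sup>2 * v\<^sup>2)"
      using uv v0 by (simp add: divide_simps) (simp add: power2_eq_square algebra_simps)
    hence "norm (1 / (u - v)\<^sup>2 - 1 / v\<^sup>2) = cmod u * cmod (2 * v - u) / ((cmod (u - v))\<^sup>2 * (cmod v)\<^sup>2)"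
      by (simp add: norm_divide norm_mult norm_power)
    also have "\<dots> \<le> cmod u * (cmod v * (2 + cmod u / gap)) / ((\<kappa> * cmod v)\<^sup>2 * (cmod v)\<^sup>2)"
    proof (rule frac_le)
      have "cmod u * gap \<le> cmod u * cmod v" using gap_le[of v] v by (intro mult_left_mono) auto
      hence "cmod u \<le> cmod v * (cmod u / gap)" using gap_pos by (simp add: field_simps)
      moreover have "cmod (2 * v - u) \<le> 2 * cmod v + cmod u" using norm_triangle_ineq4[of "2 * v" u] by (simp add: norm_mult)
      ultimately have "cmod (2 * v - u) \<le> cmod v * (2 + cmod u / gap)" by (simp add: algebra_simps)
      thus "cmod u * cmod (2 * v - u) \<le> cmod u * (cmod v * (2 + cmod u / gap))" by (intro mult_left_mono) auto
      show "(\<kappa> * cmod v)\<^sup>2 * (cmod v)\<^sup>2 \<le> (cmod (u - v))\<^sup>2 * (cmod v)\<^sup>2"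
        using k dk v0 by (intro mult_right_mono power_mono) auto
    qed (use dk v0 gap_pos in auto)
    also have "\<dots> = C * (1 / cmod v ^ 3)"
      unfolding C_def using v0 dk(2) by (simp add: field_simps power2_eq_square power3_eq_cube)
    finally show "norm (1 / (u - v)\<^sup>2 - 1 / v\<^sup>2) \<le> C * (1 / cmod v ^ 3)" .
  qed auto
qed

text \<open>The Weierstrass function without its pole at 0. Being holomorphic there, it carries the
  local expansion used to compare principal parts.\<close>

definition wp_regular :: "complex \<Rightarrow> complex" where
  "wp_regular u = (\<Sum>\<^sub>\<infinity>v\<in>L - {0}. 1 / (u - v)\<^sup>2 - 1 / v\<^sup>2)"

abbreviation wp :: "complex \<Rightarrow> complex" where "wp \<equiv> weierstrass_p (of_real \<omega>) (\<i> * of_real \<eta>)"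

lemma wp_eq: "wp u = 1 / u\<^sup>2 + wp_regular u"
  by (simp add: weierstrass_p_def wp_regular_def)

lemma wp_regular_differentiable:
  assumes u: "u \<notin> L - {0}"
  shows "wp_regular field_differentiable (at u)"
proof -
  obtain \<delta> \<kappa> where dk: "\<delta> > 0" "\<kappa> > 0" "\<And>y v. y \<in> ball u \<delta> \<Longrightarrow> v \<in> L - {0} \<Longrightarrow> \<kappa> * cmod v \<le> cmod (y - v)"
    using lattice_dist_lower_bound[OF u] by blast
  have nz: "y - v \<noteq> 0" if "y \<in> ball u \<delta>" "v \<in> L - {0}" for y v
    using dk(3)[OF that] dk(2) that by (smt (verit) DiffE insertI1 mult_pos_pos norm_zero zero_less_norm_iff singletonI)
  have "((\<lambda>y. \<Sum>\<^sub>\<infinity>v\<in>L - {0}. 1 / (y - v)\<^sup>2 - 1 / v\<^sup>2) has_field_derivative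
     (\<Sum>\<^sub>\<infinity>v\<in>L - {0}. - 2 / (u - v) ^ 3)) (at u)"
  proof (rule infsum_has_field_derivative[where S = "ball u \<delta>" and M = "\<lambda>v. 2 / \<kappa> ^ 3 * (1 / cmod v ^ 3)"])
    fix v y assume v: "v \<in> L - {0}" and y: "y \<in> ball u \<delta>"
    show "((\<lambda>y. 1 / (y - v)\<^sup>2 - 1 / v\<^sup>2) has_field_derivative - 2 / (y - v) ^ 3) (at y)"
    proof -
      have d: "y - v \<noteq> 0" by (rule nz[OF y v])
      have "((\<lambda>y. 1 / (y - v)\<^sup>2 - 1 / v\<^sup>2) has_field_derivative
          (0 * (y - v)\<^sup>2 - 1 * (2 * (y - v))) / ((y - v)\<^sup>2 * (y - v)\<^sup>2) - 0) (at y)"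
        using d by (intro DERIV_diff DERIV_divide) (auto intro!: derivative_eq_intros)
      also have "(0 * (y - v)\<^sup>2 - 1 * (2 * (y - v))) / ((y - v)\<^sup>2 * (y - v)\<^sup>2) - 0 = - 2 / (y - v) ^ 3"
        using d unfolding power2_eq_square power3_eq_cube by (simp add: divide_simps)
      finally show ?thesis .
    qed
    have "0 < \<kappa> * cmod v" using dk v by auto
    hence "2 * (1 / cmod (y - v) ^ 3) \<le> 2 * (1 / (\<kappa> * cmod v) ^ 3)"
      using dk(3)[OF y v] by (intro mult_left_mono inverse_power_mono) auto
    thus "norm (- 2 / (y - v) ^ 3) \<le> 2 / \<kappa> ^ 3 * (1 / cmod v ^ 3)"
      by (simp add: norm_divide norm_power power_mult_distrib)
  next
    show "(\<lambda>v. 2 / \<kappa> ^ 3 * (1 / cmod v ^ 3)) summable_on (L - {0})"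
      by (intro summable_on_cmult_right summable_on_inverse_cube)
  next
    fix y assume y: "y \<in> ball u \<delta>"
    have "y \<notin> L - {0}"
    proof
      assume "y \<in> L - {0}"
      from nz[OF y this] show False by simp
    qed
    thus "(\<lambda>v. 1 / (y - v)\<^sup>2 - 1 / v\<^sup>2) summable_on (L - {0})"
      by (rule abs_summable_summable[OF summable_on_wp])
  qed (use dk countable_L infinite_L in auto)
  thus ?thesis unfolding wp_regular_def[abs_def] field_differentiable_def by blast
qed

lemma wp_regular_holomorphic: "wp_regular holomorphic_on - (L - {0})"
  using wp_regular_differentiable by (auto simp: holomorphic_on_def intro: field_differentiable_at_within)

lemma wp_holomorphic: "wp holomorphic_on - L"
proof -
  have "(\<lambda>u. 1 / u\<^sup>2 + wp_regular u) holomorphic_on - L"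
    by (intro holomorphic_intros holomorphic_on_subset[OF wp_regular_holomorphic]) auto
  thus ?thesis by (simp add: wp_eq[abs_def])
qed

lemma wp_regular_0 [simp]: "wp_regular 0 = 0"
  by (simp add: wp_regular_def)

lemma wp_regular_minus: "wp_regular (- u) = wp_regular u"
proof -
  have "bij_betw uminus (L - {0}) (L - {0})"
    by (rule bij_betwI[of _ _ _ uminus]) (auto simp: L_uminus)
  from infsum_reindex_bij_betw[OF this, of "\<lambda>v. 1 / (- u - v)\<^sup>2 - 1 / v\<^sup>2"]
  have "wp_regular (- u) = (\<Sum>\<^sub>\<infinity>v\<in>L - {0}. 1 / (- u - - v)\<^sup>2 - 1 / (- v)\<^sup>2)"
    by (simp add: wp_regular_def)
  also have "\<dots> = wp_regular u" unfolding wp_regular_def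
    by (intro infsum_cong) (simp add: power2_eq_square algebra_simps)
  finally show ?thesis .
qed

lemma wp_minus: "wp (- u) = wp u"
  by (simp add: wp_eq wp_regular_minus)

definition nu :: real where "nu = pi / \<eta>"

lemma nu_pos: "nu > 0" using \<eta>_pos by (simp add: nu_def)

text \<open>With z = i \<eta> w the sum over a vertical column becomes the cosecant series at w, and
  the factor i turns sin (pi w) into sinh (nu z).\<close>

lemma column_sum:
  assumes z: "\<And>n. z \<noteq> of_int n * (\<i> * of_real \<eta>)"
  shows "((\<lambda>n::int. 1 / (z - of_int n * (\<i> * of_real \<eta>))\<^sup>2) has_sum (of_real nu / sinh (of_real nu * z))\<^sup>2) UNIV"
proof -
  define w where "w = - \<i> * z / of_real \<eta>"
  have zw: "z = \<i> * of_real \<eta> * w" using \<eta>_pos by (simp add: w_def)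
  have w: "w \<notin> \<int>"
  proof
    assume "w \<in> \<int>"
    then obtain n where "w = of_int n" by (auto elim: Ints_cases)
    thus False using z[of n] zw by (simp add: mult_ac)
  qed
  have bij: "bij_betw uminus (UNIV::int set) UNIV" by (rule bij_betwI[of _ _ _ uminus]) auto
  have "((\<lambda>n::int. 1 / (w + of_int (- n))\<^sup>2) has_sum (of_real pi / sin (of_real pi * w))\<^sup>2) UNIV"
    using has_sum_reindex_bij_betw[OF bij, of "\<lambda>n. 1 / (w + of_int n)\<^sup>2"] has_sum_inverse_square_int[OF w] by simp
  hence "((\<lambda>n::int. - 1 / (of_real \<eta>)\<^sup>2 * (1 / (w + of_int (- n))\<^sup>2)) has_sum - 1 / (of_real \<eta>)\<^sup>2 * (of_real pi / sin (of_real pi * w))\<^sup>2) UNIV"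
    by (rule has_sum_cmult_right)
  also have "(\<lambda>n::int. - 1 / (of_real \<eta>)\<^sup>2 * (1 / (w + of_int (- n))\<^sup>2)) = (\<lambda>n. 1 / (z - of_int n * (\<i> * of_real \<eta>))\<^sup>2)"
  proof
    fix n :: int
    have "(z - of_int n * (\<i> * of_real \<eta>))\<^sup>2 = (\<i> * of_real \<eta> * (w + of_int (- n)))\<^sup>2"
      unfolding zw by (simp add: algebra_simps)
    also have "\<dots> = - ((of_real \<eta>)\<^sup>2 * (w + of_int (- n))\<^sup>2)" by (simp add: power_mult_distrib)
    finally show "- 1 / (of_real \<eta>)\<^sup>2 * (1 / (w + of_int (- n))\<^sup>2) = 1 / (z - of_int n * (\<i> * of_real \<eta>))\<^sup>2"
      by simp
  qed
  also have "- 1 / (of_real \<eta>)\<^sup>2 * (of_real pi / sin (of_real pi * w))\<^sup>2 = (of_real nu / sinh (of_real nu * z))\<^sup>2"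
  proof -
    have "sinh (of_real nu * z) = sinh (\<i> * (of_real pi * w))"
      unfolding zw nu_def using \<eta>_pos by (simp add: mult_ac)
    also have "\<dots> = \<i> * sin (of_real pi * w)" by (simp add: sinh_conv_sin)
    finally show ?thesis using \<eta>_pos by (simp add: nu_def power_divide power_mult_distrib)
  qed
  finally show ?thesis .
qed

end

section \<open>The Weierstrass function of a rectangular lattice\<close>

lemma sinh_complex_of_real: "sinh (complex_of_real y) = of_real (sinh y)"
  by (simp add: sinh_def scaleR_conv_of_real exp_of_real flip: of_real_minus)

lemma cosh_complex_of_real: "cosh (complex_of_real y) = of_real (cosh y)"
  by (simp add: cosh_def scaleR_conv_of_real exp_of_real flip: of_real_minus)

context rectangular_lattice
begin

text \<open>Absolute convergence permits summation by columns. There the convergence-producing terms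
  1 / v^2 separate and sum to a constant \<kappa> independent of u, which drops out of all
  differences.\<close>

lemma wp_column:
  obtains \<kappa> where "\<And>u. u \<notin> L \<Longrightarrow> wp u = (\<Sum>\<^sub>\<infinity>m::int. (of_real nu / sinh (of_real nu * (u - of_int m * of_real \<omega>)))\<^sup>2) - \<kappa>"
    and "\<And>u. u \<notin> L \<Longrightarrow> (\<lambda>m::int. (of_real nu / sinh (of_real nu * (u - of_int m * of_real \<omega>)))\<^sup>2) summable_on UNIV"
proof -
  define col where "col u m = (of_real nu / sinh (of_real nu * (u - of_int m * of_real \<omega>)))\<^sup>2" for u :: complex and m :: int
  \<comment> \<open>For m = 0 the lattice point 0 contributes 1 / 0 = 0, so the omitted point needs
    no exception.\<close>
  define k where "k m = (\<Sum>\<^sub>\<infinity>n::int. 1 / (latt (m, n))\<^sup>2)" for m :: int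
  have k_eq: "k m = of_real (nu\<^sup>2 * (csch (of_int m * (nu * \<omega>)))\<^sup>2)" if "m \<noteq> 0" for m
  proof -
    have "((\<lambda>n::int. 1 / (of_int (- m) * of_real \<omega> - of_int n * (\<i> * of_real \<eta>))\<^sup>2) has_sum
        (of_real nu / sinh (of_real nu * (of_int (- m) * of_real \<omega>)))\<^sup>2) UNIV"
    proof (rule column_sum)
      fix n :: int
      have "Re (of_int (- m) * of_real \<omega> :: complex) \<noteq> Re (of_int n * (\<i> * complex_of_real \<eta>))"
        using that \<omega>_pos by simp
      thus "of_int (- m) * of_real \<omega> \<noteq> of_int n * (\<i> * complex_of_real \<eta>)" by metis
    qed
    moreover have "(of_int (- m) * of_real \<omega> - of_int n * (\<i> * of_real \<eta>))\<^sup>2 = (latt (m, n))\<^sup>2" for n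
      by (simp add: latt_def power2_eq_square algebra_simps)
    ultimately have "k m = (of_real nu / sinh (of_real nu * (of_int (- m) * of_real \<omega>)))\<^sup>2"
      unfolding k_def by (simp add: infsumI)
    also have "of_real nu * (of_int (- m) * of_real \<omega>) = complex_of_real (- (of_int m * (nu * \<omega>)))" by simp
    also have "sinh \<dots> = complex_of_real (- sinh (of_int m * (nu * \<omega>)))"
      by (simp only: sinh_complex_of_real sinh_minus)
    finally show ?thesis by (simp add: csch_def power_divide)
  qed
  have ks: "k summable_on UNIV"
  proof -
    have "(\<lambda>m. complex_of_real (nu\<^sup>2 * (csch (of_int m * (nu * \<omega>)))\<^sup>2)) summable_on (- {0})"
      using nu_pos \<omega>_pos by (intro summable_on_of_real summable_on_cmult_right summable_on_csch_square) auto
    hence "k summable_on (- {0})" using k_eq by (subst summable_on_cong) auto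
    hence "k summable_on (insert 0 (- {0}))" by (subst summable_on_insert_iff)
    moreover have "insert 0 (- {0::int}) = UNIV" by auto
    ultimately show ?thesis by simp
  qed
  have main: "col u summable_on UNIV" "wp u = infsum (col u) UNIV - infsum k UNIV" if u: "u \<notin> L" for u
  proof -
    let ?F = "\<lambda>v. 1 / (u - v)\<^sup>2 - 1 / v\<^sup>2"
    have "?F summable_on (L - {0})" by (rule abs_summable_summable[OF summable_on_wp]) (use u in auto)
    \<comment> \<open>At v = 0 the summand is 1 / u^2 - 1 / 0 = 1 / u^2, exactly the leading term of
      \<open>wp\<close>; the sum therefore extends to the full lattice.\<close>
    note ins = infsum_insert[OF this, of 0]
    have L0: "insert 0 (L - {0}) = L" by (auto simp: insert_absorb)
    have FL: "?F summable_on L" using \<open>?F summable_on (L - {0})\<close> summable_on_insert_iff[of ?F 0 "L - {0}"] L0 by simp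
    have "infsum ?F L = wp u" using ins unfolding L0 by (simp add: wp_eq wp_regular_def)
    hence sumF: "infsum (\<lambda>p. ?F (latt p)) UNIV = wp u"
      using infsum_reindex_bij_betw[OF bij_latt, of ?F] by simp
    have "(\<lambda>p. ?F (latt p)) summable_on UNIV"
      using summable_on_reindex_bij_betw[OF bij_latt, of ?F] FL by simp
    hence FS: "(\<lambda>(m, n). ?F (latt (m, n))) summable_on UNIV \<times> UNIV" by (simp add: case_prod_unfold)
    have colsum: "((\<lambda>n::int. 1 / (u - latt (m, n))\<^sup>2) has_sum col u m) UNIV" for m
    proof -
      have "((\<lambda>n::int. 1 / ((u - of_int m * of_real \<omega>) - of_int n * (\<i> * of_real \<eta>))\<^sup>2) has_sum
          (of_real nu / sinh (of_real nu * (u - of_int m * of_real \<omega>)))\<^sup>2) UNIV"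
      proof (rule column_sum)
        fix n :: int
        show "u - of_int m * of_real \<omega> \<noteq> of_int n * (\<i> * complex_of_real \<eta>)"
        proof
          assume "u - of_int m * of_real \<omega> = of_int n * (\<i> * complex_of_real \<eta>)"
          hence "u = latt (m, n)" by (simp add: latt_def algebra_simps)
          thus False using u L_eq by blast
        qed
      qed
      thus ?thesis by (simp add: latt_def col_def diff_diff_eq)
    qed
    have inner: "(\<Sum>\<^sub>\<infinity>n. ?F (latt (m, n))) = col u m - k m" for m
    proof -
      have Fm: "(\<lambda>n. ?F (latt (m, n))) summable_on UNIV"
        using summable_on_SigmaD1[OF FS, of m] by simp
      have "(\<lambda>n. 1 / (u - latt (m, n))\<^sup>2 + - ?F (latt (m, n))) summable_on UNIV"
        by (intro summable_on_add has_sum_imp_summable[OF colsum] summable_on_uminus[THEN iffD2, OF Fm])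
      hence km: "(\<lambda>n. 1 / (latt (m, n))\<^sup>2) summable_on UNIV" by simp
      have "((\<lambda>n. 1 / (u - latt (m, n))\<^sup>2 + - (1 / (latt (m, n))\<^sup>2)) has_sum (col u m + - k m)) UNIV"
        unfolding k_def by (intro has_sum_add colsum has_sum_uminusI has_sum_infsum km)
      thus ?thesis by (simp add: infsumI)
    qed
    have outer: "(\<lambda>m. col u m - k m) summable_on UNIV"
      using summable_on_Sigma_banach[OF FS] by (simp add: inner)
    have "(\<lambda>m. (col u m - k m) + k m) summable_on UNIV" by (intro summable_on_add outer ks)
    thus cs: "col u summable_on UNIV" by simp
    have "wp u = (\<Sum>\<^sub>\<infinity>m. col u m - k m)"
      using infsum_Sigma'_banach[OF FS] sumF by (simp add: inner case_prod_unfold)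
    also have "\<dots> = (\<Sum>\<^sub>\<infinity>m. col u m + - k m)" by simp
    also have "\<dots> = infsum (col u) UNIV + infsum (\<lambda>m. - k m) UNIV"
      by (intro infsum_add cs summable_on_uminus[THEN iffD2] ks)
    finally show "wp u = infsum (col u) UNIV - infsum k UNIV" by (simp add: infsum_uminus)
  qed
  show thesis using that[of "infsum k UNIV"] main unfolding col_def by blast
qed

section \<open>Periodicity and Liouville's theorem\<close>

lemma periodic_L:
  assumes 1: "\<And>u. u \<notin> L \<Longrightarrow> f (u + of_real \<omega>) = f u" and 2: "\<And>u. u \<notin> L \<Longrightarrow> f (u + \<i> * of_real \<eta>) = f u"
    and u: "u \<notin> L" and v: "v \<in> L"
  shows "f (u + v) = f u"
proof -
  have gen: "f (u + of_int m * p) = f u" if p: "p \<in> L" and per: "\<And>u. u \<notin> L \<Longrightarrow> f (u + p) = f u" and u: "u \<notin> L" for u p and m :: int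
  proof -
    have mp: "of_int m * p \<in> L" for m :: int
    proof -
      obtain q where "p = latt q" using p unfolding L_eq by blast
      hence "of_int m * p = latt (m * fst q, m * snd q)" by (simp add: latt_def algebra_simps)
      thus ?thesis unfolding L_eq by blast
    qed
    have nl: "u + of_int m * p \<notin> L" for m :: int using u mp[of m] by (simp add: L_add_iff)
    show ?thesis
    proof (induction m rule: int_induct[of _ 0])
      case base thus ?case by simp
    next
      case (step1 i)
      have "f (u + of_int (i + 1) * p) = f ((u + of_int i * p) + p)" by (simp add: algebra_simps)
      thus ?case using per[OF nl[of i]] step1 by simp
    next
      case (step2 i)
      have "f ((u + of_int (i - 1) * p) + p) = f (u + of_int i * p)" by (simp add: algebra_simps)
      thus ?case using per[OF nl[of "i - 1"]] step2 by simp
    qed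
  qed
  have \<omega>L: "of_real \<omega> \<in> L" "\<i> * of_real \<eta> \<in> L"
    unfolding L_eq by (rule image_eqI[of _ _ "(1, 0)"], simp_all add: latt_def) (rule image_eqI[of _ _ "(0, 1)"], simp_all add: latt_def)
  obtain p where p: "v = latt p" using v unfolding L_eq by blast
  have "of_int (fst p) * of_real \<omega> \<in> L"
    unfolding L_eq by (rule image_eqI[of _ _ "(fst p, 0)"]) (simp_all add: latt_def)
  hence "u + of_int (fst p) * of_real \<omega> \<notin> L" using u by (simp add: L_add_iff)
  from gen[OF \<omega>L(2) 2 this, of "snd p"] gen[OF \<omega>L(1) 1 u, of "fst p"]
  show ?thesis unfolding p latt_def by (simp add: add.assoc)
qed

lemma \<omega>_in_L: "of_real \<omega> \<in> L" and \<eta>_in_L: "\<i> * of_real \<eta> \<in> L"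
  unfolding L_eq by (rule image_eqI[of _ _ "(1, 0)"], simp_all add: latt_def) (rule image_eqI[of _ _ "(0, 1)"], simp_all add: latt_def)

text \<open>In the column series translation by \<omega> only permutes the columns, and translation
  by i \<eta> changes the sign of every sinh, which the square hides.\<close>

lemma wp_periodic:
  assumes "u \<notin> L" "v \<in> L"
  shows "wp (u + v) = wp u"
proof -
  obtain \<kappa> where \<kappa>: "\<And>u. u \<notin> L \<Longrightarrow> wp u = (\<Sum>\<^sub>\<infinity>m::int. (of_real nu / sinh (of_real nu * (u - of_int m * of_real \<omega>)))\<^sup>2) - \<kappa>"
    using wp_column by metis
  show ?thesis
  proof (rule periodic_L[OF _ _ assms])
    fix u assume u: "u \<notin> L"
    let ?c = "\<lambda>m::int. (of_real nu / sinh (of_real nu * (u - of_int m * of_real \<omega>)))\<^sup>2"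
    have "bij_betw (\<lambda>m::int. m - 1) UNIV UNIV" by (rule bij_betwI[of _ _ _ "\<lambda>m. m + 1"]) auto
    from infsum_reindex_bij_betw[OF this, of ?c]
    have "infsum ?c UNIV = (\<Sum>\<^sub>\<infinity>m. ?c (m - 1))" by simp
    also have "(\<lambda>m. ?c (m - 1)) = (\<lambda>m. (of_real nu / sinh (of_real nu * (u + of_real \<omega> - of_int m * of_real \<omega>)))\<^sup>2)"
      by (simp add: algebra_simps)
    finally show "wp (u + of_real \<omega>) = wp u"
      using \<kappa>[OF u] \<kappa>[of "u + of_real \<omega>"] u \<omega>_in_L by (simp add: L_add_iff)
    have "(of_real nu / sinh (of_real nu * (u + \<i> * of_real \<eta> - of_int m * of_real \<omega>)))\<^sup>2 = ?c m" for m
    proof -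
      have "of_real nu * (u + \<i> * of_real \<eta> - of_int m * of_real \<omega>) = of_real nu * (u - of_int m * of_real \<omega>) + \<i> * of_real pi"
      proof -
        have "nu * \<eta> = pi" using \<eta>_pos by (simp add: nu_def)
        hence "complex_of_real nu * of_real \<eta> = of_real pi" by (metis of_real_mult)
        thus ?thesis by (simp add: algebra_simps)
      qed
      hence "sinh (of_real nu * (u + \<i> * of_real \<eta> - of_int m * of_real \<omega>)) = - sinh (of_real nu * (u - of_int m * of_real \<omega>))"
        by (simp add: sinh_add) (simp add: cosh_conv_cos sinh_conv_sin)
      thus ?thesis by simp
    qed
    thus "wp (u + \<i> * of_real \<eta>) = wp u"
      using \<kappa>[OF u] \<kappa>[of "u + \<i> * of_real \<eta>"] u \<eta>_in_L by (simp add: L_add_iff)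
  qed
qed

lemma deriv_periodic:
  assumes f: "f holomorphic_on - L" and per: "\<And>u v. u \<notin> L \<Longrightarrow> v \<in> L \<Longrightarrow> f (u + v) = f u"
    and u: "u \<notin> L" and v: "v \<in> L"
  shows "deriv f (u + v) = deriv f u"
proof -
  have uv: "u + v \<notin> L" using u v by (simp add: L_add_iff)
  have d: "(f has_field_derivative deriv f w) (at w)" if "w \<notin> L" for w
    using holomorphic_derivI[OF f open_Compl_L] that by auto
  have "((\<lambda>z. f (z + v)) has_field_derivative deriv f (u + v) * 1) (at u)"
    by (rule DERIV_chain2[where g = "\<lambda>z. z + v", OF d[OF uv]]) (auto intro!: derivative_eq_intros)
  moreover have "((\<lambda>z. f (z + v)) has_field_derivative deriv f u) (at u)"
    by (rule has_field_derivative_transform_within_open[OF d[OF u] open_Compl_L]) (use u v per in auto)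
  ultimately show ?thesis using DERIV_unique by fastforce
qed

text \<open>Periodicity carries the removal of the singularity at 0 to all lattice points. The
  entire extension takes all its values on one closed period rectangle, hence is bounded, and
  Liouville's theorem applies.\<close>

lemma elliptic_constant:
  assumes f: "f holomorphic_on - L" and per: "\<And>u v. u \<notin> L \<Longrightarrow> v \<in> L \<Longrightarrow> f (u + v) = f u"
    and h: "h holomorphic_on ball 0 d" "d > 0" "\<And>u. u \<in> ball 0 d \<Longrightarrow> u \<notin> L \<Longrightarrow> f u = h u"
  obtains c where "\<And>u. u \<notin> L \<Longrightarrow> f u = c"
proof -
  define r where "r = min d gap"
  have r: "r > 0" using h gap_pos by (simp add: r_def)
  define E where "E u = (if u \<in> L then h 0 else f u)" for u
  have Ediff: "E field_differentiable (at u)" for u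
  proof (cases "u \<in> L")
    case False
    have "(f has_field_derivative deriv f u) (at u)"
      using holomorphic_derivI[OF f open_Compl_L] False by auto
    hence "(E has_field_derivative deriv f u) (at u)"
      by (rule has_field_derivative_transform_within_open[OF _ open_Compl_L]) (use False in \<open>auto simp: E_def\<close>)
    thus ?thesis unfolding field_differentiable_def by blast
  next
    case True
    have "(h has_field_derivative deriv h 0) (at (u - u))"
      using holomorphic_derivI[OF h(1), of 0] h(2) by auto
    hence "((\<lambda>z. h (z - u)) has_field_derivative deriv h 0 * 1) (at u)"
      by (rule DERIV_chain2) (auto intro!: derivative_eq_intros)
    hence "(E has_field_derivative deriv h 0 * 1) (at u)"
    proof (rule has_field_derivative_transform_within_open[of _ _ _ "ball u r"])
      fix z assume z: "z \<in> ball u r"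
      hence zu: "z - u \<in> ball 0 d" "z - u \<in> ball 0 gap" by (auto simp: r_def dist_norm norm_minus_commute)
      have iff: "z \<in> L \<longleftrightarrow> z - u \<in> L" using L_add_iff[OF True, of "z - u"] by simp
      show "h (z - u) = E z"
      proof (cases "z = u")
        case False
        hence nl: "z - u \<notin> L" using ball_gap[OF zu(2)] by simp
        have "E z = f (z - u + u)" using nl iff by (simp add: E_def)
        also have "\<dots> = h (z - u)" using per[OF nl True] h(3)[OF zu(1) nl] by simp
        finally show ?thesis by simp
      qed (use True in \<open>simp add: E_def\<close>)
    qed (use r in auto)
    thus ?thesis unfolding field_differentiable_def by blast
  qed
  hence E: "E holomorphic_on UNIV" by (auto simp: holomorphic_on_def)
  have "range E \<subseteq> E ` cbox 0 (Complex \<omega> \<eta>)"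
  proof
    fix w assume "w \<in> range E"
    then obtain z where z: "w = E z" by auto
    define m where "m = \<lfloor>Re z / \<omega>\<rfloor>"
    define n where "n = \<lfloor>Im z / \<eta>\<rfloor>"
    define v where "v = latt (m, n)"
    have v: "v \<in> L" unfolding v_def L_eq by blast
    have "of_int m \<le> Re z / \<omega>" "Re z / \<omega> \<le> of_int m + 1" "of_int n \<le> Im z / \<eta>" "Im z / \<eta> \<le> of_int n + 1"
      unfolding m_def n_def by linarith+
    hence "of_int m * \<omega> \<le> Re z" "Re z \<le> (of_int m + 1) * \<omega>" "of_int n * \<eta> \<le> Im z" "Im z \<le> (of_int n + 1) * \<eta>"
      using \<omega>_pos \<eta>_pos by (simp_all add: pos_le_divide_eq pos_divide_le_eq)
    hence "z - v \<in> cbox 0 (Complex \<omega> \<eta>)"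
      unfolding v_def in_cbox_complex_iff by (simp add: algebra_simps)
    moreover have "E (z - v) = E z"
    proof -
      have iff: "z \<in> L \<longleftrightarrow> z - v \<in> L" using L_add_iff[OF v, of "z - v"] by simp
      show ?thesis
      proof (cases "z \<in> L")
        case False
        thus ?thesis using iff per[of "z - v" v] v by (simp add: E_def)
      qed (use iff in \<open>simp add: E_def\<close>)
    qed
    ultimately show "w \<in> E ` cbox 0 (Complex \<omega> \<eta>)" using z by (metis image_eqI)
  qed
  moreover have "bounded (E ` cbox 0 (Complex \<omega> \<eta>))"
    by (intro compact_imp_bounded compact_continuous_image compact_cbox holomorphic_on_imp_continuous_on holomorphic_on_subset[OF E]) auto
  ultimately have "bounded (range E)" using bounded_subset by blast
  from Liouville_theorem[OF E this] obtain c where "\<And>z. E z = c" by (auto simp: constant_on_def)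
  thus thesis using that[of c] by (metis E_def)
qed

section \<open>Differential equation, surjectivity and injectivity of the Weierstrass
  parametrization\<close>

definition wp' :: "complex \<Rightarrow> complex" where "wp' = deriv wp"

lemma has_derivative_wp: "u \<notin> L \<Longrightarrow> (wp has_field_derivative wp' u) (at u)"
  unfolding wp'_def using holomorphic_derivI[OF wp_holomorphic open_Compl_L] by auto

lemma wp'_holomorphic: "wp' holomorphic_on - L"
  unfolding wp'_def by (intro holomorphic_deriv wp_holomorphic open_Compl_L)

lemma has_derivative_wp': "u \<notin> L \<Longrightarrow> (wp' has_field_derivative deriv wp' u) (at u)"
  using holomorphic_derivI[OF wp'_holomorphic open_Compl_L] by auto

lemma wp'_periodic: "u \<notin> L \<Longrightarrow> v \<in> L \<Longrightarrow> wp' (u + v) = wp' u"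
  unfolding wp'_def by (rule deriv_periodic[OF wp_holomorphic wp_periodic])

lemma wp'_minus:
  assumes u: "u \<notin> L"
  shows "wp' (- u) = - wp' u"
proof -
  have "((\<lambda>z. wp (- z)) has_field_derivative wp' (- u) * (-1)) (at u)"
    by (rule DERIV_chain2[OF has_derivative_wp]) (use u in \<open>auto simp: L_uminus intro!: derivative_eq_intros\<close>)
  hence "(wp has_field_derivative wp' (- u) * (-1)) (at u)" by (simp add: wp_minus)
  from DERIV_unique[OF this has_derivative_wp[OF u]] show ?thesis by (metis mult_minus1_right minus_minus)
qed

text \<open>-v/2 and v/2 differ by a period, while \<open>wp'\<close> is odd.\<close>

lemma wp'_half_period:
  assumes "v \<in> L" "v / 2 \<notin> L"
  shows "wp' (v / 2) = 0"
proof -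
  have "wp' (- (v / 2) + v) = wp' (- (v / 2))"
    using assms by (intro wp'_periodic) (auto simp: L_uminus)
  thus ?thesis using wp'_minus[OF assms(2)] by simp
qed

text \<open>Evenness kills the derivative at 0, and two applications of \<open>pole_lemma\<close>
  divide out u^2 holomorphically.\<close>

lemma wp_regular_expansion:
  obtains q where "q holomorphic_on ball 0 gap" "\<And>u. u \<in> ball 0 gap \<Longrightarrow> wp_regular u = u\<^sup>2 * q u"
proof -
  let ?B = "ball (0::complex) gap"
  have hol: "wp_regular holomorphic_on ?B"
    by (rule holomorphic_on_subset[OF wp_regular_holomorphic]) (use ball_gap in auto)
  have 0: "0 \<in> interior ?B" using gap_pos by (simp add: interior_open)
  have "(wp_regular has_field_derivative deriv wp_regular 0) (at 0)"
    using holomorphic_derivI[OF hol, of 0] gap_pos by auto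
  moreover from this have "((\<lambda>z. wp_regular (- z)) has_field_derivative deriv wp_regular 0 * (-1)) (at 0)"
    by (intro DERIV_chain2[where g = uminus]) (auto intro!: derivative_eq_intros)
  hence "(wp_regular has_field_derivative deriv wp_regular 0 * (-1)) (at 0)" by (simp add: wp_regular_minus)
  ultimately have "deriv wp_regular 0 = deriv wp_regular 0 * (-1)" by (rule DERIV_unique)
  hence d0: "deriv wp_regular 0 = 0" by simp
  define g1 where "g1 = (\<lambda>z. if z = 0 then deriv wp_regular 0 else (wp_regular z - wp_regular 0) / (z - 0))"
  have g1: "g1 holomorphic_on ?B" unfolding g1_def by (rule pole_lemma[OF hol 0])
  define q where "q = (\<lambda>z. if z = 0 then deriv g1 0 else (g1 z - g1 0) / (z - 0))"
  have q: "q holomorphic_on ?B" unfolding q_def by (rule pole_lemma[OF g1 0])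
  have "wp_regular u = u\<^sup>2 * q u" for u
    by (simp add: q_def g1_def d0 power2_eq_square)
  thus thesis using that q by blast
qed

text \<open>\<open>deriv wp'\<close> and 6 wp^2 have the same principal part 6 / u^4 at 0; no other
  pole term arises because \<open>wp_regular\<close> is divisible by u^2. The difference is constant
  by \<open>elliptic_constant\<close>.\<close>

lemma wp_second_derivative:
  obtains c where "\<And>u. u \<notin> L \<Longrightarrow> deriv wp' u = 6 * (wp u)\<^sup>2 + c"
proof -
  let ?B = "ball (0::complex) gap"
  obtain q where q: "q holomorphic_on ?B" "\<And>u. u \<in> ?B \<Longrightarrow> wp_regular u = u\<^sup>2 * q u"
    using wp_regular_expansion by metis
  have hol: "wp_regular holomorphic_on ?B"
    by (rule holomorphic_on_subset[OF wp_regular_holomorphic]) (use ball_gap in auto)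
  have hol': "deriv wp_regular holomorphic_on ?B" by (intro holomorphic_deriv hol) auto
  have op: "open (?B - {0})" by auto
  have w1: "wp' u = - 2 / u ^ 3 + deriv wp_regular u" if u: "u \<in> ?B - {0}" for u
  proof -
    have "(wp_regular has_field_derivative deriv wp_regular u) (at u)"
      using holomorphic_derivI[OF hol, of u] u by auto
    hence "((\<lambda>u. 1 / u\<^sup>2 + wp_regular u) has_field_derivative (0 * u\<^sup>2 - 1 * (2 * u)) / (u\<^sup>2 * u\<^sup>2) + deriv wp_regular u) (at u)"
      using u by (intro DERIV_add DERIV_divide) (auto intro!: derivative_eq_intros)
    moreover have "(0 * u\<^sup>2 - 1 * (2 * u)) / (u\<^sup>2 * u\<^sup>2) = - 2 / u ^ 3"
      using u by (simp add: power2_eq_square power3_eq_cube divide_simps)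
    ultimately have "(wp has_field_derivative - 2 / u ^ 3 + deriv wp_regular u) (at u)"
      by (simp add: wp_eq[abs_def])
    moreover have "u \<notin> L" using ball_gap[of u] u by auto
    ultimately show ?thesis using has_derivative_wp DERIV_unique by blast
  qed
  have w2: "deriv wp' u = 6 / u ^ 4 + deriv (deriv wp_regular) u" if u: "u \<in> ?B - {0}" for u
  proof -
    have "(deriv wp_regular has_field_derivative deriv (deriv wp_regular) u) (at u)"
      using holomorphic_derivI[OF hol', of u] u by auto
    hence "((\<lambda>u. - 2 / u ^ 3 + deriv wp_regular u) has_field_derivative (0 * u ^ 3 - (- 2) * (3 * u\<^sup>2)) / (u ^ 3 * u ^ 3) + deriv (deriv wp_regular) u) (at u)"
      using u by (intro DERIV_add DERIV_divide) (auto intro!: derivative_eq_intros)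
    moreover have "(0 * u ^ 3 - (- 2) * (3 * u\<^sup>2)) / (u ^ 3 * u ^ 3) = 6 / u ^ 4"
      using u by (simp add: power2_eq_square power3_eq_cube power4_eq_xxxx divide_simps)
    ultimately have "((\<lambda>u. - 2 / u ^ 3 + deriv wp_regular u) has_field_derivative 6 / u ^ 4 + deriv (deriv wp_regular) u) (at u)" by simp
    hence "(wp' has_field_derivative 6 / u ^ 4 + deriv (deriv wp_regular) u) (at u)"
      by (rule has_field_derivative_transform_within_open[OF _ op u]) (simp add: w1)
    thus ?thesis by (rule DERIV_imp_deriv)
  qed
  let ?f = "\<lambda>u. deriv wp' u - 6 * (wp u)\<^sup>2"
  let ?h = "\<lambda>u. deriv (deriv wp_regular) u - 12 * q u - 6 * (wp_regular u)\<^sup>2"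
  have f1: "?f holomorphic_on - L"
    by (intro holomorphic_intros holomorphic_deriv wp'_holomorphic wp_holomorphic open_Compl_L)
  have f2: "?f (u + v) = ?f u" if "u \<notin> L" "v \<in> L" for u v
    using deriv_periodic[OF wp'_holomorphic wp'_periodic that] wp_periodic[OF that] by simp
  have f3: "?h holomorphic_on ?B"
    by (intro holomorphic_intros holomorphic_deriv hol' hol q) auto
  have f4: "?f u = ?h u" if "u \<in> ?B" "u \<notin> L" for u
  proof -
    have u: "u \<in> ?B - {0}" "u \<noteq> 0" using that by auto
    have "6 * (wp u)\<^sup>2 = 6 / u ^ 4 + 12 * (wp_regular u / u\<^sup>2) + 6 * (wp_regular u)\<^sup>2"
      unfolding wp_eq using u(2) by (simp add: power2_eq_square power4_eq_xxxx field_simps)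
    also have "wp_regular u / u\<^sup>2 = q u" using q(2)[OF that(1)] u(2) by simp
    finally show ?thesis using w2[OF u(1)] by simp
  qed
  obtain c where c: "\<And>u. u \<notin> L \<Longrightarrow> ?f u = c"
    using elliptic_constant[OF f1 f2 f3 gap_pos f4] by blast
  show thesis
  proof (rule that[of c])
    fix u assume "u \<notin> L"
    from c[OF this] show "deriv wp' u = 6 * (wp u)\<^sup>2 + c" by (simp add: algebra_simps)
  qed
qed

text \<open>Multiply the second-order equation by 2 \<open>wp'\<close> and integrate; the complement
  of the countable lattice is connected, so a single constant of integration results.\<close>

lemma wp_differential_equation:
  obtains \<gamma>2 \<gamma>3 where "\<And>u. u \<notin> L \<Longrightarrow> (wp' u)\<^sup>2 = 4 * (wp u) ^ 3 - \<gamma>2 * wp u - \<gamma>3"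
proof -
  obtain c where c: "\<And>u. u \<notin> L \<Longrightarrow> deriv wp' u = 6 * (wp u)\<^sup>2 + c" using wp_second_derivative by metis
  let ?T = "\<lambda>u. (wp' u)\<^sup>2 - 4 * (wp u) ^ 3 - 2 * c * wp u"
  have "(?T has_field_derivative 0) (at u)" if u: "u \<notin> L" for u
    using c[OF u]
    by (auto intro!: derivative_eq_intros has_derivative_wp[OF u] has_derivative_wp'[OF u] simp: power2_eq_square algebra_simps)
  moreover from this have "continuous_on (- L) ?T"
    by (intro continuous_at_imp_continuous_on ballI) (meson ComplD DERIV_isCont)
  ultimately obtain c' where "\<And>u. u \<in> - L \<Longrightarrow> ?T u = c'"
    using DERIV_zero_connected_constant[OF connected_Compl_L[OF countable_L] open_Compl_L finite.emptyI, of ?T] by auto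
  hence "(wp' u)\<^sup>2 = 4 * (wp u) ^ 3 - (- 2 * c) * wp u - (- c')" if "u \<notin> L" for u
    using that by (simp add: algebra_simps)
  thus thesis using that by blast
qed

lemma isCont_wp_regular_0: "isCont wp_regular 0"
  using field_differentiable_imp_continuous_at[OF wp_regular_differentiable[of 0]] by simp

text \<open>If c were omitted, 1 / (wp - c) would be elliptic and extend holomorphically by 0 to the
  lattice points, hence be identically 0.\<close>

lemma wp_surj:
  obtains u where "u \<notin> L" "wp u = c"
proof (rule ccontr)
  assume "\<not> thesis"
  hence nz: "wp u - c \<noteq> 0" if "u \<notin> L" for u using that \<open>\<And>u. u \<notin> L \<Longrightarrow> wp u = c \<Longrightarrow> thesis\<close> by auto
  let ?k = "\<lambda>u. 1 + u\<^sup>2 * (wp_regular u - c)"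
  have hol: "wp_regular holomorphic_on ball 0 gap"
    by (rule holomorphic_on_subset[OF wp_regular_holomorphic]) (use ball_gap in auto)
  have "isCont ?k 0" by (intro continuous_intros isCont_wp_regular_0)
  then obtain d0 where d0: "d0 > 0" "\<And>u. dist 0 u < d0 \<Longrightarrow> ?k u \<noteq> 0"
    using continuous_at_avoid[of 0 ?k 0] by auto
  define d where "d = min d0 gap"
  have d: "d > 0" using d0 gap_pos by (simp add: d_def)
  have kd: "?k u \<noteq> 0" if "u \<in> ball 0 d" for u using that d0(2)[of u] by (simp add: d_def)
  let ?f = "\<lambda>u. 1 / (wp u - c)"
  let ?h = "\<lambda>u. u\<^sup>2 / ?k u"
  have h: "?h holomorphic_on ball 0 d"
    by (intro holomorphic_intros holomorphic_on_subset[OF hol]) (use kd in \<open>auto simp: d_def\<close>)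
  have fh: "?f u = ?h u" if "u \<in> ball 0 d" "u \<notin> L" for u
  proof -
    have "u \<noteq> 0" using that by auto
    moreover from this have "wp u - c = ?k u / u\<^sup>2" by (simp add: wp_eq field_simps)
    ultimately show ?thesis using kd[OF that(1)] by simp
  qed
  have f1: "?f holomorphic_on - L"
    by (intro holomorphic_intros wp_holomorphic) (use nz in auto)
  have f2: "?f (u + v) = ?f u" if "u \<notin> L" "v \<in> L" for u v using wp_periodic[OF that] by simp
  obtain C where C: "\<And>u. u \<notin> L \<Longrightarrow> ?f u = C"
    using elliptic_constant[OF f1 f2 h d fh] by blast
  have "continuous_on (ball 0 d) ?h" by (rule holomorphic_on_imp_continuous_on[OF h])
  hence "isCont ?h 0" using d by (simp add: continuous_on_eq_continuous_at)
  hence "?h \<midarrow>0\<rightarrow> 0" by (simp add: isCont_def)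
  moreover have "eventually (\<lambda>u. ?h u = C) (at 0)"
    unfolding eventually_at
  proof (intro exI[of _ d] conjI ballI impI d)
    fix u :: complex assume u: "u \<noteq> 0 \<and> dist u 0 < d"
    hence "u \<in> ball 0 d" "u \<in> ball 0 gap" by (auto simp: d_def)
    moreover from this have "u \<notin> L" using ball_gap[of u] u by simp
    ultimately show "?h u = C" using fh[of u] C[of u] by simp
  qed
  ultimately have "C = 0"
    using tendsto_eventually[of ?h C "at 0"] tendsto_unique[of "at (0::complex)" ?h 0 C] by auto
  moreover have "\<not> - L = {}" using countable_L uncountable_UNIV_complex by (metis Compl_empty_eq double_compl)
  then obtain u where "u \<notin> L" by auto
  ultimately show False using C[of u] nz[of u] by simp
qed

lemma wp_image:
  assumes \<gamma>: "\<And>u. u \<notin> L \<Longrightarrow> (wp' u)\<^sup>2 = 4 * (wp u) ^ 3 - \<gamma>2 * wp u - \<gamma>3"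
  shows "(\<lambda>u. (wp u, wp' u)) ` (- L) = {(x, y). y\<^sup>2 = 4 * x ^ 3 - \<gamma>2 * x - \<gamma>3}"
proof (intro equalityI subsetI)
  fix p assume "p \<in> (\<lambda>u. (wp u, wp' u)) ` (- L)"
  thus "p \<in> {(x, y). y\<^sup>2 = 4 * x ^ 3 - \<gamma>2 * x - \<gamma>3}" using \<gamma> by auto
next
  fix p assume "p \<in> {(x, y). y\<^sup>2 = 4 * x ^ 3 - \<gamma>2 * x - \<gamma>3}"
  then obtain x y where p: "p = (x, y)" "y\<^sup>2 = 4 * x ^ 3 - \<gamma>2 * x - \<gamma>3" by auto
  obtain u where u: "u \<notin> L" "wp u = x" by (rule wp_surj)
  hence "y\<^sup>2 = (wp' u)\<^sup>2" using \<gamma> p by simp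
  hence "y = wp' u \<or> y = wp' (- u)" using wp'_minus[OF u(1)] by (simp add: power2_eq_iff)
  thus "p \<in> (\<lambda>u. (wp u, wp' u)) ` (- L)"
  proof
    assume "y = wp' u"
    thus ?thesis using u p by auto
  next
    assume "y = wp' (- u)"
    thus ?thesis using u p by (intro image_eqI[of _ _ "- u"]) (auto simp: wp_minus L_uminus)
  qed
qed

text \<open>Two translates of \<open>\<wp>\<close> with the same value and derivative at a point solve the same second
  order differential equation, so they coincide.\<close>

lemma wp_inj:
  assumes u: "u \<notin> L" and v: "v \<notin> L" and eq: "wp u = wp v" "wp' u = wp' v"
  shows "u - v \<in> L"
proof (rule ccontr)
  assume uv: "u - v \<notin> L"
  obtain c where c: "\<And>u. u \<notin> L \<Longrightarrow> deriv wp' u = 6 * (wp u)\<^sup>2 + c" using wp_second_derivative by metis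
  define S where "S = - ((\<lambda>w. w - u) ` L \<union> (\<lambda>w. w - v) ` L)"
  have S: "z \<in> S \<longleftrightarrow> u + z \<notin> L \<and> v + z \<notin> L" for z
    unfolding S_def by (auto simp: image_iff algebra_simps)
  have opS: "open S" 
  proof -
    have "S = (\<lambda>z. u + z) -` (- L) \<inter> (\<lambda>z. v + z) -` (- L)" using S by auto
    moreover have "open ((\<lambda>z. w + z) -` (- L))" for w
      by (rule open_vimage[OF open_Compl_L]) (intro continuous_intros)
    ultimately show ?thesis by auto
  qed
  have conS: "connected S" unfolding S_def by (rule connected_Compl_L) (auto intro: countable_L)
  have S0: "0 \<in> S" using u v S by simp
  define D where "D z = wp (u + z) - wp (v + z)" for z
  define D' where "D' z = wp' (u + z) - wp' (v + z)" for z
  define C where "C z = 6 * (wp (u + z) + wp (v + z))" for z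
  have dshift: "((\<lambda>z. wp (w + z)) has_field_derivative wp' (w + z)) (at z)"
    "((\<lambda>z. wp' (w + z)) has_field_derivative deriv wp' (w + z)) (at z)" if "w + z \<notin> L" for w z
  proof -
    have g: "((\<lambda>z. w + z) has_field_derivative 1) (at z)" by (auto intro!: derivative_eq_intros)
    show "((\<lambda>z. wp (w + z)) has_field_derivative wp' (w + z)) (at z)"
      using DERIV_chain2[where g = "\<lambda>z. w + z", OF has_derivative_wp[OF that] g] by simp
    show "((\<lambda>z. wp' (w + z)) has_field_derivative deriv wp' (w + z)) (at z)"
      using DERIV_chain2[where g = "\<lambda>z. w + z", OF has_derivative_wp'[OF that] g] by simp
  qed
  have dD: "(D has_field_derivative D' z) (at z)" if "z \<in> S" for z
    unfolding D_def[abs_def] D'_def using that S by (intro DERIV_diff dshift) auto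
  have dD': "(D' has_field_derivative C z * D z) (at z)" if "z \<in> S" for z
  proof -
    have "(D' has_field_derivative deriv wp' (u + z) - deriv wp' (v + z)) (at z)"
      unfolding D'_def[abs_def] using that S by (intro DERIV_diff dshift) auto
    also have "deriv wp' (u + z) - deriv wp' (v + z) = C z * D z"
      using c that S unfolding C_def D_def by (simp add: power2_eq_square algebra_simps)
    finally show ?thesis .
  qed
  have holD: "D holomorphic_on S" unfolding holomorphic_on_open[OF opS] using dD by blast
  have holC: "C holomorphic_on S"
    unfolding holomorphic_on_open[OF opS] C_def[abs_def]
  proof (intro ballI exI)
    fix z assume "z \<in> S"
    thus "((\<lambda>z. 6 * (wp (u + z) + wp (v + z))) has_field_derivative 6 * (wp' (u + z) + wp' (v + z))) (at z)"
      using S by (intro DERIV_cmult DERIV_add dshift) auto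
  qed
  \<comment> \<open>D'' = C D and Leibniz' rule propagate the vanishing of D and D' at 0 to all
    higher derivatives.\<close>
  have zero: "(deriv ^^ n) D 0 = 0" for n
  proof (induction n rule: less_induct)
    case (less n)
    consider "n = 0" | "n = 1" | k where "n = Suc (Suc k)" by (metis One_nat_def not0_implies_Suc)
    thus ?case
    proof cases
      case 1 thus ?thesis using eq by (simp add: D_def)
    next
      case 2
      thus ?thesis using DERIV_imp_deriv[OF dD[OF S0]] eq by (simp add: D'_def)
    next
      case 3
      have "(deriv ^^ n) D 0 = (deriv ^^ k) (deriv (deriv D)) 0" unfolding 3 by (simp only: funpow_Suc_right o_apply)
      also have "\<dots> = (deriv ^^ k) (\<lambda>z. C z * D z) 0"
      proof (rule higher_deriv_transform_within_open[OF _ _ opS S0])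
        show "deriv (deriv D) holomorphic_on S" by (intro holomorphic_deriv holD opS)
        show "(\<lambda>z. C z * D z) holomorphic_on S" by (intro holomorphic_intros holC holD)
        fix z assume z: "z \<in> S"
        have "(deriv D has_field_derivative C z * D z) (at z)"
          by (rule has_field_derivative_transform_within_open[OF dD'[OF z] opS z]) (use dD DERIV_imp_deriv in metis)
        thus "deriv (deriv D) z = C z * D z" by (rule DERIV_imp_deriv)
      qed
      also have "\<dots> = (\<Sum>i = 0..k. of_nat (k choose i) * (deriv ^^ i) C 0 * (deriv ^^ (k - i)) D 0)"
        by (rule higher_deriv_mult[OF holC holD opS S0])
      also have "\<dots> = 0" using less 3 by (intro sum.neutral) auto
      finally show ?thesis .
    qed
  qed
  have D0: "D z = 0" if "z \<in> S" for z
    by (rule holomorphic_fun_eq_0_on_connected[OF holD opS conS zero S0 that])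
  have vu: "v - u \<notin> L" using uv L_uminus[of "u - v"] by simp
  \<comment> \<open>The pole at 0 now gives the contradiction: w^2 wp(w) tends to 1, whereas the
    translate by v - u is regular at 0 because v - u is not a period.\<close>
  have lim1: "(\<lambda>w. w\<^sup>2 * wp w) \<midarrow>0\<rightarrow> 1"
  proof -
    have "isCont (\<lambda>w. 1 + w\<^sup>2 * wp_regular w) 0"
      by (intro continuous_intros isCont_wp_regular_0)
    hence "(\<lambda>w. 1 + w\<^sup>2 * wp_regular w) \<midarrow>0\<rightarrow> 1" by (simp add: isCont_def)
    moreover have "eventually (\<lambda>w. 1 + w\<^sup>2 * wp_regular w = w\<^sup>2 * wp w) (at 0)"
      unfolding wp_eq eventually_at_filter by (intro always_eventually) (auto simp: algebra_simps)
    ultimately show ?thesis by (rule Lim_transform_eventually)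
  qed
  have "isCont (\<lambda>w. wp (v - u + w)) 0"
    using DERIV_isCont[OF dshift(1)[of "v - u" 0]] vu by simp
  hence "(\<lambda>w. w\<^sup>2 * wp (v - u + w)) \<midarrow>0\<rightarrow> 0\<^sup>2 * wp (v - u)"
    unfolding isCont_def by (intro tendsto_intros) auto
  moreover have "eventually (\<lambda>w. w\<^sup>2 * wp (v - u + w) = w\<^sup>2 * wp w) (at 0)"
  proof -
    have "open ((\<lambda>w. v - u + w) -` (- L))"
      by (rule open_vimage[OF open_Compl_L]) (intro continuous_intros)
    hence "open ((\<lambda>w. v - u + w) -` (- L) \<inter> ball 0 gap)" by auto
    moreover have "0 \<in> (\<lambda>w. v - u + w) -` (- L) \<inter> ball 0 gap" using vu gap_pos by auto
    ultimately have "eventually (\<lambda>w. w \<in> (\<lambda>w. v - u + w) -` (- L) \<inter> ball 0 gap) (nhds 0)"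
      by (rule eventually_nhds_in_open)
    thus ?thesis unfolding eventually_at_filter
    proof eventually_elim
      case (elim w)
      show ?case
      proof (intro impI)
        assume "w \<noteq> 0"
        hence "w \<notin> L" using elim ball_gap[of w] by auto
        hence "w - u \<in> S" using elim S[of "w - u"] by (simp add: algebra_simps)
        from D0[OF this] show "w\<^sup>2 * wp (v - u + w) = w\<^sup>2 * wp w"
          by (simp add: D_def algebra_simps)
      qed
    qed
  qed
  ultimately have "(\<lambda>w. w\<^sup>2 * wp w) \<midarrow>0\<rightarrow> 0\<^sup>2 * wp (v - u)" by (rule Lim_transform_eventually)
  from tendsto_unique[OF _ this lim1] show False by simp
qed

end

section \<open>Values at the division points\<close>

context rectangular_lattice
begin

text \<open>Half the column spacing after scaling by \<open>nu\<close>: seen from \<omega>/2 the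
  columns sit at the odd, seen from i \<eta>/2 at the even multiples of \<open>par\<close>.\<close>

definition par :: real where "par = nu * \<omega> / 2"

lemma par_pos: "par > 0"
  using nu_pos \<omega>_pos by (simp add: par_def)

lemma not_in_L_Re: "(\<And>m::int. Re z \<noteq> of_int m * \<omega>) \<Longrightarrow> z \<notin> L"
  unfolding L_eq by force

lemma not_in_L_Im: "(\<And>m::int. Im z \<noteq> of_int m * \<eta>) \<Longrightarrow> z \<notin> L"
  unfolding L_eq by force

lemma fraction_not_int: "0 < c \<Longrightarrow> c < 1 \<Longrightarrow> p > 0 \<Longrightarrow> c * p \<noteq> of_int m * (p::real)"
proof
  assume "0 < c" "c < 1" "p > 0" "c * p = of_int m * p"
  hence "c = of_int m" by simp
  thus False using \<open>0 < c\<close> \<open>c < 1\<close> by simp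
qed

lemma real_not_in_L: "0 < s \<Longrightarrow> s < \<omega> \<Longrightarrow> of_real s \<notin> L"
  using fraction_not_int[of "s / \<omega>" \<omega>] \<omega>_pos by (intro not_in_L_Re) auto

lemma half_periods_not_in_L:
  "of_real (\<omega> / 2) \<notin> L" "\<i> * of_real (\<eta> / 2) \<notin> L" "of_real (\<omega> / 2) + \<i> * of_real (\<eta> / 2) \<notin> L"
proof -
  have h: "p / 2 \<noteq> of_int m * p" if "p > 0" for m :: int and p :: real
    using fraction_not_int[of "1/2" p m] that by simp
  show "of_real (\<omega> / 2) \<notin> L" by (rule not_in_L_Re) (simp only: Re_complex_of_real h[OF \<omega>_pos] not_False_eq_True)
  show "\<i> * of_real (\<eta> / 2) \<notin> L"
  proof (rule not_in_L_Im)
    have "Im (\<i> * of_real (\<eta> / 2)) = \<eta> / 2" by simp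
    thus "Im (\<i> * of_real (\<eta> / 2)) \<noteq> of_int m * \<eta>" for m using h[OF \<eta>_pos] by metis
  qed
  show "of_real (\<omega> / 2) + \<i> * of_real (\<eta> / 2) \<notin> L"
  proof (rule not_in_L_Re)
    have "Re (of_real (\<omega> / 2) + \<i> * of_real (\<eta> / 2)) = \<omega> / 2" by simp
    thus "Re (of_real (\<omega> / 2) + \<i> * of_real (\<eta> / 2)) \<noteq> of_int m * \<omega>" for m using h[OF \<omega>_pos] by metis
  qed
qed

lemma bij_betw_one_minus: "bij_betw (\<lambda>m::int. 1 - 2 * m) UNIV (parity_class 1)"
  by (rule bij_betwI[of _ _ _ "\<lambda>n. (1 - n) div 2"]) (auto simp: parity_class_def)

lemma bij_betw_minus_double: "bij_betw (\<lambda>m::int. - 2 * m) UNIV (parity_class 0)"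
  by (rule bij_betwI[of _ _ _ "\<lambda>n. (- n) div 2"]) (auto simp: parity_class_def)

lemma nu_\<eta>: "complex_of_real nu * (\<i> * of_real (\<eta> / 2)) = \<i> * of_real (pi / 2)"
proof -
  have "nu * (\<eta> / 2) = pi / 2" using \<eta>_pos by (simp add: nu_def)
  hence "complex_of_real nu * of_real (\<eta> / 2) = of_real (pi / 2)" by (metis of_real_mult)
  thus ?thesis by (simp only: mult.left_commute)
qed

lemma sinh_shift: "sinh (of_real r + \<i> * of_real (pi / 2)) = \<i> * complex_of_real (cosh r)"
proof -
  have "sinh (of_real r + \<i> * of_real (pi / 2)) = sinh (of_real r) * cosh (\<i> * of_real (pi / 2)) + cosh (of_real r) * sinh (\<i> * complex_of_real (pi / 2))"
    by (rule sinh_add)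
  also have "cosh (\<i> * complex_of_real (pi / 2)) = cos (of_real (pi / 2))"
    by (simp add: cosh_conv_cos del: of_real_divide)
  also have "\<dots> = 0" by (simp only: cos_of_real cos_pi_half of_real_0)
  also have "sinh (\<i> * complex_of_real (pi / 2)) = \<i> * sin (of_real (pi / 2))"
    by (simp add: sinh_conv_sin del: of_real_divide)
  also have "sin (complex_of_real (pi / 2)) = 1" by (simp only: sin_of_real sin_pi_half of_real_1)
  finally show ?thesis by (simp add: cosh_complex_of_real)
qed

lemma real_column_term:
  "(of_real nu / sinh (complex_of_real r))\<^sup>2 = of_real (nu\<^sup>2 * (csch r)\<^sup>2)"
  by (simp add: sinh_complex_of_real csch_def power_divide)

lemma shifted_column_term:
  "(of_real nu / sinh (complex_of_real r + \<i> * of_real (pi / 2)))\<^sup>2 = of_real (- (nu\<^sup>2 * (sech r)\<^sup>2))"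
  unfolding sinh_shift by (simp add: sech_def power_divide power_mult_distrib)

lemma infsum_real_column:
  "(\<Sum>\<^sub>\<infinity>m. complex_of_real (f m)) = of_real (\<Sum>\<^sub>\<infinity>m. f m)" if "f summable_on UNIV"
  by (rule infsumI) (rule has_sum_of_real[OF has_sum_infsum[OF that]])

text \<open>Scaling by \<open>nu\<close> turns the shift i \<eta>/2 into i pi/2 and thereby sinh
  into i cosh, so cosecants become secants with a minus sign. One \<kappa> serves all the values,
  which makes it cancel in their differences.\<close>

lemma wp_half_periods:
  obtains \<kappa> where
    "wp (of_real (\<omega> / 2)) = of_real (nu\<^sup>2 * (\<Sum>\<^sub>\<infinity>n\<in>parity_class 1. (csch (of_int n * par))\<^sup>2)) - \<kappa>"
    "wp (\<i> * of_real (\<eta> / 2)) = of_real (- (nu\<^sup>2 * (\<Sum>\<^sub>\<infinity>n\<in>parity_class 0. (sech (of_int n * par))\<^sup>2))) - \<kappa>"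
    "wp (of_real (\<omega> / 2) + \<i> * of_real (\<eta> / 2)) = of_real (- (nu\<^sup>2 * (\<Sum>\<^sub>\<infinity>n\<in>parity_class 1. (sech (of_int n * par))\<^sup>2))) - \<kappa>"
    "\<And>s. 0 < s \<Longrightarrow> s < \<omega> \<Longrightarrow> wp (of_real s) = of_real (\<Sum>\<^sub>\<infinity>m::int. nu\<^sup>2 * (csch (nu * (s - of_int m * \<omega>)))\<^sup>2) - \<kappa>"
proof -
  obtain \<kappa> where \<kappa>: "\<And>u. u \<notin> L \<Longrightarrow> wp u = (\<Sum>\<^sub>\<infinity>m::int. (of_real nu / sinh (of_real nu * (u - of_int m * of_real \<omega>)))\<^sup>2) - \<kappa>"
    "\<And>u. u \<notin> L \<Longrightarrow> (\<lambda>m::int. (of_real nu / sinh (of_real nu * (u - of_int m * of_real \<omega>)))\<^sup>2) summable_on UNIV"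
    using wp_column by blast
  show thesis
  proof (rule that[of \<kappa>])
    have a: "of_real nu * (of_real s - of_int m * of_real \<omega>) = complex_of_real (nu * (s - of_int m * \<omega>))" for s and m :: int by simp
    show R: "wp (of_real s) = of_real (\<Sum>\<^sub>\<infinity>m::int. nu\<^sup>2 * (csch (nu * (s - of_int m * \<omega>)))\<^sup>2) - \<kappa>" if "0 < s" "s < \<omega>" for s
    proof -
      have nl: "of_real s \<notin> L" using that by (rule real_not_in_L)
      have "(\<lambda>m::int. complex_of_real (nu\<^sup>2 * (csch (nu * (s - of_int m * \<omega>)))\<^sup>2)) summable_on UNIV"
        using \<kappa>(2)[OF nl] unfolding a real_column_term .
      from summable_on_Re[OF this] have "(\<lambda>m::int. nu\<^sup>2 * (csch (nu * (s - of_int m * \<omega>)))\<^sup>2) summable_on UNIV" by (simp only: Re_complex_of_real)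
      thus ?thesis unfolding \<kappa>(1)[OF nl] a real_column_term by (simp only: infsum_real_column)
    qed
    have "(\<Sum>\<^sub>\<infinity>m::int. nu\<^sup>2 * (csch (nu * (\<omega> / 2 - of_int m * \<omega>)))\<^sup>2) = (\<Sum>\<^sub>\<infinity>m::int. nu\<^sup>2 * (csch (of_int (1 - 2 * m) * par))\<^sup>2)"
    proof -
      have "nu * (\<omega> / 2 - of_int m * \<omega>) = of_int (1 - 2 * m) * par" for m :: int
        by (simp add: par_def field_simps)
      thus ?thesis by (simp only:)
    qed
    also have "\<dots> = (\<Sum>\<^sub>\<infinity>n\<in>parity_class 1. nu\<^sup>2 * (csch (of_int n * par))\<^sup>2)"
      by (rule infsum_reindex_bij_betw[OF bij_betw_one_minus])
    also have "\<dots> = nu\<^sup>2 * (\<Sum>\<^sub>\<infinity>n\<in>parity_class 1. (csch (of_int n * par))\<^sup>2)" by (rule infsum_cmult_right')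
    finally show "wp (of_real (\<omega> / 2)) = of_real (nu\<^sup>2 * (\<Sum>\<^sub>\<infinity>n\<in>parity_class 1. (csch (of_int n * par))\<^sup>2)) - \<kappa>"
      using R[of "\<omega> / 2"] \<omega>_pos by simp
    have b: "of_real nu * (\<i> * of_real (\<eta> / 2) - of_int m * of_real \<omega>) = complex_of_real (of_int (- 2 * m) * par) + \<i> * of_real (pi / 2)" for m :: int
    proof -
      have "of_real nu * (\<i> * of_real (\<eta> / 2) - of_int m * of_real \<omega>) = - complex_of_real (of_int m * (nu * \<omega>)) + complex_of_real nu * (\<i> * of_real (\<eta> / 2))"
        by (simp add: algebra_simps)
      also have "- complex_of_real (of_int m * (nu * \<omega>)) = complex_of_real (of_int (- 2 * m) * par)"
        by (simp add: par_def)
      finally show ?thesis unfolding nu_\<eta> .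
    qed
    have se: "(\<lambda>m::int. - (nu\<^sup>2 * (sech (of_int (- 2 * m) * par))\<^sup>2)) summable_on UNIV"
      using summable_on_reindex_bij_betw[OF bij_betw_minus_double, of "\<lambda>n. - (nu\<^sup>2 * (sech (of_int n * par))\<^sup>2)"]
        summable_on_sech_square[OF par_pos, of "parity_class 0"]
      by (simp only: summable_on_uminus summable_on_cmult_right)
    have "(\<Sum>\<^sub>\<infinity>m::int. - (nu\<^sup>2 * (sech (of_int (- 2 * m) * par))\<^sup>2)) = (\<Sum>\<^sub>\<infinity>n\<in>parity_class 0. - (nu\<^sup>2 * (sech (of_int n * par))\<^sup>2))"
      by (rule infsum_reindex_bij_betw[OF bij_betw_minus_double])
    also have "\<dots> = - (nu\<^sup>2 * (\<Sum>\<^sub>\<infinity>n\<in>parity_class 0. (sech (of_int n * par))\<^sup>2))"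
      by (simp only: infsum_uminus infsum_cmult_right')
    finally have "(\<Sum>\<^sub>\<infinity>m::int. complex_of_real (- (nu\<^sup>2 * (sech (of_int (- 2 * m) * par))\<^sup>2))) =
        of_real (- (nu\<^sup>2 * (\<Sum>\<^sub>\<infinity>n\<in>parity_class 0. (sech (of_int n * par))\<^sup>2)))"
      using infsum_real_column[OF se] by (simp only:)
    thus "wp (\<i> * of_real (\<eta> / 2)) = of_real (- (nu\<^sup>2 * (\<Sum>\<^sub>\<infinity>n\<in>parity_class 0. (sech (of_int n * par))\<^sup>2))) - \<kappa>"
      unfolding \<kappa>(1)[OF half_periods_not_in_L(2)] b shifted_column_term by (simp only:)
    have c: "of_real nu * (of_real (\<omega> / 2) + \<i> * of_real (\<eta> / 2) - of_int m * of_real \<omega>) = complex_of_real (of_int (1 - 2 * m) * par) + \<i> * of_real (pi / 2)" for m :: int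
    proof -
      have "of_real nu * (of_real (\<omega> / 2) + \<i> * of_real (\<eta> / 2) - of_int m * of_real \<omega>) = complex_of_real (nu * (\<omega> / 2 - of_int m * \<omega>)) + complex_of_real nu * (\<i> * of_real (\<eta> / 2))"
        by (simp add: algebra_simps)
      also have "nu * (\<omega> / 2 - of_int m * \<omega>) = of_int (1 - 2 * m) * par"
        by (simp add: par_def field_simps)
      finally show ?thesis unfolding nu_\<eta> .
    qed
    have so: "(\<lambda>m::int. - (nu\<^sup>2 * (sech (of_int (1 - 2 * m) * par))\<^sup>2)) summable_on UNIV"
      using summable_on_reindex_bij_betw[OF bij_betw_one_minus, of "\<lambda>n. - (nu\<^sup>2 * (sech (of_int n * par))\<^sup>2)"]
        summable_on_sech_square[OF par_pos, of "parity_class 1"]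
      by (simp only: summable_on_uminus summable_on_cmult_right)
    have "(\<Sum>\<^sub>\<infinity>m::int. - (nu\<^sup>2 * (sech (of_int (1 - 2 * m) * par))\<^sup>2)) = (\<Sum>\<^sub>\<infinity>n\<in>parity_class 1. - (nu\<^sup>2 * (sech (of_int n * par))\<^sup>2))"
      by (rule infsum_reindex_bij_betw[OF bij_betw_one_minus])
    also have "\<dots> = - (nu\<^sup>2 * (\<Sum>\<^sub>\<infinity>n\<in>parity_class 1. (sech (of_int n * par))\<^sup>2))"
      by (simp only: infsum_uminus infsum_cmult_right')
    finally have "(\<Sum>\<^sub>\<infinity>m::int. complex_of_real (- (nu\<^sup>2 * (sech (of_int (1 - 2 * m) * par))\<^sup>2))) =
        of_real (- (nu\<^sup>2 * (\<Sum>\<^sub>\<infinity>n\<in>parity_class 1. (sech (of_int n * par))\<^sup>2)))"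
      using infsum_real_column[OF so] by (simp only:)
    thus "wp (of_real (\<omega> / 2) + \<i> * of_real (\<eta> / 2)) = of_real (- (nu\<^sup>2 * (\<Sum>\<^sub>\<infinity>n\<in>parity_class 1. (sech (of_int n * par))\<^sup>2))) - \<kappa>"
      unfolding \<kappa>(1)[OF half_periods_not_in_L(3)] c shifted_column_term by (simp only:)
  qed
qed

lemma wp_half_period_differences:
  "wp (of_real (\<omega> / 2)) - wp (\<i> * of_real (\<eta> / 2)) = of_real (nu\<^sup>2 * (sech_even par)\<^sup>2)"
  "wp (of_real (\<omega> / 2)) - wp (of_real (\<omega> / 2) + \<i> * of_real (\<eta> / 2)) = of_real (nu\<^sup>2 * (sech_odd par)\<^sup>2)"
proof -
  obtain \<kappa> where k: "wp (of_real (\<omega> / 2)) = of_real (nu\<^sup>2 * (\<Sum>\<^sub>\<infinity>n\<in>parity_class 1. (csch (of_int n * par))\<^sup>2)) - \<kappa>"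
    "wp (\<i> * of_real (\<eta> / 2)) = of_real (- (nu\<^sup>2 * (\<Sum>\<^sub>\<infinity>n\<in>parity_class 0. (sech (of_int n * par))\<^sup>2))) - \<kappa>"
    "wp (of_real (\<omega> / 2) + \<i> * of_real (\<eta> / 2)) = of_real (- (nu\<^sup>2 * (\<Sum>\<^sub>\<infinity>n\<in>parity_class 1. (sech (of_int n * par))\<^sup>2))) - \<kappa>"
    using wp_half_periods by metis
  show "wp (of_real (\<omega> / 2)) - wp (\<i> * of_real (\<eta> / 2)) = of_real (nu\<^sup>2 * (sech_even par)\<^sup>2)"
    unfolding k sech_even_square[OF par_pos] by (simp add: algebra_simps)
  show "wp (of_real (\<omega> / 2)) - wp (of_real (\<omega> / 2) + \<i> * of_real (\<eta> / 2)) = of_real (nu\<^sup>2 * (sech_odd par)\<^sup>2)"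
    unfolding k sech_odd_square[OF par_pos] by (simp add: algebra_simps)
qed

text \<open>At \<omega>/4 the columns lie at (1 - 4 m) par/2, one from each pair of opposite odd
  multiples of par/2. Hence the cosecant sum is half of that over all odd multiples, which
  \<open>sech_odd_square'\<close> evaluates.\<close>

lemma wp_quarter_period:
  "wp (of_real (\<omega> / 4)) - wp (of_real (\<omega> / 2)) = of_real (nu\<^sup>2 * (sech_odd (par / 2))\<^sup>2 / 4)"
proof -
  obtain \<kappa> where k: "wp (of_real (\<omega> / 2)) = of_real (nu\<^sup>2 * (\<Sum>\<^sub>\<infinity>n\<in>parity_class 1. (csch (of_int n * par))\<^sup>2)) - \<kappa>"
    "\<And>s. 0 < s \<Longrightarrow> s < \<omega> \<Longrightarrow> wp (of_real s) = of_real (\<Sum>\<^sub>\<infinity>m::int. nu\<^sup>2 * (csch (nu * (s - of_int m * \<omega>)))\<^sup>2) - \<kappa>"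
    using wp_half_periods by metis
  define x where "x = par / 2"
  have x: "x > 0" using par_pos by (simp add: x_def)
  let ?c = "\<lambda>n::int. (csch (of_int n * x))\<^sup>2"
  have s: "?c summable_on A" for A by (rule summable_on_csch_square[OF x])
  let ?A = "range (\<lambda>m::int. 1 - 4 * m)" and ?B = "range (\<lambda>m::int. - (1 - 4 * m))"
  have injs: "inj (\<lambda>m::int. 1 - 4 * m)" "inj (\<lambda>m::int. - (1 - 4 * m))" by (auto simp: inj_def)
  have AB: "?A \<inter> ?B = {}" "?A \<union> ?B = parity_class 1"
  proof -
    show "?A \<inter> ?B = {}" by auto presburger
    show "?A \<union> ?B = parity_class 1"
    proof (intro equalityI subsetI)
      fix n assume "n \<in> parity_class 1"
      hence "n mod 4 = 1 \<or> n mod 4 = 3" unfolding parity_class_def by simp presburger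
      thus "n \<in> ?A \<union> ?B"
      proof
        assume "n mod 4 = 1"
        hence "n = 1 - 4 * (- (n div 4))" by presburger
        thus ?thesis by blast
      next
        assume "n mod 4 = 3"
        hence "n = - (1 - 4 * (n div 4 + 1))" by presburger
        thus ?thesis by blast
      qed
    qed (auto simp: parity_class_def)
  qed
  define S where "S = (\<Sum>\<^sub>\<infinity>m::int. ?c (1 - 4 * m))"
  have "infsum ?c (parity_class 1) = infsum ?c ?A + infsum ?c ?B"
    unfolding AB(2)[symmetric] by (rule infsum_Un_disjoint[OF s s AB(1)])
  also have "infsum ?c ?A = S" by (subst infsum_reindex[OF injs(1)]) (simp add: S_def o_def)
  also have "infsum ?c ?B = (\<Sum>\<^sub>\<infinity>m::int. ?c (- (1 - 4 * m)))" by (subst infsum_reindex[OF injs(2)]) (simp add: o_def)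
  also have "\<dots> = S" unfolding S_def
  proof (intro infsum_cong)
    fix m :: int
    have "of_int (- (1 - 4 * m)) * x = - (of_int (1 - 4 * m) * x)" by (simp add: algebra_simps)
    thus "?c (- (1 - 4 * m)) = ?c (1 - 4 * m)" by (simp only: csch_minus power2_minus)
  qed
  finally have 1: "infsum ?c (parity_class 1) = 2 * S" by simp
  have s2: "(\<lambda>n. (csch (2 * (of_int n * x)))\<^sup>2) summable_on parity_class 1"
    using summable_on_csch_square[OF par_pos, of "parity_class 1"] by (simp add: x_def)
  have "(sech_odd x)\<^sup>2 = (\<Sum>\<^sub>\<infinity>n\<in>parity_class 1. 2 * ?c n + - (4 * (csch (2 * (of_int n * x)))\<^sup>2))"
    using sech_odd_square'[OF x] by simp
  also have "\<dots> = 2 * infsum ?c (parity_class 1) - 4 * (\<Sum>\<^sub>\<infinity>n\<in>parity_class 1. (csch (2 * (of_int n * x)))\<^sup>2)"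
    by (subst infsum_add[OF summable_on_cmult_right[OF s] summable_on_uminus[THEN iffD2, OF summable_on_cmult_right[OF s2]]])
       (simp only: infsum_uminus infsum_cmult_right' diff_conv_add_uminus)
  also have "(\<Sum>\<^sub>\<infinity>n\<in>parity_class 1. (csch (2 * (of_int n * x)))\<^sup>2) = (\<Sum>\<^sub>\<infinity>n\<in>parity_class 1. (csch (of_int n * par))\<^sup>2)"
    by (simp add: x_def)
  finally have 2: "(sech_odd x)\<^sup>2 / 4 = S - (\<Sum>\<^sub>\<infinity>n\<in>parity_class 1. (csch (of_int n * par))\<^sup>2)"
    unfolding 1 by simp
  have "(\<Sum>\<^sub>\<infinity>m::int. nu\<^sup>2 * (csch (nu * (\<omega> / 4 - of_int m * \<omega>)))\<^sup>2) = (\<Sum>\<^sub>\<infinity>m::int. nu\<^sup>2 * ?c (1 - 4 * m))"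
  proof -
    have "nu * (\<omega> / 4 - of_int m * \<omega>) = of_int (1 - 4 * m) * x" for m :: int
      by (simp add: x_def par_def field_simps)
    thus ?thesis by (simp only:)
  qed
  also have "\<dots> = nu\<^sup>2 * S" unfolding S_def by (rule infsum_cmult_right')
  finally have "wp (of_real (\<omega> / 4)) = of_real (nu\<^sup>2 * S) - \<kappa>"
    using k(2)[of "\<omega> / 4"] \<omega>_pos by simp
  moreover have "nu\<^sup>2 * (sech_odd (par / 2))\<^sup>2 / 4 = nu\<^sup>2 * S - nu\<^sup>2 * (\<Sum>\<^sub>\<infinity>n\<in>parity_class 1. (csch (of_int n * par))\<^sup>2)"
    using 2 unfolding x_def by (metis right_diff_distrib times_divide_eq_right)
  ultimately show ?thesis unfolding k(1) by simp
qed

text \<open>On the real axis \<open>wp\<close> is real up to a constant, so \<open>wp'\<close> is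
  real. A zero s in (0, \<omega>/2) would make 2 s a period by \<open>wp_inj\<close>; hence the sign
  is constant, and it is negative as \<open>wp\<close> is larger at \<omega>/4 than at
  \<omega>/2.\<close>

lemma wp'_quarter_period: "Im (wp' (of_real (\<omega> / 4))) = 0" "Re (wp' (of_real (\<omega> / 4))) < 0"
proof -
  obtain \<kappa> where k: "\<And>s. 0 < s \<Longrightarrow> s < \<omega> \<Longrightarrow> wp (of_real s) = of_real (\<Sum>\<^sub>\<infinity>m::int. nu\<^sup>2 * (csch (nu * (s - of_int m * \<omega>)))\<^sup>2) - \<kappa>"
    using wp_half_periods by metis
  have dv: "((\<lambda>s. wp (of_real s)) has_vector_derivative wp' (of_real s)) (at s)" if "0 < s" "s < \<omega>" for s
    using has_vector_derivative_real_field[OF has_derivative_wp[OF real_not_in_L[OF that]]] by simp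
  have dRe: "((\<lambda>s. Re (wp (of_real s))) has_real_derivative Re (wp' (of_real s))) (at s)"
    and dIm: "((\<lambda>s. Im (wp (of_real s))) has_real_derivative Im (wp' (of_real s))) (at s)" if "0 < s" "s < \<omega>" for s
    using has_field_derivative_Re[OF dv[OF that]] has_field_derivative_Im[OF dv[OF that]] by auto
  have im: "Im (wp' (of_real s)) = 0" if s: "0 < s" "s < \<omega>" for s
  proof -
    have "((\<lambda>s. Im (wp (of_real s))) has_real_derivative 0) (at s)"
    proof (rule has_field_derivative_transform_within_open[of "\<lambda>_. - Im \<kappa>" _ _ "{0<..<\<omega>}"])
      fix r assume "r \<in> {0<..<\<omega>}"
      thus "- Im \<kappa> = Im (wp (of_real r))" by (simp add: k)
    qed (use s in auto)
    from DERIV_unique[OF dIm[OF s] this] show ?thesis .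
  qed
  show "Im (wp' (of_real (\<omega> / 4))) = 0" using im[of "\<omega> / 4"] \<omega>_pos by simp
  have nz: "Re (wp' (of_real s)) \<noteq> 0" if s: "0 < s" "s < \<omega> / 2" for s
  proof
    assume "Re (wp' (of_real s)) = 0"
    hence z: "wp' (of_real s) = 0" using im[of s] s by (simp add: complex_eq_iff)
    have nl: "of_real s \<notin> L" "- of_real s \<notin> L" using real_not_in_L[of s] s by (auto simp: L_uminus)
    have "of_real s - (- of_real s) \<in> L"
      by (rule wp_inj[OF nl]) (simp_all add: wp_minus wp'_minus[OF nl(1)] z)
    hence "of_real (2 * s) \<in> L" by simp
    thus False using real_not_in_L[of "2 * s"] s by simp
  qed
  have pos: "\<omega> / 4 < \<omega> / 2" using \<omega>_pos by simp
  obtain \<xi> where \<xi>: "\<omega> / 4 < \<xi>" "\<xi> < \<omega> / 2"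
    "Re (wp (of_real (\<omega> / 2))) - Re (wp (of_real (\<omega> / 4))) = (\<omega> / 2 - \<omega> / 4) * Re (wp' (of_real \<xi>))"
    using MVT2[OF pos, of "\<lambda>s. Re (wp (of_real s))" "\<lambda>s. Re (wp' (of_real s))"] dRe \<omega>_pos by auto
  have "Re (wp (of_real (\<omega> / 4)) - wp (of_real (\<omega> / 2))) > 0"
    unfolding wp_quarter_period using nu_pos sech_odd_pos[of "par / 2"] par_pos by simp
  hence "(\<omega> / 2 - \<omega> / 4) * Re (wp' (of_real \<xi>)) < 0" using \<xi>(3) by simp
  hence neg: "Re (wp' (of_real \<xi>)) < 0" using \<omega>_pos by (simp add: mult_less_0_iff)
  show "Re (wp' (of_real (\<omega> / 4))) < 0"
  proof (rule ccontr)
    assume "\<not> ?thesis"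
    moreover have "continuous_on {\<omega> / 4..\<xi>} (\<lambda>s. Re (wp' (of_real s)))"
    proof (intro continuous_intros continuous_on_compose2[OF holomorphic_on_imp_continuous_on[OF wp'_holomorphic]])
      show "complex_of_real ` {\<omega> / 4..\<xi>} \<subseteq> - L"
        using real_not_in_L \<xi> \<omega>_pos by (force simp del: of_real_divide)
    qed
    ultimately obtain s where "\<omega> / 4 \<le> s" "s \<le> \<xi>" "Re (wp' (of_real s)) = 0"
      using IVT2'[of "\<lambda>s. Re (wp' (of_real s))" \<xi> 0 "\<omega> / 4"] neg \<xi> by auto
    thus False using nz[of s] \<xi> \<omega>_pos by auto
  qed
qed

end

section \<open>Modular inversion\<close>

lemma period_lattice_scale:
  "period_lattice (c * \<omega>) (c * \<omega>') = (\<lambda>v. c * v) ` period_lattice \<omega> \<omega>'"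
proof (intro equalityI subsetI)
  fix v assume "v \<in> period_lattice (c * \<omega>) (c * \<omega>')"
  then obtain m n :: int where "v = c * (of_int m * \<omega> + of_int n * \<omega>')"
    by (auto simp: period_lattice_def algebra_simps)
  thus "v \<in> (\<lambda>v. c * v) ` period_lattice \<omega> \<omega>'" by (auto simp: period_lattice_def)
next
  fix v assume "v \<in> (\<lambda>v. c * v) ` period_lattice \<omega> \<omega>'"
  then obtain m n :: int where "v = of_int m * (c * \<omega>) + of_int n * (c * \<omega>')"
    by (auto simp: period_lattice_def algebra_simps)
  thus "v \<in> period_lattice (c * \<omega>) (c * \<omega>')" by (auto simp: period_lattice_def)
qed

lemma weierstrass_p_scale:
  assumes c: "c \<noteq> 0"
  shows "weierstrass_p (c * \<omega>) (c * \<omega>') (c * u) = weierstrass_p \<omega> \<omega>' u / c\<^sup>2"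
proof -
  let ?L = "period_lattice \<omega> \<omega>'"
  have "inj_on (\<lambda>v. c * v) (?L - {0})" using c by (auto simp: inj_on_def)
  moreover have im: "period_lattice (c * \<omega>) (c * \<omega>') - {0} = (\<lambda>v. c * v) ` (?L - {0})"
    unfolding period_lattice_scale using c by auto
  ultimately have "(\<Sum>\<^sub>\<infinity>v\<in>period_lattice (c * \<omega>) (c * \<omega>') - {0}. 1 / (c * u - v)\<^sup>2 - 1 / v\<^sup>2) =
     (\<Sum>\<^sub>\<infinity>v\<in>?L - {0}. 1 / (c * u - c * v)\<^sup>2 - 1 / (c * v)\<^sup>2)"
    unfolding im by (subst infsum_reindex) (auto simp: o_def)
  also have "\<dots> = (\<Sum>\<^sub>\<infinity>v\<in>?L - {0}. 1 / c\<^sup>2 * (1 / (u - v)\<^sup>2 - 1 / v\<^sup>2))"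
    by (simp only: right_diff_distrib[symmetric] power_mult_distrib) (simp add: right_diff_distrib)
  also have "\<dots> = 1 / c\<^sup>2 * (\<Sum>\<^sub>\<infinity>v\<in>?L - {0}. 1 / (u - v)\<^sup>2 - 1 / v\<^sup>2)"
    by (rule infsum_cmult_right')
  finally show ?thesis
    unfolding weierstrass_p_def using c by (simp add: power_mult_distrib field_simps)
qed

lemma period_lattice_rotate: "period_lattice \<omega>' (- \<omega>) = period_lattice \<omega> \<omega>'"
proof (intro equalityI subsetI)
  fix v assume "v \<in> period_lattice \<omega>' (- \<omega>)"
  then obtain m n :: int where "v = of_int m * \<omega>' + of_int n * (- \<omega>)" by (auto simp: period_lattice_def)
  hence "v = of_int (- n) * \<omega> + of_int m * \<omega>'" by simp
  thus "v \<in> period_lattice \<omega> \<omega>'" unfolding period_lattice_def by blast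
next
  fix v assume "v \<in> period_lattice \<omega> \<omega>'"
  then obtain m n :: int where "v = of_int m * \<omega> + of_int n * \<omega>'" by (auto simp: period_lattice_def)
  hence "v = of_int n * \<omega>' + of_int (- m) * (- \<omega>)" by simp
  thus "v \<in> period_lattice \<omega>' (- \<omega>)" unfolding period_lattice_def by blast
qed

text \<open>Multiplying the periods 1 and i/t by i t gives i t and -1, generators of the same
  lattice as 1 and i t.\<close>

lemma weierstrass_p_dual:
  assumes t: "t > 0"
  shows "weierstrass_p 1 (\<i> * of_real t) (\<i> * of_real t * u) = - weierstrass_p 1 (\<i> * of_real (1 / t)) u / (of_real t)\<^sup>2"
proof -
  have "weierstrass_p (\<i> * of_real t * 1) (\<i> * of_real t * (\<i> * of_real (1 / t))) (\<i> * of_real t * u) =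
     weierstrass_p 1 (\<i> * of_real (1 / t)) u / (\<i> * of_real t)\<^sup>2"
    by (rule weierstrass_p_scale) (use t in auto)
  moreover have "\<i> * of_real t * (\<i> * complex_of_real (1 / t)) = - 1" using t by simp
  moreover have "weierstrass_p (\<i> * of_real t) (- 1) = weierstrass_p 1 (\<i> * of_real t)"
    unfolding weierstrass_p_def period_lattice_rotate ..
  ultimately show ?thesis by (simp add: power_mult_distrib)
qed

text \<open>Multiplication by i t exchanges the real and the imaginary half period and fixes the
  third modulo periods and sign. So e1 - e2 is preserved up to a scalar, while e1 - e3 becomes e3 -
  e2 = (e1 - e2) - (e1 - e3) of the other lattice.\<close>

lemma sech_inversion:
  assumes t: "t > 0"
  shows "sech_even (pi / (2 * t)) = t * sech_even (pi * t / 2)"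
    and "(sech_odd (pi / (2 * t)))\<^sup>2 = t\<^sup>2 * ((sech_even (pi * t / 2))\<^sup>2 - (sech_odd (pi * t / 2))\<^sup>2)"
proof -
  interpret A: rectangular_lattice 1 t by standard (use t in auto)
  interpret B: rectangular_lattice 1 "1 / t" by standard (use t in auto)
  have Apar: "A.nu = pi / t" "A.par = pi / (2 * t)" by (simp_all add: A.par_def A.nu_def)
  have Bpar: "B.nu = pi * t" "B.par = pi * t / 2" using t by (simp_all add: B.par_def B.nu_def)
  let ?a = "weierstrass_p 1 (\<i> * of_real t)" and ?b = "weierstrass_p 1 (\<i> * of_real (1 / t))"
  define h where "h = complex_of_real (1 / 2)"
  have a1: "?a h = - ?b (\<i> * of_real (1 / t / 2)) / (of_real t)\<^sup>2"
  proof -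
    have "h = \<i> * of_real t * (- (\<i> * of_real (1 / t / 2)))" using t by (simp add: h_def)
    hence "?a h = - ?b (- (\<i> * of_real (1 / t / 2))) / (of_real t)\<^sup>2" using weierstrass_p_dual[OF t] by metis
    thus ?thesis using B.wp_minus by simp
  qed
  have a3: "?a (\<i> * of_real (t / 2)) = - ?b h / (of_real t)\<^sup>2"
  proof -
    have "\<i> * of_real (t / 2) = \<i> * of_real t * h" using t by (simp add: h_def)
    thus ?thesis using weierstrass_p_dual[OF t] by metis
  qed
  have a2: "?a (h + \<i> * of_real (t / 2)) = - ?b (h + \<i> * of_real (1 / t / 2)) / (of_real t)\<^sup>2"
  proof -
    have "h + \<i> * of_real (t / 2) = \<i> * of_real t * (h - \<i> * of_real (1 / t / 2))"
      using t by (simp add: h_def algebra_simps)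
    hence "?a (h + \<i> * of_real (t / 2)) = - ?b (h - \<i> * of_real (1 / t / 2)) / (of_real t)\<^sup>2"
      using weierstrass_p_dual[OF t] by metis
    also have "?b (h - \<i> * of_real (1 / t / 2)) = ?b (h - \<i> * of_real (1 / t / 2) + \<i> * of_real (1 / t))"
    proof -
      have "h - \<i> * of_real (1 / t / 2) \<notin> B.L"
        using B.fraction_not_int[of "1/2" 1] by (intro B.not_in_L_Re) (auto simp: h_def)
      from B.wp_periodic[OF this B.\<eta>_in_L] show ?thesis by simp
    qed
    also have "h - \<i> * of_real (1 / t / 2) + \<i> * of_real (1 / t) = h + \<i> * of_real (1 / t / 2)"
      by (simp add: complex_eq_iff h_def)
    finally show ?thesis .
  qed
  have d: "?a h - ?a (\<i> * of_real (t / 2)) = of_real ((pi / t)\<^sup>2 * (sech_even (pi / (2 * t)))\<^sup>2)"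
    "?a h - ?a (h + \<i> * of_real (t / 2)) = of_real ((pi / t)\<^sup>2 * (sech_odd (pi / (2 * t)))\<^sup>2)"
    using A.wp_half_period_differences unfolding Apar h_def by simp_all
  have d': "?b h - ?b (\<i> * of_real (1 / t / 2)) = of_real ((pi * t)\<^sup>2 * (sech_even (pi * t / 2))\<^sup>2)"
    "?b h - ?b (h + \<i> * of_real (1 / t / 2)) = of_real ((pi * t)\<^sup>2 * (sech_odd (pi * t / 2))\<^sup>2)"
    using B.wp_half_period_differences unfolding Bpar h_def by simp_all
  have t0: "complex_of_real t \<noteq> 0" using t by simp
  have "?a h - ?a (\<i> * of_real (t / 2)) = (?b h - ?b (\<i> * of_real (1 / t / 2))) / (of_real t)\<^sup>2"
    unfolding a1 a3 by (simp add: diff_divide_distrib)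
  hence "complex_of_real ((pi / t)\<^sup>2 * (sech_even (pi / (2 * t)))\<^sup>2) = of_real ((pi * t)\<^sup>2 * (sech_even (pi * t / 2))\<^sup>2 / t\<^sup>2)"
    unfolding d d' by simp
  hence "(pi / t)\<^sup>2 * (sech_even (pi / (2 * t)))\<^sup>2 = (pi * t)\<^sup>2 * (sech_even (pi * t / 2))\<^sup>2 / t\<^sup>2"
    by (simp only: of_real_eq_iff)
  hence "(sech_even (pi / (2 * t)))\<^sup>2 = (t * sech_even (pi * t / 2))\<^sup>2"
    using t by (simp add: power_divide power_mult_distrib field_simps)
  moreover have "sech_even (pi / (2 * t)) \<ge> 0" "t * sech_even (pi * t / 2) \<ge> 0"
    using sech_even_ge_1[of "pi / (2 * t)"] sech_even_ge_1[of "pi * t / 2"] t by auto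
  ultimately show "sech_even (pi / (2 * t)) = t * sech_even (pi * t / 2)"
    by (rule power2_eq_imp_eq)
  have "?a h - ?a (h + \<i> * of_real (t / 2)) = ((?b h - ?b (\<i> * of_real (1 / t / 2))) - (?b h - ?b (h + \<i> * of_real (1 / t / 2)))) / (of_real t)\<^sup>2"
    unfolding a1 a2 by (simp add: diff_divide_distrib)
  hence "complex_of_real ((pi / t)\<^sup>2 * (sech_odd (pi / (2 * t)))\<^sup>2) =
     of_real (((pi * t)\<^sup>2 * (sech_even (pi * t / 2))\<^sup>2 - (pi * t)\<^sup>2 * (sech_odd (pi * t / 2))\<^sup>2) / t\<^sup>2)"
    unfolding d d' by simp
  hence "(pi / t)\<^sup>2 * (sech_odd (pi / (2 * t)))\<^sup>2 =
     ((pi * t)\<^sup>2 * (sech_even (pi * t / 2))\<^sup>2 - (pi * t)\<^sup>2 * (sech_odd (pi * t / 2))\<^sup>2) / t\<^sup>2"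
    by (simp only: of_real_eq_iff)
  hence "pi\<^sup>2 * (sech_odd (pi / (2 * t)))\<^sup>2 =
     pi\<^sup>2 * (t\<^sup>2 * ((sech_even (pi * t / 2))\<^sup>2 - (sech_odd (pi * t / 2))\<^sup>2))"
    using t by (simp add: power_divide power_mult_distrib field_simps)
  thus "(sech_odd (pi / (2 * t)))\<^sup>2 = t\<^sup>2 * ((sech_even (pi * t / 2))\<^sup>2 - (sech_odd (pi * t / 2))\<^sup>2)"
    by simp
qed

section \<open>Mahler measures as dilogarithm series\<close>

text \<open>Inversion followed by Landen's transformation: both factors of E (E^2 - O^2) at x are
  expressed at y = pi^2/(2x), where they match the second moment E O (E + O).\<close>

lemma sech_inversion_double:
  assumes x: "x > 0"
  defines "y \<equiv> pi\<^sup>2 / (2 * x)"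
  shows "sech_even x = pi / (2 * x) * (sech_even y + sech_odd y)"
    and "(sech_even x)\<^sup>2 - (sech_odd x)\<^sup>2 = pi\<^sup>2 / x\<^sup>2 * (sech_even y * sech_odd y)"
proof -
  have y: "y / 2 > 0" using x by (simp add: y_def)
  define t where "t = pi / (2 * x)"
  have t: "t > 0" "pi / (2 * t) = x" "pi * t / 2 = y / 2"
    using x by (simp_all add: t_def y_def power2_eq_square)
  show "sech_even x = pi / (2 * x) * (sech_even y + sech_odd y)"
    using sech_inversion(1)[OF t(1)] sech_even_double[OF y] unfolding t(2,3) by (simp add: t_def)
  define r where "r = 2 * x / pi"
  have r: "r > 0" "pi / (2 * r) = y / 2" "pi * r / 2 = x"
    using x by (simp_all add: r_def y_def power2_eq_square)
  have "r\<^sup>2 * ((sech_even x)\<^sup>2 - (sech_odd x)\<^sup>2) = 4 * (sech_even y * sech_odd y)"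
    using sech_inversion(2)[OF r(1)] sech_odd_square_double[OF y] unfolding r(2,3) by simp
  moreover have "r\<^sup>2 = 4 * x\<^sup>2 / pi\<^sup>2" by (simp add: r_def power_divide power_mult_distrib)
  ultimately show "(sech_even x)\<^sup>2 - (sech_odd x)\<^sup>2 = pi\<^sup>2 / x\<^sup>2 * (sech_even y * sech_odd y)"
    using x by (simp add: field_simps)
qed

text \<open>The factor -4/pi is that of \<open>mahler_4\<close>: as x tends to 0 the inverted
  parameter tends to infinity and only the term n = 0 of the series is left.\<close>

definition dual_dilog :: "real \<Rightarrow> real" where
  "dual_dilog x = - (4 / pi) * dilog_series (pi\<^sup>2 / (2 * x))"

lemma has_derivative_dual_dilog:
  assumes x: "x > 0"
  shows "(dual_dilog has_real_derivative sech_even x * ((sech_even x)\<^sup>2 - (sech_odd x)\<^sup>2)) (at x)"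
proof -
  let ?y = "pi\<^sup>2 / (2 * x)"
  let ?E = "sech_even ?y" and ?O = "sech_odd ?y"
  have y: "?y > 0" using x by simp
  have "((\<lambda>x. pi\<^sup>2 / (2 * x)) has_real_derivative - (pi\<^sup>2 / (2 * x\<^sup>2))) (at x)"
    using x by (auto intro!: derivative_eq_intros simp: power2_eq_square)
  from DERIV_cmult[OF DERIV_chain2[where g = "\<lambda>x. pi\<^sup>2 / (2 * x)", OF has_derivative_dilog_series[OF y] this], of "- (4 / pi)"]
  have "(dual_dilog has_real_derivative - (4 / pi) * (?y / 2 * (?E * ?O * (?E + ?O)) * - (pi\<^sup>2 / (2 * x\<^sup>2)))) (at x)"
    unfolding dual_dilog_def[abs_def] .
  moreover have "- (4 / pi) * (?y / 2 * (?E * ?O * (?E + ?O)) * - (pi\<^sup>2 / (2 * x\<^sup>2))) =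
      (pi / (2 * x) * (?E + ?O)) * (pi\<^sup>2 / x\<^sup>2 * (?E * ?O))"
  proof -
    have "- (4 / pi) * (?y / 2 * (a * b * c) * - (pi\<^sup>2 / (2 * x\<^sup>2))) = (pi / (2 * x) * c) * (pi\<^sup>2 / x\<^sup>2 * (a * b))" for a b c
      using x by (simp add: field_simps power2_eq_square)
    thus ?thesis .
  qed
  ultimately show ?thesis
    unfolding sech_inversion_double(2)[OF x] unfolding sech_inversion_double(1)[OF x] by (simp only:)
qed

lemma dual_dilog_tendsto: "(dual_dilog \<longlongrightarrow> mahler 4) (at_right 0)"
proof -
  have "filterlim (\<lambda>x. pi\<^sup>2 / (2 * x)) at_top (at_right 0)" by real_asymp
  from filterlim_compose[OF dilog_series_tendsto this]
  show ?thesis unfolding dual_dilog_def[abs_def] mahler_4 by (intro tendsto_intros)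
qed

lemma isCont_mahler:
  assumes "k > 0"
  shows "isCont mahler k"
  using continuous_on_interior[OF continuous_on_mahler[of "k + 1"], of k] assms by simp

text \<open>Both sides have equal increments in x, and both tend to \<open>mahler 4\<close> as x
  tends to 0.\<close>

lemma mahler_ratio:
  assumes x: "x > 0"
  shows "mahler (4 * ratio x) = dual_dilog x"
proof -
  have "((\<lambda>z. 4 * ratio z) \<longlongrightarrow> 4 * 1) (at_right 0)"
    by (intro tendsto_intros ratio_tendsto_at_right_0)
  hence "((\<lambda>z. mahler (4 * ratio z)) \<longlongrightarrow> mahler 4) (at_right 0)"
    by (intro isCont_tendsto_compose[OF isCont_mahler]) auto
  from tendsto_diff[OF this dual_dilog_tendsto]
  have "((\<lambda>z. mahler (4 * ratio z) - dual_dilog z) \<longlongrightarrow> 0) (at_right 0)" by simp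
  moreover have "\<forall>\<^sub>F z in at_right 0. mahler (4 * ratio z) - dual_dilog z = mahler (4 * ratio x) - dual_dilog x"
    using eventually_at_right_less[of 0] eventually_at_right_real[OF x]
    by eventually_elim (use mahler_diff_ratio[OF _ _ has_derivative_dual_dilog, of _ x] in force)
  ultimately have "((\<lambda>z. mahler (4 * ratio x) - dual_dilog x) \<longlongrightarrow> 0) (at_right (0::real))"
    by (simp cong: tendsto_cong)
  thus ?thesis by (simp add: tendsto_const_iff)
qed

text \<open>By Landen's transformation E^2 - O^2 at z/2 is (E - O)^2 at z, so B = dual_dilog z - 2
  dual_dilog (z/2) has derivative (E - (E - O)) (E^2 - O^2) = O (E^2 - O^2), the negative of that of
  \<open>mahler (4 / ratio z)\<close>.\<close>

lemma mahler_inverse_ratio: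
  assumes x: "x > 0"
  shows "mahler (4 / ratio x) = 2 * dual_dilog (x / 2) - dual_dilog x"
proof -
  define B where "B z = dual_dilog z - 2 * dual_dilog (z / 2)" for z
  have dB: "(B has_real_derivative sech_odd z * ((sech_even z)\<^sup>2 - (sech_odd z)\<^sup>2)) (at z)" if z: "z > 0" for z
  proof -
    have z2: "z / 2 > 0" using z by simp
    have d: "((\<lambda>z. dual_dilog (z / 2)) has_real_derivative
       sech_even (z / 2) * ((sech_even (z / 2))\<^sup>2 - (sech_odd (z / 2))\<^sup>2) * (1 / 2)) (at z)"
      by (rule DERIV_chain2[where g = "\<lambda>z. z / 2", OF has_derivative_dual_dilog[OF z2]]) (auto intro!: derivative_eq_intros)
    have "(B has_real_derivative sech_even z * ((sech_even z)\<^sup>2 - (sech_odd z)\<^sup>2)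
       - 2 * (sech_even (z / 2) * ((sech_even (z / 2))\<^sup>2 - (sech_odd (z / 2))\<^sup>2) * (1 / 2))) (at z)"
      unfolding B_def[abs_def] by (intro DERIV_diff DERIV_cmult has_derivative_dual_dilog z d)
    moreover have "sech_even (z / 2) = sech_even z + sech_odd z" "(sech_odd (z / 2))\<^sup>2 = 4 * (sech_even z * sech_odd z)"
      using sech_even_double[OF z2] sech_odd_square_double[OF z2] by simp_all
    ultimately show ?thesis by (auto elim!: DERIV_cong simp: algebra_simps power2_eq_square)
  qed
  have half: "filterlim (\<lambda>z::real. z / 2) (at_right 0) (at_right 0)" by real_asymp
  have "((\<lambda>z. 4 / ratio z) \<longlongrightarrow> 4 / 1) (at_right 0)"
    by (intro tendsto_intros ratio_tendsto_at_right_0) simp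
  hence "((\<lambda>z. mahler (4 / ratio z)) \<longlongrightarrow> mahler 4) (at_right 0)"
    by (intro isCont_tendsto_compose[OF isCont_mahler]) auto
  moreover have "(B \<longlongrightarrow> mahler 4 - 2 * mahler 4) (at_right 0)"
    unfolding B_def[abs_def]
    by (intro tendsto_diff tendsto_mult tendsto_const dual_dilog_tendsto filterlim_compose[OF dual_dilog_tendsto half])
  ultimately have "((\<lambda>z. mahler (4 / ratio z) + B z) \<longlongrightarrow> mahler 4 + (mahler 4 - 2 * mahler 4)) (at_right 0)"
    by (rule tendsto_add)
  moreover have "\<forall>\<^sub>F z in at_right 0. mahler (4 / ratio z) + B z = mahler (4 / ratio x) + B x"
    using eventually_at_right_less[of 0] eventually_at_right_real[OF x]
    by eventually_elim (use mahler_diff_inverse_ratio[OF _ _ dB, of _ x] in force)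
  ultimately have "((\<lambda>z. mahler (4 / ratio x) + B x) \<longlongrightarrow> mahler 4 + (mahler 4 - 2 * mahler 4)) (at_right (0::real))"
    by (simp cong: tendsto_cong)
  hence "mahler (4 / ratio x) + B x = mahler 4 + (mahler 4 - 2 * mahler 4)" 
    by (intro tendsto_unique[OF _ tendsto_const]) simp_all
  thus ?thesis by (simp add: B_def)
qed

lemma ratio_half_square:
  assumes x: "x > 0"
  shows "(ratio (x / 2))\<^sup>2 = (ratio x + 1)\<^sup>2 / (4 * ratio x)"
proof -
  have x2: "x / 2 > 0" using x by simp
  have "sech_even (x / 2) = sech_even x + sech_odd x" "(sech_odd (x / 2))\<^sup>2 = 4 * (sech_even x * sech_odd x)"
    using sech_even_double[OF x2] sech_odd_square_double[OF x2] by simp_all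
  moreover have "(E + S)\<^sup>2 / (4 * (E * S)) = (E / S + 1)\<^sup>2 / (4 * (E / S))" if "E > 0" "S > 0" for E S :: real
    using that by (simp add: field_simps power2_eq_square)
  ultimately show ?thesis
    unfolding ratio_def power_divide using sech_odd_pos[OF x] sech_even_ge_1[OF x] by simp
qed

section \<open>Periods of the curves\<close>

text \<open>Without a quadratic term the three roots sum to 0; the differences from e1, which are
  what the column series provide, then determine e1 and both coefficients.\<close>

lemma cubic_coefficients_from_roots:
  fixes e1 e2 e3 a b :: complex
  assumes roots: "4 * e1 ^ 3 - a * e1 - b = 0" "4 * e2 ^ 3 - a * e2 - b = 0" "4 * e3 ^ 3 - a * e3 - b = 0"
    and ne: "e1 \<noteq> e2" "e1 \<noteq> e3" "e2 \<noteq> e3"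
  shows "3 * e1 = (e1 - e2) + (e1 - e3)"
    and "a = 12 * e1\<^sup>2 - 4 * ((e1 - e2) * (e1 - e3))"
    and "b = 4 * ((e1 - e2) * (e1 - e3)) * e1 - 8 * e1 ^ 3"
proof -
  have a: "4 * (r\<^sup>2 + r * s + s\<^sup>2) = a" if "4 * r ^ 3 - a * r - b = 0" "4 * s ^ 3 - a * s - b = 0" "r \<noteq> s" for r s
  proof -
    have "(r - s) * (4 * (r\<^sup>2 + r * s + s\<^sup>2) - a) = (4 * r ^ 3 - a * r - b) - (4 * s ^ 3 - a * s - b)"
      by (simp add: algebra_simps power2_eq_square power3_eq_cube)
    thus ?thesis using that by simp
  qed
  have 12: "4 * (e1\<^sup>2 + e1 * e2 + e2\<^sup>2) = a" and 13: "4 * (e1\<^sup>2 + e1 * e3 + e3\<^sup>2) = a"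
    using a[OF roots(1,2) ne(1)] a[OF roots(1,3) ne(2)] .
  have "(e2 - e3) * (4 * (e1 + e2 + e3)) = 4 * (e1\<^sup>2 + e1 * e2 + e2\<^sup>2) - 4 * (e1\<^sup>2 + e1 * e3 + e3\<^sup>2)"
    by (simp add: algebra_simps power2_eq_square)
  also have "\<dots> = 0" unfolding 12 13 by simp
  finally have "e1 + e2 + e3 = 0" using ne(3) by (simp only: mult_eq_0_iff) simp
  hence e3: "e3 = - e1 - e2" by (simp add: eq_neg_iff_add_eq_0 algebra_simps)
  show "3 * e1 = (e1 - e2) + (e1 - e3)" by (simp add: e3)
  show a2: "a = 12 * e1\<^sup>2 - 4 * ((e1 - e2) * (e1 - e3))"
    unfolding 12[symmetric] e3 by (simp add: algebra_simps power2_eq_square)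
  have "b = 4 * e1 ^ 3 - a * e1" using roots(1) by simp
  thus "b = 4 * ((e1 - e2) * (e1 - e3)) * e1 - 8 * e1 ^ 3"
    unfolding a2 by (simp add: algebra_simps power2_eq_square power3_eq_cube)
qed

text \<open>Here e is the abscissa of a real point of order 2, and p^2 is the product of its
  differences from the other two roots. For k > 4 and l > 0 it is the largest real root, by
  \<open>cubic_root_le\<close>.\<close>

lemma curve_eq:
  fixes k l :: real
  defines "e \<equiv> 3 / 2 * l * (k\<^sup>2 - 8)" and "p \<equiv> 18 * l"
  shows "curve k l = Weierstrass (12 * e\<^sup>2 - 4 * p\<^sup>2) (4 * p\<^sup>2 * e - 8 * e ^ 3)"
  unfolding curve_def e_def p_def weierstrass_curve.inject by algebra

text \<open>The cubic is \<open>4 (e' - e)\<close> times a factor that is positive beyond \<open>e\<close>.\<close>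

lemma cubic_root_le:
  fixes e p e' :: real
  assumes "e > 0" "p > 0" "4 * e' ^ 3 - (12 * e\<^sup>2 - 4 * p\<^sup>2) * e' - (4 * p\<^sup>2 * e - 8 * e ^ 3) = 0"
  shows "e' \<le> e"
proof (rule ccontr)
  assume "\<not> ?thesis"
  hence y: "e' - e > 0" by simp
  have "4 * e' ^ 3 - (12 * e\<^sup>2 - 4 * p\<^sup>2) * e' - (4 * p\<^sup>2 * e - 8 * e ^ 3) =
     4 * (e' - e) * ((e' - e)\<^sup>2 + 3 * e * (e' - e) + p\<^sup>2)"
    by algebra
  moreover have "4 * (e' - e) * ((e' - e)\<^sup>2 + 3 * e * (e' - e) + p\<^sup>2) > 0"
    using y assms(1,2) by (intro mult_pos_pos add_pos_pos) auto
  ultimately show False using assms(3) by linarith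
qed

text \<open>The largest real root e depends on the curve alone; the coefficient of x then gives p,
  and e and p give l and k.\<close>

lemma curve_inject:
  assumes k: "k > 4" "l > 0" and k': "k' > 4" "l' > 0" and eq: "curve k l = curve k' l'"
  shows "k = k'" "l = l'"
proof -
  define e p e' p' where defs: "e = 3 / 2 * l * (k\<^sup>2 - 8)" "p = 18 * l" "e' = 3 / 2 * l' * (k'\<^sup>2 - 8)" "p' = 18 * l'"
  have g: "12 * e\<^sup>2 - 4 * p\<^sup>2 = 12 * e'\<^sup>2 - 4 * p'\<^sup>2" "4 * p\<^sup>2 * e - 8 * e ^ 3 = 4 * p'\<^sup>2 * e' - 8 * e' ^ 3"
    using eq unfolding curve_eq defs by simp_all
  have sq: "r\<^sup>2 > 8" if "r > 4" for r :: real
    using power_strict_mono[of 4 r 2] that by simp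
  have pos: "e > 0" "p > 0" "e' > 0" "p' > 0"
    using k k' sq[of k] sq[of k'] by (simp_all add: defs)
  have r: "4 * e ^ 3 - (12 * e\<^sup>2 - 4 * p\<^sup>2) * e - (4 * p\<^sup>2 * e - 8 * e ^ 3) = 0" for e p :: real by algebra
  have "e' \<le> e" by (rule cubic_root_le[OF pos(1,2)]) (use r[of e' p'] g in simp)
  moreover have "e \<le> e'" by (rule cubic_root_le[OF pos(3,4)]) (use r[of e p] g in simp)
  ultimately have e: "e = e'" by simp
  with g(1) have "p\<^sup>2 = p'\<^sup>2" by simp
  hence "p = p'" using pos by (simp add: power2_eq_iff_nonneg)
  thus l: "l = l'" by (simp add: defs)
  with e k have "k\<^sup>2 = k'\<^sup>2" by (simp add: defs)
  thus "k = k'" using k k' by (simp add: power2_eq_iff_nonneg)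
qed

text \<open>The points over x = 0 determine g3, and those over x = 1 then determine g2.\<close>

lemma affine_points_inject:
  assumes "affine_points E = affine_points F"
  shows "E = F"
proof -
  have *: "of_real (4 * x ^ 3 - g2 E * x - g3 E) = complex_of_real (4 * x ^ 3 - g2 F * x - g3 F)" for x
  proof -
    let ?y = "csqrt (of_real (4 * x ^ 3 - g2 E * x - g3 E))"
    have "(of_real x, ?y) \<in> affine_points E" by (simp add: affine_points_def)
    hence "(of_real x, ?y) \<in> affine_points F" using assms by simp
    thus ?thesis by (simp add: affine_points_def)
  qed
  from *[of 0] *[of 1] show ?thesis
    unfolding of_real_eq_iff by (intro weierstrass_curve.expand) auto
qed

context rectangular_lattice
begin

text \<open>The half-period differences nu^2 E^2 and nu^2 S^2 at \<open>par\<close> give p = nu^2 E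
  S, so 18 l = p fixes l, and e1 = 3 l (k^2 - 8)/2 fixes k. Landen's transformation expresses both
  at par/2.\<close>

lemma period_curve:
  defines "k \<equiv> 4 * ratio (par / 2)" and "l \<equiv> nu\<^sup>2 * (sech_odd (par / 2))\<^sup>2 / 72"
  shows "(\<lambda>u. (wp u, wp' u)) ` (- L) = affine_points (curve k l)"
    and "wp (of_real (\<omega> / 4)) = of_real (3 / 2 * l * (k\<^sup>2 + 4))"
proof -
  define E S where "E = sech_even par" and "S = sech_odd par"
  have ES: "E > 0" "S > 0" "S < E"
    using sech_even_ge_1[OF par_pos] sech_odd_pos[OF par_pos] sech_odd_less_even[OF par_pos] by (auto simp: E_def S_def)
  have x2: "par / 2 > 0" using par_pos by simp
  have half: "sech_even (par / 2) = E + S" "(sech_odd (par / 2))\<^sup>2 = 4 * (E * S)"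
    using sech_even_double[OF x2] sech_odd_square_double[OF x2] by (simp_all add: E_def S_def)
  have k2: "k\<^sup>2 = 4 * (E + S)\<^sup>2 / (E * S)" and l: "l = nu\<^sup>2 * (E * S) / 18"
  proof -
    have "k\<^sup>2 = 16 * ((E + S)\<^sup>2 / (4 * (E * S)))"
      unfolding k_def ratio_def power_mult_distrib power_divide half by simp
    thus "k\<^sup>2 = 4 * (E + S)\<^sup>2 / (E * S)" by simp
    show "l = nu\<^sup>2 * (E * S) / 18" using half by (simp add: l_def)
  qed
  define e1 e2 e3 where e: "e1 = wp (of_real (\<omega> / 2))" "e2 = wp (\<i> * of_real (\<eta> / 2))"
    "e3 = wp (of_real (\<omega> / 2) + \<i> * of_real (\<eta> / 2))"
  have d: "e1 - e2 = of_real (nu\<^sup>2 * E\<^sup>2)" "e1 - e3 = of_real (nu\<^sup>2 * S\<^sup>2)"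
    unfolding e E_def S_def by (rule wp_half_period_differences)+
  have "e1 - e2 \<noteq> 0" "e1 - e3 \<noteq> 0" using ES nu_pos by (auto simp: d)
  moreover have "e2 \<noteq> e3"
  proof
    assume "e2 = e3"
    hence "nu\<^sup>2 * E\<^sup>2 = nu\<^sup>2 * S\<^sup>2" using d by (metis of_real_eq_iff)
    hence "E = S" using nu_pos ES by (simp add: power2_eq_iff_nonneg)
    thus False using ES by simp
  qed
  ultimately have ne: "e1 \<noteq> e2" "e1 \<noteq> e3" "e2 \<noteq> e3" by auto
  obtain a b where ab: "\<And>u. u \<notin> L \<Longrightarrow> (wp' u)\<^sup>2 = 4 * (wp u) ^ 3 - a * wp u - b"
    using wp_differential_equation by blast
  have z: "4 * (wp v) ^ 3 - a * wp v - b = 0" if "2 * v \<in> L" "v \<notin> L" for v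
    using ab[OF that(2)] wp'_half_period[of "2 * v"] that by simp
  have "2 * complex_of_real (\<omega> / 2) = of_real \<omega>" "2 * (\<i> * complex_of_real (\<eta> / 2)) = \<i> * of_real \<eta>"
    "2 * (complex_of_real (\<omega> / 2) + \<i> * of_real (\<eta> / 2)) = of_real \<omega> + \<i> * of_real \<eta>" by simp_all
  hence h: "2 * of_real (\<omega> / 2) \<in> L" "2 * (\<i> * of_real (\<eta> / 2)) \<in> L"
    "2 * (of_real (\<omega> / 2) + \<i> * of_real (\<eta> / 2)) \<in> L"
    using \<omega>_in_L \<eta>_in_L L_add[OF \<omega>_in_L \<eta>_in_L] by (simp_all only:)
  have roots: "4 * e1 ^ 3 - a * e1 - b = 0" "4 * e2 ^ 3 - a * e2 - b = 0" "4 * e3 ^ 3 - a * e3 - b = 0"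
    unfolding e by (fact z[OF h(1) half_periods_not_in_L(1)] z[OF h(2) half_periods_not_in_L(2)] z[OF h(3) half_periods_not_in_L(3)])+
  note coeffs = cubic_coefficients_from_roots[OF roots ne]
  have "3 * (nu\<^sup>2 * (E\<^sup>2 + S\<^sup>2) / 3) = nu\<^sup>2 * E\<^sup>2 + nu\<^sup>2 * S\<^sup>2" by (simp add: algebra_simps)
  hence "3 * complex_of_real (nu\<^sup>2 * (E\<^sup>2 + S\<^sup>2) / 3) = 3 * e1"
    unfolding coeffs(1) d by (metis of_real_add of_real_mult of_real_numeral)
  hence "e1 = of_real (nu\<^sup>2 * (E\<^sup>2 + S\<^sup>2) / 3)" by (simp only: mult_cancel_left) simp
  also have "nu\<^sup>2 * (E\<^sup>2 + S\<^sup>2) / 3 = 3 / 2 * l * (k\<^sup>2 - 8)"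
    unfolding k2 l using ES by (simp add: field_simps power2_eq_square)
  finally have e1: "e1 = of_real (3 / 2 * l * (k\<^sup>2 - 8))" .
  have pp: "(e1 - e2) * (e1 - e3) = of_real ((18 * l)\<^sup>2)"
    unfolding d l by (simp add: power_mult_distrib power2_eq_square)
  have "a = of_real (g2 (curve k l))" "b = of_real (g3 (curve k l))"
    unfolding coeffs(2) coeffs(3) pp unfolding e1 curve_eq by simp_all
  thus "(\<lambda>u. (wp u, wp' u)) ` (- L) = affine_points (curve k l)"
    using wp_image[OF ab] unfolding affine_points_def by simp
  have "wp (of_real (\<omega> / 4)) = e1 + of_real (nu\<^sup>2 * (sech_odd (par / 2))\<^sup>2 / 4)"
    unfolding wp_quarter_period[symmetric] by (simp add: e)
  also have "nu\<^sup>2 * (sech_odd (par / 2))\<^sup>2 / 4 = 18 * l" by (simp add: l_def)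
  finally show "wp (of_real (\<omega> / 4)) = of_real (3 / 2 * l * (k\<^sup>2 + 4))"
    unfolding e1 by (simp add: algebra_simps)
qed

text \<open>A point set determines its curve, the curve determines k and l, and \<open>ratio\<close>
  is injective; so admissible periods are the solutions of two real equations. This settles
  existence and uniqueness at once.\<close>

lemma rectangular_periods_iff:
  assumes x: "x > 0" and l: "l > 0"
  shows "rectangular_periods (curve (4 * ratio x) l) (of_real \<omega>) (\<i> * of_real \<eta>) \<longleftrightarrow>
    par / 2 = x \<and> nu\<^sup>2 * (sech_odd (par / 2))\<^sup>2 / 72 = l"
proof -
  have x2: "par / 2 > 0" using par_pos by simp
  let ?l = "nu\<^sup>2 * (sech_odd (par / 2))\<^sup>2 / 72"
  have l': "?l > 0" using nu_pos sech_odd_pos[OF x2] by simp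
  have k: "4 * ratio y > 4" if "y > 0" for y using ratio_gt_1[OF that] by simp
  have "Im (\<i> * of_real \<eta> / of_real \<omega>) > 0" using \<omega>_pos \<eta>_pos by simp
  hence "rectangular_periods (curve (4 * ratio x) l) (of_real \<omega>) (\<i> * of_real \<eta>) \<longleftrightarrow>
     affine_points (curve (4 * ratio (par / 2)) ?l) = affine_points (curve (4 * ratio x) l)"
    unfolding rectangular_periods_def period_curve(1)[symmetric] wp'_def using \<omega>_pos by simp
  also have "\<dots> \<longleftrightarrow> curve (4 * ratio (par / 2)) ?l = curve (4 * ratio x) l"
    using affine_points_inject by auto
  also have "\<dots> \<longleftrightarrow> ratio (par / 2) = ratio x \<and> ?l = l"
  proof
    assume eq: "curve (4 * ratio (par / 2)) ?l = curve (4 * ratio x) l"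
    show "ratio (par / 2) = ratio x \<and> ?l = l"
      using curve_inject[OF k[OF x2] l' k[OF x] l eq] by (simp only: mult_cancel_left) simp
  qed (simp only:)
  also have "\<dots> \<longleftrightarrow> par / 2 = x \<and> ?l = l" by (simp only: ratio_eq_iff[OF x2 x])
  finally show ?thesis .
qed

text \<open>The abscissa fixes the ordinate up to sign. \<open>wp'\<close> is negative at
  \<omega>/4, so a positive ordinate is that of -\<omega>/4, and \<open>wp_inj\<close> leaves only
  its translates by periods.\<close>

lemma quarter_period_point:
  assumes u: "u \<notin> L" and X: "wp u = wp (of_real (\<omega> / 4))" and Y: "wp' u = of_real Y" "Y > 0"
  obtains m n :: int where "u = - of_real (\<omega> / 4) + of_int m * of_real \<omega> + of_int n * (\<i> * of_real \<eta>)"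
proof -
  let ?q = "complex_of_real (\<omega> / 4)"
  have q: "?q \<notin> L" by (rule real_not_in_L) (use \<omega>_pos in auto)
  have q': "- ?q \<notin> L" using q L_uminus by blast
  obtain a b where ab: "\<And>u. u \<notin> L \<Longrightarrow> (wp' u)\<^sup>2 = 4 * (wp u) ^ 3 - a * wp u - b"
    using wp_differential_equation by blast
  define y where "y = - Re (wp' ?q)"
  have y: "y > 0" and wy: "wp' (- ?q) = of_real y"
    using wp'_quarter_period unfolding wp'_minus[OF q] by (simp_all add: y_def complex_eq_iff del: of_real_divide)
  have "(wp' u)\<^sup>2 = (wp' (- ?q))\<^sup>2" using ab[OF u] ab[OF q'] X by (simp add: wp_minus)
  hence "complex_of_real (Y\<^sup>2) = of_real (y\<^sup>2)" unfolding Y wy by simp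
  hence "Y = y" using Y(2) y by (simp add: power2_eq_iff_nonneg del: of_real_power)
  hence "u - (- ?q) \<in> L" by (intro wp_inj[OF u q']) (simp_all only: X wp_minus Y wy)
  then obtain m n :: int where "u - (- ?q) = of_int m * of_real \<omega> + of_int n * (\<i> * of_real \<eta>)"
    by (auto simp: period_lattice_def)
  hence "u = - ?q + of_int m * of_real \<omega> + of_int n * (\<i> * of_real \<eta>)" by (simp add: algebra_simps)
  thus thesis by (rule that)
qed

text \<open>For this u the base exp (2 pi i u/\<omega>) is -i q^n: the multiple of \<omega>
  disappears, and the multiple of i \<eta> merely shifts the summation index.\<close>

lemma quarter_period_dilog:
  assumes u: "u = - of_real (\<omega> / 4) + of_int m * of_real \<omega> + of_int n * (\<i> * of_real \<eta>)"
  shows "(\<Sum>\<^sub>\<infinity>j::int. bloch_wigner (exp (2 * of_real pi * \<i> * u / of_real \<omega>) *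
           exp (2 * of_real pi * \<i> * (\<i> * of_real \<eta> / of_real \<omega>)) powi j)) = dilog_series (pi\<^sup>2 / par)"
proof -
  define s where "s = pi\<^sup>2 / par"
  have s: "s = 2 * pi * \<eta> / \<omega>" using \<omega>_pos \<eta>_pos by (simp add: s_def par_def nu_def power2_eq_square)
  have "2 * of_real pi * \<i> * u / of_real \<omega> = - (\<i> * of_real (pi / 2)) + 2 * of_int m * of_real pi * \<i> + of_real (- (of_int n * s))"
    using \<omega>_pos by (simp add: u s field_simps)
  moreover have "exp (- (\<i> * complex_of_real (pi / 2))) = - \<i>"
    using cis_conv_exp[of "- pi / 2"] cis_minus_pi_half by (simp add: cis_minus_pi_half)
  moreover have "exp (2 * of_int m * of_real pi * \<i>) = 1" 
    using exp_integer_2pi[of "of_int m"] by (simp add: mult_ac)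
  ultimately have U: "exp (2 * of_real pi * \<i> * u / of_real \<omega>) = - \<i> * of_real (exp (- (of_int n * s)))"
    by (simp only: exp_add mult_1_right exp_of_real)
  have "2 * of_real pi * \<i> * (\<i> * of_real \<eta> / of_real \<omega>) = complex_of_real (- s)"
    using \<omega>_pos by (simp add: s field_simps)
  hence q: "exp (2 * of_real pi * \<i> * (\<i> * of_real \<eta> / of_real \<omega>)) powi j = of_real (exp (- (of_int j * s)))" for j
    by (simp only: exp_of_real exp_power_int of_real_power_int[symmetric]) (simp add: exp_of_real[symmetric])
  have t: "bloch_wigner (- \<i> * of_real (exp (- (of_int n * s))) * of_real (exp (- (of_int j * s)))) =
      dilog_imag (exp (- (of_int (n + j) * s)))" for j
  proof -
    have "exp (- (of_int n * s)) * exp (- (of_int j * s)) = exp (- (of_int (n + j) * s))"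
      by (simp add: exp_add[symmetric] algebra_simps)
    hence "- \<i> * of_real (exp (- (of_int n * s))) * of_real (exp (- (of_int j * s))) =
        - \<i> * complex_of_real (exp (- (of_int (n + j) * s)))"
      by (metis mult.assoc of_real_mult)
    thus ?thesis by (simp only: bloch_wigner_imag exp_gt_zero)
  qed
  have "bij_betw (\<lambda>j. n + j) UNIV (UNIV :: int set)"
    by (rule bij_betwI[of _ _ _ "\<lambda>j. j - n"]) auto
  hence "(\<Sum>\<^sub>\<infinity>j. dilog_imag (exp (- (of_int (n + j) * s)))) = dilog_series s"
    unfolding dilog_series_def by (rule infsum_reindex_bij_betw)
  thus ?thesis unfolding U q t by (simp only: s_def)
qed

end

text \<open>The first two assumptions provide an admissible triple, so the choice operator returns
  one; constancy of the sum over all admissible triples then fixes the value.\<close>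

lemma elliptic_dilog_eqI:
  assumes "rectangular_periods E \<omega>0 \<omega>0'" "P \<in> affine_points E"
    and eq: "\<And>\<omega> \<omega>' u. rectangular_periods E \<omega> \<omega>' \<Longrightarrow> u \<notin> period_lattice \<omega> \<omega>' \<Longrightarrow>
      (weierstrass_p \<omega> \<omega>' u, deriv (weierstrass_p \<omega> \<omega>') u) = P \<Longrightarrow>
      (\<Sum>\<^sub>\<infinity>n::int. bloch_wigner (exp (2 * of_real pi * \<i> * u / \<omega>) * exp (2 * of_real pi * \<i> * (\<omega>' / \<omega>)) powi n)) = c"
  shows "elliptic_dilog E P = c"
proof -
  define Q where "Q = (\<lambda>(\<omega>, \<omega>', u). rectangular_periods E \<omega> \<omega>' \<and> u \<notin> period_lattice \<omega> \<omega>' \<and>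
               (weierstrass_p \<omega> \<omega>' u, deriv (weierstrass_p \<omega> \<omega>') u) = P)"
  obtain u where "u \<notin> period_lattice \<omega>0 \<omega>0'" "(weierstrass_p \<omega>0 \<omega>0' u, deriv (weierstrass_p \<omega>0 \<omega>0') u) = P"
    using assms(1,2) unfolding rectangular_periods_def by (metis (no_types, lifting) ComplD imageE)
  hence "Q (\<omega>0, \<omega>0', u)" using assms(1) by (simp add: Q_def)
  hence Q: "Q (Eps Q)" by (rule someI)
  obtain \<omega> \<omega>' v where T: "Eps Q = (\<omega>, \<omega>', v)" by (cases "Eps Q") auto
  have "elliptic_dilog E P = (\<Sum>\<^sub>\<infinity>n::int. bloch_wigner (exp (2 * of_real pi * \<i> * v / \<omega>) * exp (2 * of_real pi * \<i> * (\<omega>' / \<omega>)) powi n))"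
    unfolding elliptic_dilog_def Q_def[symmetric] T by simp
  also have "\<dots> = c" using Q unfolding T by (intro eq) (simp_all add: Q_def)
  finally show ?thesis .
qed

lemma elliptic_dilog_curve:
  fixes x l X Y :: real
  assumes x: "x > 0" and l: "l > 0" and X: "X = 3 / 2 * l * ((4 * ratio x)\<^sup>2 + 4)" and Y: "Y > 0"
    and P: "(of_real X, of_real Y) \<in> affine_points (curve (4 * ratio x) l)"
  shows "elliptic_dilog (curve (4 * ratio x) l) (of_real X, of_real Y) = dilog_series (pi\<^sup>2 / (2 * x))"
proof -
  \<comment> \<open>\<open>h\<close> and \<open>w\<close> solve the two equations of
    \<open>rectangular_periods_iff\<close>: with nu = pi/h the one for l gives \<open>h\<close>, and
    par = 2 x gives \<open>w\<close>.\<close>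
  define h where "h = pi * sech_odd x / sqrt (72 * l)"
  define w where "w = 4 * x * h / pi"
  have h: "h > 0" using sech_odd_pos[OF x] l by (simp add: h_def)
  have w: "w > 0" using h x by (simp add: w_def)
  show ?thesis
  proof (rule elliptic_dilog_eqI[OF _ P])
    interpret rectangular_lattice w h by standard (rule w h)+
    have p: "par / 2 = x" using h unfolding par_def nu_def by (simp add: w_def)
    have "h\<^sup>2 = pi\<^sup>2 * (sech_odd x)\<^sup>2 / (72 * l)" using l by (simp add: h_def power_divide power_mult_distrib)
    hence "nu\<^sup>2 * (sech_odd (par / 2))\<^sup>2 / 72 = l"
      unfolding p using l h by (simp add: nu_def power_divide field_simps)
    thus "rectangular_periods (curve (4 * ratio x) l) (of_real w) (\<i> * of_real h)"
      using rectangular_periods_iff[OF x l] p by blast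
  next
    fix \<omega> \<omega>' u :: complex
    assume R: "rectangular_periods (curve (4 * ratio x) l) \<omega> \<omega>'" and u: "u \<notin> period_lattice \<omega> \<omega>'"
      and uP: "(weierstrass_p \<omega> \<omega>' u, deriv (weierstrass_p \<omega> \<omega>') u) = (of_real X, of_real Y)"
    define w h where "w = Re \<omega>" and "h = Im \<omega>'"
    have \<omega>: "\<omega> = of_real w" "\<omega>' = \<i> * of_real h"
      using R by (auto simp: rectangular_periods_def w_def h_def complex_eq_iff)
    have w: "w > 0" using R by (simp add: rectangular_periods_def w_def)
    moreover have "Im (\<i> * of_real h / of_real w) > 0" using R \<omega> by (simp only: rectangular_periods_def)
    ultimately have h: "h > 0" by (simp add: zero_less_divide_iff)
    interpret rectangular_lattice w h by standard (rule w h)+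
    have pl: "par / 2 = x" "nu\<^sup>2 * (sech_odd (par / 2))\<^sup>2 / 72 = l"
      using R rectangular_periods_iff[OF x l] unfolding \<omega> by blast+
    have "wp (of_real (w / 4)) = of_real X"
      using period_curve(2) unfolding pl(2) unfolding pl(1) X .
    hence Xu: "wp u = wp (of_real (w / 4))" and Yu: "wp' u = of_real Y"
      using uP unfolding \<omega> wp'_def by simp_all
    obtain m n :: int where mn: "u = - of_real (w / 4) + of_int m * of_real w + of_int n * (\<i> * of_real h)"
      using quarter_period_point[OF u[unfolded \<omega>] Xu Yu Y] by blast
    have "par = 2 * x" using pl by simp
    thus "(\<Sum>\<^sub>\<infinity>n::int. bloch_wigner (exp (2 * of_real pi * \<i> * u / \<omega>) * exp (2 * of_real pi * \<i> * (\<omega>' / \<omega>)) powi n)) =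
        dilog_series (pi\<^sup>2 / (2 * x))"
      using quarter_period_dilog[OF mn] unfolding \<omega> by simp
  qed
qed

theorem theorem5:
  shows "(11 * mahler 1 = mahler 16 \<longleftrightarrow>
            11 * elliptic_dilog (curve 5 2) (87, 1080)
              = 6 * elliptic_dilog (curve 16 (1/2)) (195, 432))
       \<and> (4 * mahler 2 = mahler 8 \<longleftrightarrow>
            5 * elliptic_dilog (curve 8 (1/2)) (51, 216)
              = 8 * elliptic_dilog (curve (3 * sqrt 2) 1) (33, 324))"
proof (intro conjI)
  obtain x where x: "x > 0" "ratio x = 4" using ratio_surj[of 4] by auto
  have x2: "x / 2 > 0" using x by simp
  have "(ratio (x / 2))\<^sup>2 = (5 / 4)\<^sup>2" unfolding ratio_half_square[OF x(1)] x(2) by (simp add: power2_eq_square)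
  hence r: "ratio (x / 2) = 5 / 4" using ratio_gt_1[OF x2] by (simp add: power2_eq_iff_nonneg del: power_divide)
  have D: "elliptic_dilog (curve 16 (1/2)) (195, 432) = dilog_series (pi\<^sup>2 / (2 * x))"
    using elliptic_dilog_curve[OF x(1), of "1/2" 195 432] curve_points(2) by (simp add: x)
  have D2: "elliptic_dilog (curve 5 2) (87, 1080) = dilog_series (pi\<^sup>2 / (2 * (x / 2)))"
    using elliptic_dilog_curve[OF x2, of 2 87 1080] curve_points(1) by (simp add: r)
  have M: "mahler 16 = dual_dilog x" "mahler 1 = 2 * dual_dilog (x / 2) - dual_dilog x"
    using mahler_ratio[OF x(1)] mahler_inverse_ratio[OF x(1)] by (simp_all add: x(2))
  \<comment> \<open>With A for \<open>dual_dilog\<close>, 11 (2 A(x/2) - A(x)) = A(x) amounts to 22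
    A(x/2) = 12 A(x).\<close>
  have "11 * mahler 1 = mahler 16 \<longleftrightarrow> 11 * dual_dilog (x / 2) = 6 * dual_dilog x" unfolding M by auto
  also have "\<dots> \<longleftrightarrow> 11 * dilog_series (pi\<^sup>2 / (2 * (x / 2))) = 6 * dilog_series (pi\<^sup>2 / (2 * x))"
    unfolding dual_dilog_def by (simp add: field_simps)
  finally show "11 * mahler 1 = mahler 16 \<longleftrightarrow>
            11 * elliptic_dilog (curve 5 2) (87, 1080) = 6 * elliptic_dilog (curve 16 (1/2)) (195, 432)"
    unfolding D D2 .
next
  obtain x where x: "x > 0" "ratio x = 2" using ratio_surj[of 2] by auto
  have x2: "x / 2 > 0" using x by simp
  have "(ratio (x / 2))\<^sup>2 = (3 / 4 * sqrt 2)\<^sup>2" unfolding ratio_half_square[OF x(1)] x(2) by (simp add: power_mult_distrib power2_eq_square)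
  hence r: "ratio (x / 2) = 3 / 4 * sqrt 2" using ratio_gt_1[OF x2] by (subst (asm) power2_eq_iff_nonneg) auto
  have D: "elliptic_dilog (curve 8 (1/2)) (51, 216) = dilog_series (pi\<^sup>2 / (2 * x))"
    using elliptic_dilog_curve[OF x(1), of "1/2" 51 216] curve_points(3) by (simp add: x)
  have D2: "elliptic_dilog (curve (3 * sqrt 2) 1) (33, 324) = dilog_series (pi\<^sup>2 / (2 * (x / 2)))"
    using elliptic_dilog_curve[OF x2, of 1 33 324] curve_points(4) by (simp add: r power_mult_distrib)
  have M: "mahler 8 = dual_dilog x" "mahler 2 = 2 * dual_dilog (x / 2) - dual_dilog x"
    using mahler_ratio[OF x(1)] mahler_inverse_ratio[OF x(1)] by (simp_all add: x(2))
  \<comment> \<open>Here 4 (2 A(x/2) - A(x)) = A(x) amounts to 8 A(x/2) = 5 A(x).\<close>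
  have "4 * mahler 2 = mahler 8 \<longleftrightarrow> 5 * dual_dilog x = 8 * dual_dilog (x / 2)" unfolding M by auto
  also have "\<dots> \<longleftrightarrow> 5 * dilog_series (pi\<^sup>2 / (2 * x)) = 8 * dilog_series (pi\<^sup>2 / (2 * (x / 2)))"
    unfolding dual_dilog_def by (simp add: field_simps)
  finally show "4 * mahler 2 = mahler 8 \<longleftrightarrow>
            5 * elliptic_dilog (curve 8 (1/2)) (51, 216) = 8 * elliptic_dilog (curve (3 * sqrt 2) 1) (33, 324)"
    unfolding D D2 .
qed

end
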